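(* Let $X_1,X_2\in B(\mathcal H)$ be the bounded free random variables described in the context, with $\varphi$-distributions $\mu_1,\mu_2$, and suppose that $X_1$ and $X_2$ are positive. Then there exists a decomposition $$\sqrt{X_1}\,X_2\sqrt{X_1}=\sqrt{y}\,Y\sqrt{y}$$ with positive operators $y,Y\in B(\mathcal H)$ such that the $\varphi$-distributions of $y$ and $Y$ are $\mu_1$ and $\mu_2\boxtimes_s\mu_1$ respectively, and the pair $(y-1,Y-1)$ is monotone independent with respect to $\varphi$. Moreover, the $\varphi$-distribution of $Y$ agrees with that of $\sqrt{R_1^{\rm even}}\,R_2^{\rm odd}\sqrt{R_1^{\rm even}}$, and the pair $(R_2^{\rm odd}-1_{\mathcal K_2},\,R_1^{\rm even}-1_{\mathcal K_2})$ is s-free independent with respect to $(\varphi,\psi)$, where $\psi$ is the state associated with any unit vector $\zeta\in\mathcal H_2^0$.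
   Context: Free product setting. $I=\{1,2\}$, $\bar 1=2$, $\bar 2=1$. $(\mathcal H_\iota,\xi_\iota)$, $\iota\in I$, are Hilbert spaces with distinguished unit vectors, $\mathcal H_\iota^0=\mathcal H_\iota\ominus\mathbb C\xi_\iota$. Their free product is $(\mathcal H,\xi)$, $\mathcal H=\mathbb C\xi\oplus\bigoplus_{n\ge1}\bigoplus_{\iota_1\ne\iota_2\ne\dots\ne\iota_n}\mathcal H_{\iota_1}^0\otimes\dots\otimes\mathcal H_{\iota_n}^0$. For $n\ge1$, $\mathcal H^{(n)}(\iota)$ is the direct sum of those $\mathcal H_{\iota_1}^0\otimes\dots\otimes\mathcal H_{\iota_n}^0$ ($\iota_1\neq\dots\neq\iota_n$) with $\iota_1\ne\iota$; $\mathcal H^{(0)}(\iota)=\mathbb C\xi$. For each $\iota$, $\mathcal H=\bigoplus_{n\ge1}\big(\mathcal H^{(n-1)}(\iota)\oplus\mathcal H^{(n)}(\bar\iota)\big)$ and $P_\iota(n)$ is the orthogonal projection onto the $n$-th summand; $P_\xi$ is the projection onto $\mathbb C\xi$. $\lambda$ denotes the free product representation: $a\in B(\mathcal H_\iota)$ acts as $a\otimes1$ under the natural unitary $\mathcal H\cong\mathcal H_\iota\otimes\bigoplus_{n\ge0}\mathcal H^{(n)}(\iota)$. For $x\in B(\mathcal H_1)$, $y_0\in B(\mathcal H_2)$ put $X_1=\lambda(x)$, $X_2=\lambda(y_0)$; these are free with respect to the vacuum state $\varphi(\cdot)=\langle\cdot\,\xi,\xi\rangle$. Put $X_\iota(j)=P_\iota(j)X_\iota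 P_\iota(j)$. The s-free Fock space is $\mathcal K_\iota=\bigoplus_{n\ \rm odd}\big(\mathcal H^{(n-1)}(\iota)\oplus\mathcal H^{(n)}(\bar\iota)\big)$ ($\mathbb C\xi$ plus all tensors whose last factor lies in $\mathcal H_\iota^0$). On $\mathcal K_2$: $R_2^{\rm odd}=\sum_{j\ \rm odd}X_2(j)$, $R_1^{\rm even}=P_\xi+\sum_{j\ \rm even}X_1(j)$. The state associated with a unit vector $\zeta$ is $\langle\cdot\,\zeta,\zeta\rangle$. The distribution of $a$ in a state $\omega$ is the functional $X^n\mapsto\omega(a^n)$ on $\mathbb C[X]$ (identified with the corresponding compactly supported measure when there is one). Transforms: for a probability measure $\mu$ on $\mathbb R_+=[0,\infty)$, $\psi_\mu(z)=\int\frac{zt}{1-zt}d\mu(t)$, $\eta_\mu=\psi_\mu/(1+\psi_\mu)$ on $\mathbb C\setminus\mathbb R_+$. $\boxtimes$ is free multiplicative convolution. s-free multiplicative convolution $\boxtimes_s$: for $\mu_1,\mu_2\neq\delta_0$ on $\mathbb R_+$, $\mu_1\boxtimes_s\mu_2=\sigma_1$ and $\mu_2\boxtimes_s\mu_1=\sigma_2$ are the unique probability measures on $\mathbb R_+$, different from $\delta_0$, with $\eta_{\mu_1\boxtimes\mu_2}(z)=\eta_{\mu_1}(\eta_{\sigma_2}(z))=\eta_{\mu_2}(\eta_{\sigma_1}(z))$ on $\mathbb C\setminus\mathbb R_+$; in addition $\mu\boxtimes_s\delta_0=\delta_{\mu(X)}$ (with $\mu(X)$ the mean of $\mu$) and $\delta_0\boxtimes_s\mu=\delta_0$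 for compactly supported $\mu$ on $\mathbb R_+$. Monotone independence: a pair $(a,b)$ is monotone independent w.r.t. $\varphi$ if, with $\mathcal A_1,\mathcal A_2$ the non-unital algebras generated by $a$ and by $b$, one has $\varphi(w_1a_1b')=\varphi(b')\varphi(w_1a_1)$, $\varphi(b'a_2w_2)=\varphi(b')\varphi(a_2w_2)$, $\varphi(w_1a_1b'a_2w_2)=\varphi(b')\varphi(w_1a_1a_2w_2)$ for all $a_1,a_2\in\mathcal A_1$, $b'\in\mathcal A_2$ and $w_1,w_2$ in the unital algebra generated by $\mathcal A_1,\mathcal A_2$. s-freeness: let $\mathcal A_1$ be a unital subalgebra and $\mathcal A_2$ a non-unital subalgebra with internal unit $1_2$ ($1_2b=b=b1_2$ for $b\in\mathcal A_2$). $(\mathcal A_1,\mathcal A_2)$ is s-free w.r.t. $(\varphi,\psi)$ if $\psi(1_2)=1$ and (i) $\varphi(a_1\cdots a_n)=0$ whenever $a_j\in\mathcal A_{i_j}^0$, $i_1\ne\dots\ne i_n$; (ii) $\varphi(w_11_2w_2)=\varphi(w_1w_2)-\varphi(w_1)\varphi(w_2)$ for all $w_1,w_2\in{\rm alg}(\mathcal A_1,\mathcal A_2)$; here $\mathcal A_1^0=\mathcal A_1\cap\ker\varphi$, $\mathcal A_2^0=\mathcal A_2\cap\ker\psi$. A pair $(a,b)$ is s-free (s-free independent) if there is $1_2$ such that $({\rm alg}(1,a),{\rm alg}(1_2,b))$ is s-free. *)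

theory Defs
  imports "HOL-Probability.Probability" "HOL-Library.Poly_Mapping"
begin

section \<open>Complex Hilbert spaces\<close>

class complex_vector = ab_group_add +
  fixes scaleC :: "complex \<Rightarrow> 'a \<Rightarrow> 'a"  (infixr \<open>*\<^sub>C\<close> 75)
  assumes scaleC_add_right: "c *\<^sub>C (x + y) = c *\<^sub>C x + c *\<^sub>C y"
    and scaleC_add_left: "(c + d) *\<^sub>C x = c *\<^sub>C x + d *\<^sub>C x"
    and scaleC_scaleC: "c *\<^sub>C d *\<^sub>C x = (c * d) *\<^sub>C x"
    and scaleC_one: "1 *\<^sub>C x = x"

global_interpretation complex_vector:
  vector_space "scaleC :: complex \<Rightarrow> 'a \<Rightarrow> 'a::complex_vector"
  defines csubspace = complex_vector.subspace and cspan = complex_vector.span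
  by unfold_locales (simp_all add: scaleC_add_right scaleC_add_left scaleC_scaleC scaleC_one)

text \<open>Inner products are linear in the first argument.\<close>

class complex_inner = complex_vector + real_normed_vector +
  fixes cinner :: "'a \<Rightarrow> 'a \<Rightarrow> complex"
  assumes scaleR_scaleC: "r *\<^sub>R x = complex_of_real r *\<^sub>C x"
    and cinner_commute: "cinner x y = cnj (cinner y x)"
    and cinner_add_left: "cinner (x + y) z = cinner x z + cinner y z"
    and cinner_scaleC_left: "cinner (c *\<^sub>C x) y = c * cinner x y"
    and cinner_self_ge_zero: "0 \<le> Re (cinner x x)"
    and norm_eq_sqrt_cinner: "norm x = sqrt (Re (cinner x x))"

class complex_hilbert = complex_inner + banach

instantiation complex :: complex_hilbert
begin

definition scaleC_complex :: "complex \<Rightarrow> complex \<Rightarrow> complex"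
  where "scaleC_complex c x = c * x"

definition cinner_complex :: "complex \<Rightarrow> complex \<Rightarrow> complex"
  where "cinner_complex x y = x * cnj y"

instance
  by standard
    (auto simp: scaleC_complex_def cinner_complex_def scaleR_conv_of_real cmod_def
      algebra_simps power2_eq_square)

end

lemma norm_scaleC: "norm (c *\<^sub>C x) = cmod c * norm (x :: 'a::complex_inner)"
proof -
  have "cinner (c *\<^sub>C x) (c *\<^sub>C x) = c * cinner x (c *\<^sub>C x)"
    by (rule cinner_scaleC_left)
  also have "cinner x (c *\<^sub>C x) = cnj c * cinner x x"
    by (metis cinner_commute cinner_scaleC_left complex_cnj_mult)
  finally have "cinner (c *\<^sub>C x) (c *\<^sub>C x) = complex_of_real ((cmod c)\<^sup>2) * cinner x x"
    by (simp add: complex_norm_square mult.assoc [symmetric] del: of_real_power)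
  then have "Re (cinner (c *\<^sub>C x) (c *\<^sub>C x)) = (cmod c)\<^sup>2 * Re (cinner x x)"
    by simp
  then show ?thesis
    unfolding norm_eq_sqrt_cinner [of x] norm_eq_sqrt_cinner [of "c *\<^sub>C x"]
    by (simp add: real_sqrt_mult)
qed


section \<open>The algebra of bounded operators\<close>

definition bounded_clinear :: "('a::complex_inner \<Rightarrow> 'b::complex_inner) \<Rightarrow> bool"
  where "bounded_clinear f \<longleftrightarrow> bounded_linear f \<and> (\<forall>c x. f (c *\<^sub>C x) = c *\<^sub>C f x)"

typedef (overloaded) 'a bop = "{f :: 'a::complex_inner \<Rightarrow> 'a. bounded_clinear f}"
  morphisms bop_apply Bop
  by (rule exI [of _ "\<lambda>x. x"]) (simp add: bounded_clinear_def bounded_linear_ident)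

setup_lifting type_definition_bop

declare [[coercion "bop_apply :: 'a::complex_inner bop \<Rightarrow> 'a \<Rightarrow> 'a"]]

lemma bounded_linear_scaleC: "bounded_linear (\<lambda>x :: 'a::complex_inner. c *\<^sub>C x)"
  by (rule bounded_linear_intro [of _ "cmod c"])
    (simp_all add: scaleC_add_right scaleR_scaleC scaleC_scaleC norm_scaleC mult.commute)

instantiation bop :: (complex_inner) "{complex_vector, ring, monoid_mult}"
begin

lift_definition zero_bop :: "'a bop" is "\<lambda>_. 0"
  by (simp add: bounded_clinear_def)

lift_definition one_bop :: "'a bop" is "\<lambda>x. x"
  by (simp add: bounded_clinear_def bounded_linear_ident)

lift_definition plus_bop :: "'a bop \<Rightarrow> 'a bop \<Rightarrow> 'a bop" is "\<lambda>S T x. S x + T x"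
  by (auto simp: bounded_clinear_def bounded_linear_add scaleC_add_right)

lift_definition uminus_bop :: "'a bop \<Rightarrow> 'a bop" is "\<lambda>S x. - S x"
  by (auto simp: bounded_clinear_def bounded_linear_minus complex_vector.scale_minus_right)

lift_definition minus_bop :: "'a bop \<Rightarrow> 'a bop \<Rightarrow> 'a bop" is "\<lambda>S T x. S x - T x"
  by (auto simp: bounded_clinear_def bounded_linear_sub complex_vector.scale_right_diff_distrib)

lift_definition times_bop :: "'a bop \<Rightarrow> 'a bop \<Rightarrow> 'a bop" is "\<lambda>S T x. S (T x)"
  by (auto simp: bounded_clinear_def bounded_linear_compose)

lift_definition scaleC_bop :: "complex \<Rightarrow> 'a bop \<Rightarrow> 'a bop" is "\<lambda>c S x. c *\<^sub>C S x"
  by (auto simp: bounded_clinear_def bounded_linear_compose [OF bounded_linear_scaleC]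
      scaleC_scaleC mult.commute)

instance
proof
  fix a b c :: "'a bop"
  show "a * b * c = a * (b * c)" by transfer simp
  show "(a + b) * c = a * c + b * c" by transfer simp
  show "a * (b + c) = a * b + a * c"
    by transfer (auto simp: bounded_clinear_def linear_add dest: bounded_linear.linear)
qed (transfer; simp add: algebra_simps scaleC_add_right scaleC_add_left scaleC_scaleC scaleC_one)+

end

text \<open>On a complex Hilbert space a positive operator is automatically self-adjoint.\<close>

definition positive_op :: "'a::complex_hilbert bop \<Rightarrow> bool"
  where "positive_op T \<longleftrightarrow> (\<forall>h. cinner (T h) h \<in> \<real>\<^sub>\<ge>\<^sub>0)"

definition sqrt_op :: "'a::complex_hilbert bop \<Rightarrow> 'a bop"
  where "sqrt_op T = (THE S. positive_op S \<and> S * S = T)"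

definition projection :: "'a::complex_hilbert set \<Rightarrow> 'a bop"
  where "projection M =
    (THE P :: 'a bop. \<forall>h. P h \<in> M \<and> (\<forall>m\<in>M. cinner (h - P h) m = 0))"

definition strong_sum :: "(nat \<Rightarrow> 'a::complex_hilbert bop) \<Rightarrow> nat set \<Rightarrow> 'a bop"
  where "strong_sum T J = Bop (\<lambda>h. \<Sum>\<^sub>\<infinity>j\<in>J. T j h)"

definition vector_state :: "'a::complex_hilbert \<Rightarrow> 'a bop \<Rightarrow> complex"
  where "vector_state \<zeta> T = cinner (T \<zeta>) \<zeta>"


section \<open>Noncommutative probability\<close>

definition distribution :: "('a::monoid_mult \<Rightarrow> complex) \<Rightarrow> 'a \<Rightarrow> nat \<Rightarrow> complex"
  where "distribution \<omega> a = (\<lambda>n. \<omega> (a ^ n))"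

definition prob_real :: "real measure \<Rightarrow> bool"
  where "prob_real \<mu> \<longleftrightarrow> prob_space \<mu> \<and> sets \<mu> = sets borel"

definition nonneg_support :: "real measure \<Rightarrow> bool"
  where "nonneg_support \<mu> \<longleftrightarrow> (AE t in \<mu>. 0 \<le> t)"

definition compact_support :: "real measure \<Rightarrow> bool"
  where "compact_support \<mu> \<longleftrightarrow> (\<exists>r. AE t in \<mu>. \<bar>t\<bar> \<le> r)"

definition has_distribution ::
    "('a::monoid_mult \<Rightarrow> complex) \<Rightarrow> 'a \<Rightarrow> real measure \<Rightarrow> bool"
  where "has_distribution \<omega> a \<mu> \<longleftrightarrow>
    prob_real \<mu> \<and> compact_support \<mu> \<and>
    distribution \<omega> a = (\<lambda>n. complex_of_real (\<integral>t. t ^ n \<partial>\<mu>))"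

text \<open>Subalgebras need not contain a unit.\<close>

definition csubalgebra :: "'a::{complex_vector, ring} set \<Rightarrow> bool"
  where "csubalgebra A \<longleftrightarrow> csubspace A \<and> (\<forall>a\<in>A. \<forall>b\<in>A. a * b \<in> A)"

definition alg :: "'a::{complex_vector, ring} set \<Rightarrow> 'a set"
  where "alg S = csubalgebra hull S"

definition alternating_products_vanish ::
    "('a::monoid_mult \<Rightarrow> complex) \<Rightarrow> 'a set \<Rightarrow> 'a set \<Rightarrow> bool"
  where "alternating_products_vanish \<omega> A B \<longleftrightarrow>
    (\<forall>ps :: (bool \<times> 'a) list. ps \<noteq> [] \<and> distinct_adj (map fst ps) \<and>
       (\<forall>(i, a)\<in>set ps. a \<in> (if i then A else B)) \<longrightarrow>
       \<omega> (prod_list (map snd ps)) = 0)"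

definition free_pair ::
    "('a::{complex_vector, ring, monoid_mult} \<Rightarrow> complex) \<Rightarrow> 'a \<Rightarrow> 'a \<Rightarrow> bool"
  where "free_pair \<omega> a b \<longleftrightarrow>
    alternating_products_vanish \<omega> {c \<in> alg {1, a}. \<omega> c = 0} {c \<in> alg {1, b}. \<omega> c = 0}"

definition monotone_independent ::
    "('a::{complex_vector, ring, monoid_mult} \<Rightarrow> complex) \<Rightarrow> 'a \<Rightarrow> 'a \<Rightarrow> bool"
  where "monotone_independent \<omega> a b \<longleftrightarrow>
    (\<forall>w1 \<in> alg (insert 1 (alg {a} \<union> alg {b})). \<forall>w2 \<in> alg (insert 1 (alg {a} \<union> alg {b})).
     \<forall>a1 \<in> alg {a}. \<forall>a2 \<in> alg {a}. \<forall>b' \<in> alg {b}.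
       \<omega> (w1 * a1 * b') = \<omega> b' * \<omega> (w1 * a1) \<and>
       \<omega> (b' * a2 * w2) = \<omega> b' * \<omega> (a2 * w2) \<and>
       \<omega> (w1 * a1 * b' * a2 * w2) = \<omega> b' * \<omega> (w1 * a1 * a2 * w2))"

text \<open>The unit \<open>u\<close> of the ambient algebra is a parameter because we use this for the
  algebra of operators on a closed subspace \<open>K\<close> of \<open>H\<close>, identified with the corner
  \<open>P\<^sub>K B(H) P\<^sub>K\<close>, whose unit is the projection \<open>P\<^sub>K\<close>; an operator \<open>a\<close> on \<open>H\<close> belongs to the
  corner if and only if \<open>P\<^sub>K * a = a = a * P\<^sub>K\<close>.\<close>

definition s_free ::
    "'a::{complex_vector, ring, monoid_mult} \<Rightarrow> ('a \<Rightarrow> complex) \<Rightarrow> ('a \<Rightarrow> complex) \<Rightarrow> 'a set \<Rightarrow> 'a set \<Rightarrow> 'a \<Rightarrow> bool"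
  where "s_free u \<phi> \<psi> A1 A2 e \<longleftrightarrow>
    (\<forall>a \<in> A1 \<union> A2. u * a = a \<and> a * u = a) \<and>
    csubalgebra A1 \<and> u \<in> A1 \<and>
    csubalgebra A2 \<and> u \<notin> A2 \<and> e \<in> A2 \<and> (\<forall>b\<in>A2. e * b = b \<and> b * e = b) \<and>
    \<psi> e = 1 \<and>
    alternating_products_vanish \<phi> {a \<in> A1. \<phi> a = 0} {a \<in> A2. \<psi> a = 0} \<and>
    (\<forall>w1 \<in> alg (A1 \<union> A2). \<forall>w2 \<in> alg (A1 \<union> A2).
       \<phi> (w1 * e * w2) = \<phi> (w1 * w2) - \<phi> w1 * \<phi> w2)"

definition s_free_pair ::
    "'a::{complex_vector, ring, monoid_mult} \<Rightarrow> ('a \<Rightarrow> complex) \<Rightarrow> ('a \<Rightarrow> complex) \<Rightarrow> 'a \<Rightarrow> 'a \<Rightarrow> bool"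
  where "s_free_pair u \<phi> \<psi> a b \<longleftrightarrow> (\<exists>e. s_free u \<phi> \<psi> (alg {u, a}) (alg {e, b}) e)"


section \<open>Multiplicative convolutions\<close>

datatype index = I1 | I2

fun other :: "index \<Rightarrow> index"
  where "other I1 = I2" | "other I2 = I1"

text \<open>The free noncommutative algebra on two generators is the monoid algebra of the free
  monoid, written additively since multiplication of \<open>poly_mapping\<close> is convolution along \<open>+\<close>.\<close>

datatype monomial = Monomial (letters: "index list")

instantiation monomial :: monoid_add
begin

definition zero_monomial :: monomial
  where "zero_monomial = Monomial []"

definition plus_monomial :: "monomial \<Rightarrow> monomial \<Rightarrow> monomial"
  where "plus_monomial u v = Monomial (letters u @ letters v)"

instance
  by standard (simp_all add: zero_monomial_def plus_monomial_def)

end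

instantiation poly_mapping :: (type, complex_vector) complex_vector
begin

lift_definition scaleC_poly_mapping :: "complex \<Rightarrow> ('a \<Rightarrow>\<^sub>0 'b) \<Rightarrow> 'a \<Rightarrow>\<^sub>0 'b"
  is "\<lambda>c p k. c *\<^sub>C p k"
  by (erule finite_subset [rotated]) (auto simp: complex_vector.scale_zero_right)

instance
  by standard (rule poly_mapping_eqI,
    simp add: scaleC_poly_mapping.rep_eq lookup_add scaleC_add_right scaleC_add_left
      scaleC_scaleC scaleC_one)+

end

type_synonym ncpoly = "monomial \<Rightarrow>\<^sub>0 complex"

definition variable :: "index \<Rightarrow> ncpoly"
  where "variable i = Poly_Mapping.single (Monomial [i]) 1"

text \<open>For compactly supported measures on the half-line, \<open>\<mu> \<boxtimes> \<nu>\<close> is the distribution of the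
  product of two free variables with distributions \<open>\<mu>\<close> and \<open>\<nu>\<close>. That distribution only depends
  on the joint moments, so the variables may be taken to be the generators of the free algebra.\<close>

definition free_mult_conv :: "real measure \<Rightarrow> real measure \<Rightarrow> real measure"
  where "free_mult_conv \<mu> \<nu> = (THE \<rho>. nonneg_support \<rho> \<and>
    (\<exists>\<Phi> :: ncpoly \<Rightarrow> complex. Vector_Spaces.linear (*\<^sub>C) (*) \<Phi> \<and>
       has_distribution \<Phi> (variable I1) \<mu> \<and> has_distribution \<Phi> (variable I2) \<nu> \<and>
       free_pair \<Phi> (variable I1) (variable I2) \<and>
       has_distribution \<Phi> (variable I1 * variable I2) \<rho>))"

definition psi_transform :: "real measure \<Rightarrow> complex \<Rightarrow> complex"
  where "psi_transform \<mu> z =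
    (\<integral>t. z * complex_of_real t / (1 - z * complex_of_real t) \<partial>\<mu>)"

definition eta_transform :: "real measure \<Rightarrow> complex \<Rightarrow> complex"
  where "eta_transform \<mu> z = psi_transform \<mu> z / (1 + psi_transform \<mu> z)"

abbreviation delta :: "real \<Rightarrow> real measure"
  where "delta c \<equiv> return borel c"

text \<open>With \<open>\<sigma>\<close> for \<open>\<mu> \<boxtimes>\<^sub>s \<nu>\<close> and \<open>\<tau>\<close> for \<open>\<nu> \<boxtimes>\<^sub>s \<mu>\<close>.\<close>

definition s_free_mult_conv_pair ::
    "real measure \<Rightarrow> real measure \<Rightarrow> real measure \<Rightarrow> real measure \<Rightarrow> bool"
  where "s_free_mult_conv_pair \<mu> \<nu> \<sigma> \<tau> \<longleftrightarrow>
    prob_real \<sigma> \<and> nonneg_support \<sigma> \<and> \<sigma> \<noteq> delta 0 \<and>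
    prob_real \<tau> \<and> nonneg_support \<tau> \<and> \<tau> \<noteq> delta 0 \<and>
    (\<forall>z. z \<notin> \<real>\<^sub>\<ge>\<^sub>0 \<longrightarrow>
       eta_transform (free_mult_conv \<mu> \<nu>) z = eta_transform \<mu> (eta_transform \<tau> z) \<and>
       eta_transform (free_mult_conv \<mu> \<nu>) z = eta_transform \<nu> (eta_transform \<sigma> z))"

definition s_free_mult_conv :: "real measure \<Rightarrow> real measure \<Rightarrow> real measure"
  where "s_free_mult_conv \<mu> \<nu> =
    (if \<nu> = delta 0 then delta (\<integral>t. t \<partial>\<mu>)
     else if \<mu> = delta 0 then delta 0
     else fst (THE (\<sigma>, \<tau>). s_free_mult_conv_pair \<mu> \<nu> \<sigma> \<tau>))"


section \<open>The free product of two Hilbert spaces\<close>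

text \<open>Letters \<open>Inl h\<close> and \<open>Inr h\<close> stand for vectors of the first and of the second space, and
  \<open>tensor F [h\<^sub>1, \<dots>, h\<^sub>n]\<close> for the elementary tensor \<open>h\<^sub>1 \<otimes> \<dots> \<otimes> h\<^sub>n\<close>.\<close>

record ('a, 'b, 'h) free_product =
  vec1 :: 'a
  vec2 :: 'b
  tensor :: "('a + 'b) list \<Rightarrow> 'h"

fun index_of :: "'a + 'b \<Rightarrow> index"
  where "index_of (Inl _) = I1" | "index_of (Inr _) = I2"

fun in_H0 :: "('a::complex_hilbert, 'b::complex_hilbert, 'h) free_product \<Rightarrow> 'a + 'b \<Rightarrow> bool"
  where
    "in_H0 F (Inl h) \<longleftrightarrow> cinner h (vec1 F) = 0"
  | "in_H0 F (Inr h) \<longleftrightarrow> cinner h (vec2 F) = 0"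

fun letter_inner :: "'a::complex_hilbert + 'b::complex_hilbert \<Rightarrow> 'a + 'b \<Rightarrow> complex"
  where
    "letter_inner (Inl h) (Inl k) = cinner h k"
  | "letter_inner (Inr h) (Inr k) = cinner h k"
  | "letter_inner _ _ = 0"

definition reduced_words ::
    "('a::complex_hilbert, 'b::complex_hilbert, 'h) free_product \<Rightarrow> ('a + 'b) list set"
  where "reduced_words F = {w. distinct_adj (map index_of w) \<and> (\<forall>l\<in>set w. in_H0 F l)}"

text \<open>The space \<open>'h\<close> is a realisation of the Hilbert space direct sum of the Hilbert space tensor
  products of the alternating families, the empty word giving the vacuum vector. The inner
  product formula forces \<open>tensor F\<close> to be multilinear on reduced words and summands of
  different type to be orthogonal; together with density it determines \<open>'h\<close>, its vacuum vector
  and \<open>tensor F\<close> on reduced words up to a unique unitary.\<close>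

definition is_free_product ::
    "('a::complex_hilbert, 'b::complex_hilbert, 'h::complex_hilbert) free_product \<Rightarrow> bool"
  where "is_free_product F \<longleftrightarrow>
    norm (vec1 F) = 1 \<and> norm (vec2 F) = 1 \<and>
    (\<forall>v\<in>reduced_words F. \<forall>w\<in>reduced_words F.
       cinner (tensor F v) (tensor F w) =
         (if length v = length w then prod_list (map2 letter_inner v w) else 0)) \<and>
    closure (cspan (tensor F ` reduced_words F)) = UNIV"

definition vacuum :: "('a, 'b, 'h) free_product \<Rightarrow> 'h"
  where "vacuum F = tensor F []"

definition words_avoiding ::
    "('a::complex_hilbert, 'b::complex_hilbert, 'h) free_product \<Rightarrow> index \<Rightarrow> ('a + 'b) list set"
  where "words_avoiding F i = {w \<in> reduced_words F. w \<noteq> [] \<longrightarrow> index_of (hd w) \<noteq> i}"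

text \<open>\<open>H\<^sup>(\<^sup>n\<^sup>)(i)\<close>.\<close>

definition level_space ::
    "('a::complex_hilbert, 'b::complex_hilbert, 'h::complex_hilbert) free_product \<Rightarrow>
      index \<Rightarrow> nat \<Rightarrow> 'h set"
  where "level_space F i n = closure (cspan (tensor F ` {w \<in> words_avoiding F i. length w = n}))"

text \<open>The \<open>n\<close>-th summand \<open>H\<^sup>(\<^sup>n\<^sup>-\<^sup>1\<^sup>)(i) \<oplus> H\<^sup>(\<^sup>n\<^sup>)(other i)\<close>, meaningful for \<open>n \<ge> 1\<close>.\<close>

definition summand ::
    "('a::complex_hilbert, 'b::complex_hilbert, 'h::complex_hilbert) free_product \<Rightarrow>
      index \<Rightarrow> nat \<Rightarrow> 'h set"
  where "summand F i n =
    closure (cspan (level_space F i (n - 1) \<union> level_space F (other i) n))"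

text \<open>\<open>prepend1 F h w\<close> is the image of \<open>h \<otimes> tensor F w\<close> under the natural unitary from the tensor
  product of the first space with the closed span of the words not starting in it; here \<open>h\<close> need
  not be orthogonal to \<open>vec1 F\<close>. The operator \<open>a \<otimes> 1\<close> is determined by its values on these.\<close>

definition prepend1 ::
    "('a::complex_hilbert, 'b::complex_hilbert, 'h::complex_hilbert) free_product \<Rightarrow>
      'a \<Rightarrow> ('a + 'b) list \<Rightarrow> 'h"
  where "prepend1 F h w = cinner h (vec1 F) *\<^sub>C tensor F w
    + tensor F (Inl (h - cinner h (vec1 F) *\<^sub>C vec1 F) # w)"

definition prepend2 ::
    "('a::complex_hilbert, 'b::complex_hilbert, 'h::complex_hilbert) free_product \<Rightarrow>
      'b \<Rightarrow> ('a + 'b) list \<Rightarrow> 'h"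
  where "prepend2 F h w = cinner h (vec2 F) *\<^sub>C tensor F w
    + tensor F (Inr (h - cinner h (vec2 F) *\<^sub>C vec2 F) # w)"

definition lambda1 ::
    "('a::complex_hilbert, 'b::complex_hilbert, 'h::complex_hilbert) free_product \<Rightarrow>
      'a bop \<Rightarrow> 'h bop"
  where "lambda1 F a =
    (THE L :: 'h bop. \<forall>h. \<forall>w\<in>words_avoiding F I1. L (prepend1 F h w) = prepend1 F (a h) w)"

definition lambda2 ::
    "('a::complex_hilbert, 'b::complex_hilbert, 'h::complex_hilbert) free_product \<Rightarrow>
      'b bop \<Rightarrow> 'h bop"
  where "lambda2 F b =
    (THE L :: 'h bop. \<forall>h. \<forall>w\<in>words_avoiding F I2. L (prepend2 F h w) = prepend2 F (b h) w)"

text \<open>\<open>X\<^sub>i(j)\<close>, for \<open>X\<close> in the role of \<open>X\<^sub>i\<close>.\<close>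

definition block ::
    "('a::complex_hilbert, 'b::complex_hilbert, 'h::complex_hilbert) free_product \<Rightarrow>
      index \<Rightarrow> 'h bop \<Rightarrow> nat \<Rightarrow> 'h bop"
  where "block F i X j = projection (summand F i j) * X * projection (summand F i j)"

definition s_free_Fock ::
    "('a::complex_hilbert, 'b::complex_hilbert, 'h::complex_hilbert) free_product \<Rightarrow>
      index \<Rightarrow> 'h set"
  where "s_free_Fock F i = closure (cspan (\<Union>n\<in>{n. odd n}. summand F i n))"

text \<open>Operators on the s-free Fock space of index \<open>I2\<close> are regarded as operators on \<open>'h\<close> that
  vanish on its orthogonal complement; both sums below have this property.\<close>

definition R2_odd ::
    "('a::complex_hilbert, 'b::complex_hilbert, 'h::complex_hilbert) free_product \<Rightarrow>
      'h bop \<Rightarrow> 'h bop"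
  where "R2_odd F X2 = strong_sum (block F I2 X2) {j. odd j}"

definition R1_even ::
    "('a::complex_hilbert, 'b::complex_hilbert, 'h::complex_hilbert) free_product \<Rightarrow>
      'h bop \<Rightarrow> 'h bop"
  where "R1_even F X1 =
    projection (cspan {vacuum F}) + strong_sum (block F I1 X1) {j. even j \<and> j \<ge> 1}"

end

theory Submission
  imports Defs "HOL-Complex_Analysis.Complex_Analysis"
begin

text \<open>
  Let \<open>P\<close> be the projection onto \<open>\<complex>\<xi> \<oplus> H\<^sub>1\<^sup>0\<close>. It commutes with \<open>X\<^sub>1\<close>, so that \<open>X\<^sub>1 = y z\<close> with the commuting
  positive operators \<open>y = X\<^sub>1 P + (1 - P)\<close> and \<open>z = P + X\<^sub>1 (1 - P)\<close>, and \<open>Y = \<surd>z X\<^sub>2 \<surd>z\<close> gives the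
  decomposition. Under \<open>H = K\<^sub>2 \<otimes> H\<^sub>1\<close> (splitting off the last letter of a word) both \<open>z\<close> and \<open>X\<^sub>2\<close> have
  the form \<open>b \<otimes> 1\<close>, that is, they commute with the action of \<open>B(H\<^sub>1)\<close> on the last letter; hence
  \<open>P b P = \<phi>(b) P\<close> for all \<open>b\<close> in the algebra of \<open>Y\<close>. This yields monotone independence, and, by solving
  \<open>(1 - \<zeta> \<surd>y Y \<surd>y) v = \<xi>\<close> for small \<open>\<zeta>\<close>, the subordination \<open>\<eta>\<^sub>\<rho> = \<eta>\<^sub>\<mu>\<^sub>1 \<circ> \<eta>\<^sub>\<sigma>\<close>, where \<open>\<rho>\<close> and \<open>\<sigma>\<close> are the
  distributions of \<open>\<surd>X\<^sub>1 X\<^sub>2 \<surd>X\<^sub>1\<close> and \<open>Y\<close>; it extends to the slit plane by the identity theorem.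
  Exchanging the two factors gives the second subordination equation, because \<open>\<phi>\<close> is a trace on the
  algebra generated by \<open>X\<^sub>1, X\<^sub>2\<close>. Restricting \<open>z\<close> and \<open>X\<^sub>2\<close> to \<open>K\<^sub>2\<close> yields \<open>R\<^sub>1\<close> and \<open>R\<^sub>2\<close>.
  Distributions of positive operators exist by the Hausdorff moment problem.
\<close>

section \<open>Inner product spaces\<close>

text \<open>No tensor product of Hilbert spaces is formed: to be of the form
  \<open>b \<otimes> 1\<close> is expressed as commuting with \<open>rho1 F c\<close> for every
  \<open>c\<close>. The operator \<open>X2\<close> commutes outright, because the first letter that
  it changes and the last letter that \<open>rho1\<close> changes lie in different spaces. The
  operator \<open>X1\<close> commutes only off the first level: on words of length at most one over
  the first space both actions meet in the same letter. Replacing \<open>X1\<close> by the identity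
  exactly there gives \<open>z\<close>, and \<open>y\<close> collects what was removed. The
  convolution \<open>s_free_mult_conv\<close> is a description of a pair of measures, so both
  subordination equations are needed, together with uniqueness. Uniqueness is taken from the
  negative axis, where \<eta> is injective and determines the measure. If a marginal is the point
  mass at 0, the convolution is given by a separate convention, and \<open>Y\<close> is evaluated at
  the vacuum directly. With G = 1 + \<psi> one has \<eta> = 1 - 1/G, so a subordination equation for
  \<eta> is an equation between the functions G, which are vacuum entries of resolvents.\<close>

lemma cinner_add_right: "cinner x (y + z) = cinner x y + cinner x z"
  by (metis cinner_commute cinner_add_left complex_cnj_add)

lemma cinner_scaleC_right: "cinner x (c *\<^sub>C y) = cnj c * cinner x y"
  by (metis cinner_commute cinner_scaleC_left complex_cnj_mult)

lemma cinner_zero_left [simp]: "cinner 0 y = 0"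
  using cinner_add_left [of 0 0 y] by simp

lemma cinner_zero_right [simp]: "cinner y 0 = 0"
  using cinner_add_right [of y 0 0] by simp

lemma cinner_minus_left: "cinner (- x) y = - cinner x y"
  using cinner_add_left [of x "-x" y] by (simp add: add_eq_0_iff)

lemma cinner_minus_right: "cinner x (- y) = - cinner x y"
  using cinner_add_right [of x y "-y"] by (simp add: add_eq_0_iff)

lemma cinner_diff_left: "cinner (x - y) z = cinner x z - cinner y z"
  using cinner_add_left [of x "-y" z] by (simp add: cinner_minus_left)

lemma cinner_diff_right: "cinner z (x - y) = cinner z x - cinner z y"
  using cinner_add_right [of z x "-y"] by (simp add: cinner_minus_right)

lemma cinner_sum_left: "cinner (sum f I) y = (\<Sum>i\<in>I. cinner (f i) y)"
  by (induction I rule: infinite_finite_induct) (simp_all add: cinner_add_left)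

lemma cinner_sum_right: "cinner y (sum f I) = (\<Sum>i\<in>I. cinner y (f i))"
  by (induction I rule: infinite_finite_induct) (simp_all add: cinner_add_right)

lemmas cinner_simps = cinner_add_left cinner_add_right cinner_diff_left cinner_diff_right
  cinner_minus_left cinner_minus_right cinner_scaleC_left cinner_scaleC_right

lemma cinner_self: "cinner x x = of_real ((norm x)\<^sup>2)"
proof -
  have "Im (cinner x x) = 0"
    using cinner_commute [of x x] by (metis complex_cnj_cancel_iff cnj.simps(2) equal_neg_zero)
  then show ?thesis
    by (simp add: complex_eq_iff norm_eq_sqrt_cinner cinner_self_ge_zero)
qed

lemma cinner_eq_zero_iff [simp]: "cinner x x = 0 \<longleftrightarrow> x = 0"
  by (simp add: cinner_self)

text \<open>The form may be degenerate, so the inequality serves \<open>cinner\<close> as well as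
  the form \<open>cinner (T x) y\<close> of a positive operator, where it yields norm bounds and
  kernels.\<close>

lemma psd_form_Cauchy_Schwarz:
  fixes B :: "'a::complex_vector \<Rightarrow> 'a \<Rightarrow> complex"
  assumes add: "\<And>x y z. B (x + y) z = B x z + B y z"
    and scale: "\<And>c x y. B (c *\<^sub>C x) y = c * B x y"
    and herm: "\<And>x y. B x y = cnj (B y x)"
    and pos: "\<And>x. 0 \<le> Re (B x x)"
  shows "(cmod (B x y))\<^sup>2 \<le> Re (B x x) * Re (B y y)"
proof -
  have add': "B z (x + y) = B z x + B z y" for x y z
    by (metis herm add complex_cnj_add)
  have scale': "B y (c *\<^sub>C x) = cnj c * B y x" for c x y
    by (metis herm scale complex_cnj_mult)
  define p where "p = (cmod (B x y))\<^sup>2"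
  have p: "B x y * cnj (B x y) = of_real p"
    by (simp add: p_def complex_norm_square [symmetric])
  \<comment> \<open>Positivity at x - t B(x,y) y. The phase is absorbed into the coefficient, which
    leaves a quadratic polynomial in the real variable t.\<close>
  have key: "0 \<le> Re (B x x) - 2 * t * p + t\<^sup>2 * p * Re (B y y)" for t :: real
  proof -
    define c where "c = - (of_real t * B x y)"
    have "B (x + c *\<^sub>C y) (x + c *\<^sub>C y) =
        B x x + cnj c * B x y + c * B y x + c * cnj c * B y y"
      by (simp add: add add' scale scale' algebra_simps)
    moreover have "cnj c * B x y = - of_real (t * p)" "c * B y x = - of_real (t * p)"
      "c * cnj c = of_real (t\<^sup>2 * p)"
      using p herm [of y x] by (simp_all add: c_def power2_eq_square mult.commute mult.left_commute)
    ultimately have "Re (B (x + c *\<^sub>C y) (x + c *\<^sub>C y)) =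
        Re (B x x) - t * p - t * p + t\<^sup>2 * p * Re (B y y)"
      by simp
    then show ?thesis
      using pos [of "x + c *\<^sub>C y"] by (simp add: algebra_simps)
  qed
  show ?thesis
  proof (cases "Re (B y y) = 0")
    case True
    have "p = 0"
    proof (rule ccontr)
      assume "p \<noteq> 0"
      \<comment> \<open>Without quadratic term the polynomial is affine; at this t it equals
        -1.\<close>
      with key [of "(Re (B x x) + 1) / (2 * p)"] True show False
        by simp
    qed
    then show ?thesis
      using True by (simp add: p_def)
  next
    case False
    then have y: "Re (B y y) > 0"
      using pos [of y] by simp
    have "0 \<le> Re (B x x) - p / Re (B y y)"
      using key [of "1 / Re (B y y)"] y by (simp add: power2_eq_square field_simps)
    then show ?thesis
      using y by (simp add: p_def field_simps)
  qed
qed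

lemma Cauchy_Schwarz_cinner: "cmod (cinner x y) \<le> norm x * norm y"
proof -
  have "(cmod (cinner x y))\<^sup>2 \<le> Re (cinner x x) * Re (cinner y y)"
    by (rule psd_form_Cauchy_Schwarz [of cinner])
      (simp_all add: cinner_simps cinner_self_ge_zero flip: cinner_commute)
  then have "(cmod (cinner x y))\<^sup>2 \<le> (norm x * norm y)\<^sup>2"
    by (simp add: cinner_self power_mult_distrib)
  then show ?thesis
    by (rule power2_le_imp_le) simp
qed

lemma bounded_linear_cinner_left: "bounded_linear (\<lambda>x. cinner x y)"
  by (rule bounded_linear_intro [of _ "norm y"])
    (auto simp: cinner_simps scaleR_scaleC Cauchy_Schwarz_cinner scaleC_complex_def)

lemma bounded_linear_cinner_right: "bounded_linear (\<lambda>y. cinner x y)"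
  by (rule bounded_linear_intro [of _ "norm x"])
    (auto simp: cinner_simps scaleR_scaleC scaleC_complex_def,
     metis Cauchy_Schwarz_cinner mult.commute)

lemmas tendsto_cinner_left = bounded_linear.tendsto [OF bounded_linear_cinner_left]
lemmas tendsto_cinner_right = bounded_linear.tendsto [OF bounded_linear_cinner_right]
lemmas tendsto_scaleC = bounded_linear.tendsto [OF bounded_linear_scaleC]

lemma closed_cinner_eq_zero: "closed {x. cinner x y = 0}"
  by (intro closed_Collect_eq linear_continuous_on bounded_linear_cinner_left continuous_on_const)

lemma csubspace_cinner_eq_zero: "csubspace {x. cinner x y = 0}"
  by (auto simp: complex_vector.subspace_def cinner_simps)

lemma closure_cspan_subset:
  fixes M :: "'a::complex_inner set"
  assumes "A \<subseteq> M" "csubspace M" "closed M"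
  shows "closure (cspan A) \<subseteq> M"
  using assms by (metis closure_minimal complex_vector.span_minimal)

lemma closure_cspan_superset: "A \<subseteq> closure (cspan A)"
  using closure_subset complex_vector.span_superset by blast

lemma csubspace_closure:
  fixes M :: "'a::complex_inner set"
  assumes "csubspace M"
  shows "csubspace (closure M)"
  unfolding complex_vector.subspace_def
proof (intro conjI ballI allI)
  show "0 \<in> closure M"
    using assms closure_subset by (auto simp: complex_vector.subspace_def)
next
  fix x y assume "x \<in> closure M" "y \<in> closure M"
  then obtain f g where "\<And>n. f n \<in> M" "f \<longlonglongrightarrow> x" "\<And>n. g n \<in> M" "g \<longlonglongrightarrow> y"
    by (meson closure_sequential)
  then show "x + y \<in> closure M"
    unfolding closure_sequential using assms
    by (intro exI [of _ "\<lambda>n. f n + g n"]) (auto intro: tendsto_add complex_vector.subspace_add)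
next
  fix c x assume "x \<in> closure M"
  then obtain f where "\<And>n. f n \<in> M" "f \<longlonglongrightarrow> x"
    by (meson closure_sequential)
  then show "c *\<^sub>C x \<in> closure M"
    unfolding closure_sequential using assms
    by (intro exI [of _ "\<lambda>n. c *\<^sub>C f n"]) (auto intro: tendsto_scaleC complex_vector.subspace_scale)
qed

lemma cinner_dense_eqI:
  fixes x y :: "'a::complex_inner"
  assumes "closure (cspan A) = UNIV" "\<And>a. a \<in> A \<Longrightarrow> cinner x a = cinner y a"
  shows "x = y"
proof -
  have "cinner a (x - y) = 0" if "a \<in> A" for a
    using assms(2) [OF that] cinner_commute [of a "x - y"] by (simp add: cinner_diff_left)
  then have "closure (cspan A) \<subseteq> {a. cinner a (x - y) = 0}"
    by (intro closure_cspan_subset csubspace_cinner_eq_zero closed_cinner_eq_zero) auto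
  then have "cinner (x - y) (x - y) = 0"
    using assms(1) by blast
  then show ?thesis by simp
qed

text \<open>Gram-Schmidt elimination of one index \<open>a\<close>: splitting every
  \<open>W i\<close> into a multiple of \<open>W a\<close> and a vector \<open>V i\<close>
  orthogonal to it makes the double sum fall apart. The first part is \<open>q g g\<close> times the
  squared norm of \<open>W a\<close>, for a single vector \<open>g\<close>; in the second
  \<open>V a = 0\<close>, so the index \<open>a\<close> disappears and induction applies.\<close>

lemma psd_form_Schur_product:
  fixes q :: "'a::complex_vector \<Rightarrow> 'a \<Rightarrow> complex" and W :: "'i \<Rightarrow> 'b::complex_inner"
  assumes add: "\<And>x y z. q (x + y) z = q x z + q y z"
    and scale: "\<And>c x y. q (c *\<^sub>C x) y = c * q x y"
    and herm: "\<And>x y. q x y = cnj (q y x)"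
    and pos: "\<And>x. 0 \<le> Re (q x x)"
    and fin: "finite I"
  shows "0 \<le> Re (\<Sum>i\<in>I. \<Sum>j\<in>I. q (h i) (h j) * cinner (W i) (W j))"
  using fin
proof (induction I arbitrary: W)
  case empty
  show ?case by simp
next
  case (insert a I)
  have add': "q z (x + y) = q z x + q z y" for x y z
    by (metis herm add complex_cnj_add)
  have scale': "q y (c *\<^sub>C x) = cnj c * q y x" for c x y
    by (metis herm scale complex_cnj_mult)
  have zero: "q 0 z = 0" "q z 0 = 0" for z
    using add [of 0 0 z] add' [of z 0 0] by simp_all
  have sum1: "q (sum f J) z = (\<Sum>i\<in>J. q (f i) z)" for f z and J :: "'i set"
    by (induction J rule: infinite_finite_induct) (simp_all add: add zero)
  have sum2: "q z (sum f J) = (\<Sum>i\<in>J. q z (f i))" for f z and J :: "'i set"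
    by (induction J rule: infinite_finite_induct) (simp_all add: add' zero)
  \<comment> \<open>The default 0 keeps \<open>V a = 0\<close> true when
    \<open>W a = 0\<close>.\<close>
  define \<alpha> where "\<alpha> i = (if W a = 0 then 0 else cinner (W i) (W a) / cinner (W a) (W a))" for i
  define V where "V i = W i - \<alpha> i *\<^sub>C W a" for i
  have Va: "V a = 0"
    by (simp add: V_def \<alpha>_def scaleC_one complex_vector.scale_zero_left)
  have orth: "cinner (V i) (W a) = 0" for i
    by (auto simp: V_def \<alpha>_def cinner_simps)
  have orth': "cinner (W a) (V i) = 0" for i
    by (metis orth cinner_commute complex_cnj_zero)
  have W: "cinner (W i) (W j) = \<alpha> i * cnj (\<alpha> j) * cinner (W a) (W a) + cinner (V i) (V j)" for i j
  proof -
    have "W i = V i + \<alpha> i *\<^sub>C W a" "W j = V j + \<alpha> j *\<^sub>C W a"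
      by (simp_all add: V_def)
    then have "cinner (W i) (W j) = cinner (V i + \<alpha> i *\<^sub>C W a) (V j + \<alpha> j *\<^sub>C W a)"
      by simp
    also have "\<dots> = \<alpha> i * cnj (\<alpha> j) * cinner (W a) (W a) + cinner (V i) (V j)"
      by (simp add: cinner_simps orth orth')
    finally show ?thesis .
  qed
  define J where "J = insert a I"
  define g where "g = (\<Sum>i\<in>J. \<alpha> i *\<^sub>C h i)"
  have "(\<Sum>i\<in>J. \<Sum>j\<in>J. q (h i) (h j) * cinner (W i) (W j)) =
      (\<Sum>i\<in>J. \<Sum>j\<in>J. q (\<alpha> i *\<^sub>C h i) (\<alpha> j *\<^sub>C h j) * cinner (W a) (W a)) +
      (\<Sum>i\<in>J. \<Sum>j\<in>J. q (h i) (h j) * cinner (V i) (V j))"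
  proof -
    have "q (h i) (h j) * cinner (W i) (W j) =
        q (\<alpha> i *\<^sub>C h i) (\<alpha> j *\<^sub>C h j) * cinner (W a) (W a) + q (h i) (h j) * cinner (V i) (V j)" for i j
      unfolding W [of i j] by (simp add: scale scale' algebra_simps)
    then show ?thesis
      by (simp add: sum.distrib)
  qed
  also have "(\<Sum>i\<in>J. \<Sum>j\<in>J. q (\<alpha> i *\<^sub>C h i) (\<alpha> j *\<^sub>C h j) * cinner (W a) (W a)) =
      q g g * cinner (W a) (W a)"
    by (simp only: g_def sum1) (simp add: sum2 sum_distrib_right)
  also have "(\<Sum>i\<in>J. \<Sum>j\<in>J. q (h i) (h j) * cinner (V i) (V j)) =
      (\<Sum>i\<in>I. \<Sum>j\<in>I. q (h i) (h j) * cinner (V i) (V j))"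
    using insert.hyps by (simp add: J_def Va)
  finally have "Re (\<Sum>i\<in>J. \<Sum>j\<in>J. q (h i) (h j) * cinner (W i) (W j)) =
      Re (q g g) * (norm (W a))\<^sup>2 + Re (\<Sum>i\<in>I. \<Sum>j\<in>I. q (h i) (h j) * cinner (V i) (V j))"
    by (simp add: cinner_self)
  then show ?case
    using pos [of g] insert.IH [of V] by (simp add: J_def)
qed

section \<open>Bounded operators\<close>

lemmas bop_rep = zero_bop.rep_eq one_bop.rep_eq plus_bop.rep_eq uminus_bop.rep_eq
  minus_bop.rep_eq times_bop.rep_eq scaleC_bop.rep_eq

lemma bop_eqI: "(\<And>x. bop_apply S x = bop_apply T x) \<Longrightarrow> S = T"
  by (metis bop_apply_inject ext)

lemma bop_clinear: "bounded_clinear (bop_apply T)"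
  using bop_apply by blast

lemma bop_bounded_linear: "bounded_linear (bop_apply T)"
  using bop_clinear bounded_clinear_def by blast

lemma bop_add: "bop_apply T (x + y) = bop_apply T x + bop_apply T y"
  by (simp add: bop_bounded_linear bounded_linear.linear linear_add)

lemma bop_diff: "bop_apply T (x - y) = bop_apply T x - bop_apply T y"
  by (simp add: bop_bounded_linear bounded_linear.linear linear_diff)

lemma bop_zero [simp]: "bop_apply T 0 = 0"
  by (simp add: bop_bounded_linear bounded_linear.linear linear_0)

lemma bop_scaleC: "bop_apply T (c *\<^sub>C x) = c *\<^sub>C bop_apply T x"
  using bop_clinear bounded_clinear_def by blast

lemma bop_sum: "bop_apply T (sum f I) = (\<Sum>i\<in>I. bop_apply T (f i))"
  by (simp add: bop_bounded_linear bounded_linear.linear linear_sum)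

lemmas bop_linear_simps = bop_add bop_diff bop_scaleC bop_sum

lemma bop_norm_bound:
  obtains K where "K > 0" "\<And>x. norm (bop_apply T x) \<le> K * norm x"
  using bounded_linear.pos_bounded [OF bop_bounded_linear, of T] by (metis mult.commute)

lemmas bop_tendsto = bounded_linear.tendsto [OF bop_bounded_linear]

lemma scaleC_mult_bop:
  fixes S T :: "'a::complex_inner bop"
  shows "(c *\<^sub>C S) * T = c *\<^sub>C (S * T)" and "S * (c *\<^sub>C T) = c *\<^sub>C (S * T)"
  by (auto intro!: bop_eqI simp: bop_rep bop_scaleC)

lemma closed_bop_eq: "closed {x. bop_apply S x = bop_apply T x}"
  by (intro closed_Collect_eq linear_continuous_on bop_bounded_linear)

lemma csubspace_bop_eq: "csubspace {x. bop_apply S x = bop_apply T x}"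
  by (auto simp: complex_vector.subspace_def bop_linear_simps)

lemma bop_eq_on_dense:
  assumes "closure (cspan A) = UNIV" "\<And>a. a \<in> A \<Longrightarrow> bop_apply S a = bop_apply T a"
  shows "S = T"
proof (rule bop_eqI)
  fix x
  have "closure (cspan A) \<subseteq> {x. bop_apply S x = bop_apply T x}"
    using assms(2) by (intro closure_cspan_subset closed_bop_eq csubspace_bop_eq) auto
  then show "bop_apply S x = bop_apply T x"
    using assms(1) by blast
qed

lemma closed_vimage_bop: "closed M \<Longrightarrow> closed {x. bop_apply S x \<in> M}"
  using continuous_closed_vimage [of M "bop_apply S"] linear_continuous_at bop_bounded_linear
  by (metis vimage_def)

lemma csubspace_vimage_bop: "csubspace M \<Longrightarrow> csubspace {x. bop_apply S x \<in> M}"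
  by (auto simp: complex_vector.subspace_def bop_linear_simps)

lemma bop_closure_cspan_into:
  assumes "\<And>a. a \<in> A \<Longrightarrow> bop_apply S a \<in> M" "csubspace M" "closed M" "x \<in> closure (cspan A)"
  shows "bop_apply S x \<in> M"
proof -
  have "closure (cspan A) \<subseteq> {x. bop_apply S x \<in> M}"
    using assms by (intro closure_cspan_subset closed_vimage_bop csubspace_vimage_bop) auto
  with assms(4) show ?thesis by blast
qed

text \<open>Finite linear combinations are indexed by lists, so that sums of combinations are
  concatenations.\<close>

definition lincomb :: "('i \<Rightarrow> 'a::complex_vector) \<Rightarrow> (complex \<times> 'i) list \<Rightarrow> 'a"
  where "lincomb u xs = (\<Sum>(c, i)\<leftarrow>xs. c *\<^sub>C u i)"

lemma lincomb_Nil [simp]: "lincomb u [] = 0"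
  and lincomb_Cons [simp]: "lincomb u (ci # xs) = fst ci *\<^sub>C u (snd ci) + lincomb u xs"
  and lincomb_append [simp]: "lincomb u (xs @ ys) = lincomb u xs + lincomb u ys"
  by (simp_all add: lincomb_def case_prod_beta)

lemma lincomb_map_scale:
  "lincomb u (map (\<lambda>(c, i). (d * c, i)) xs) = d *\<^sub>C lincomb u xs"
  by (induction xs)
    (auto simp: complex_vector.scale_zero_right scaleC_add_right scaleC_scaleC)

lemma lincomb_sum:
  "lincomb u xs = (\<Sum>k<length xs. fst (xs ! k) *\<^sub>C u (snd (xs ! k)))"
  by (simp add: lincomb_def sum_list_sum_nth case_prod_beta atLeast0LessThan)

lemma cspan_subset_lincomb: "cspan (range u) \<subseteq> range (lincomb u)"
proof (rule complex_vector.span_minimal)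
  show "range u \<subseteq> range (lincomb u)"
  proof clarify
    fix i
    have "u i = lincomb u [(1, i)]"
      by (simp add: scaleC_one)
    then show "u i \<in> range (lincomb u)" by blast
  qed
  show "csubspace (range (lincomb u))"
    unfolding complex_vector.subspace_def
    by (auto simp flip: lincomb_append lincomb_map_scale) (metis lincomb_Nil rangeI)
qed

text \<open>The operator is obtained from its graph \<open>G\<close>, the limits of pairs of
  combinations with equal coefficients. The bound passes to the limit, which makes \<open>G\<close>
  single-valued even when a vector has several representations; completeness makes it total.\<close>

lemma bop_extension:
  fixes u v :: "'i \<Rightarrow> 'h::complex_hilbert"
  assumes dense: "closure (cspan (range u)) = UNIV"
    and bound: "\<And>xs. norm (lincomb v xs) \<le> K * norm (lincomb u xs)"
  shows "\<exists>L :: 'h bop. \<forall>i. L (u i) = v i"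
proof -
  define G where "G x y \<longleftrightarrow>
    (\<exists>xs. (\<lambda>n. lincomb u (xs n)) \<longlonglongrightarrow> x \<and> (\<lambda>n. lincomb v (xs n)) \<longlonglongrightarrow> y)" for x y
  have G_add: "G (x + x') (y + y')" if xy: "G x y" "G x' y'" for x y x' y'
  proof -
    obtain xs xs' where "(\<lambda>n. lincomb u (xs n)) \<longlonglongrightarrow> x" "(\<lambda>n. lincomb v (xs n)) \<longlonglongrightarrow> y"
      "(\<lambda>n. lincomb u (xs' n)) \<longlonglongrightarrow> x'" "(\<lambda>n. lincomb v (xs' n)) \<longlonglongrightarrow> y'"
      using xy unfolding G_def by blast
    then show ?thesis
      unfolding G_def by (intro exI [of _ "\<lambda>n. xs n @ xs' n"]) (auto intro: tendsto_add)
  qed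
  have G_scale: "G (c *\<^sub>C x) (c *\<^sub>C y)" if xy: "G x y" for c x y
  proof -
    obtain xs where "(\<lambda>n. lincomb u (xs n)) \<longlonglongrightarrow> x" "(\<lambda>n. lincomb v (xs n)) \<longlonglongrightarrow> y"
      using xy unfolding G_def by blast
    then show ?thesis
      unfolding G_def
      by (intro exI [of _ "\<lambda>n. map (\<lambda>(d, i). (c * d, i)) (xs n)"])
        (simp add: lincomb_map_scale tendsto_scaleC)
  qed
  have G_bound: "norm y \<le> K * norm x" if xy: "G x y" for x y
  proof -
    obtain xs where xs: "(\<lambda>n. lincomb u (xs n)) \<longlonglongrightarrow> x" "(\<lambda>n. lincomb v (xs n)) \<longlonglongrightarrow> y"
      using xy unfolding G_def by blast
    show ?thesis
      by (rule LIMSEQ_le [OF tendsto_norm [OF xs(2)] tendsto_mult_left [OF tendsto_norm [OF xs(1)]]])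
        (use bound in blast)
  qed
  have G_fun: "y = y'" if "G x y" "G x y'" for x y y'
  proof -
    have "G (x + (-1) *\<^sub>C x) (y + (-1) *\<^sub>C y')"
      using that by (intro G_add G_scale)
    then have "norm (y + (-1) *\<^sub>C y') \<le> K * norm (x + (-1) *\<^sub>C x)"
      by (rule G_bound)
    then show ?thesis
      by (simp add: complex_vector.scale_minus_left scaleC_one)
  qed
  have G_total: "\<exists>y. G x y" for x
  proof -
    have "x \<in> closure (cspan (range u))"
      using dense by blast
    then obtain f where f: "\<And>n. f n \<in> cspan (range u)" "f \<longlonglongrightarrow> x"
      by (meson closure_sequential)
    have "\<forall>n. \<exists>xs. f n = lincomb u xs"
      using f(1) cspan_subset_lincomb [of u] by blast
    then have "\<exists>xs. \<forall>n. f n = lincomb u (xs n)"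
      by (rule choice)
    then obtain xs where xs: "\<And>n. f n = lincomb u (xs n)"
      by blast
    have "Cauchy f"
      using f(2) by (rule LIMSEQ_imp_Cauchy)
    \<comment> \<open>The constant \<open>K\<close> may be 0 or negative; the Cauchy estimate
      divides by a positive one.\<close>
    have diff: "norm (lincomb v (xs m) - lincomb v (xs n)) \<le> (\<bar>K\<bar> + 1) * norm (f m - f n)" for m n
    proof -
      have "lincomb w (xs m @ map (\<lambda>(c, i). (-1 * c, i)) (xs n)) =
          lincomb w (xs m) - lincomb w (xs n)" for w :: "'i \<Rightarrow> 'h"
        by (simp only: lincomb_append lincomb_map_scale)
          (simp add: complex_vector.scale_minus_left scaleC_one)
      with bound [of "xs m @ map (\<lambda>(c, i). (-1 * c, i)) (xs n)"]
      have "norm (lincomb v (xs m) - lincomb v (xs n)) \<le> K * norm (f m - f n)"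
        by (simp only: xs)
      also have "\<dots> \<le> (\<bar>K\<bar> + 1) * norm (f m - f n)"
        by (intro mult_right_mono) auto
      finally show ?thesis .
    qed
    have "Cauchy (\<lambda>n. lincomb v (xs n))"
    proof (rule CauchyI)
      fix e :: real assume "e > 0"
      then have "e / (\<bar>K\<bar> + 1) > 0" by simp
      then obtain M where M: "\<And>m n. m \<ge> M \<Longrightarrow> n \<ge> M \<Longrightarrow> norm (f m - f n) < e / (\<bar>K\<bar> + 1)"
        using CauchyD [OF \<open>Cauchy f\<close>] by meson
      show "\<exists>M. \<forall>m\<ge>M. \<forall>n\<ge>M. norm (lincomb v (xs m) - lincomb v (xs n)) < e"
      proof (intro exI [of _ M] allI impI)
        fix m n assume "M \<le> m" "M \<le> n"
        then have "(\<bar>K\<bar> + 1) * norm (f m - f n) < e"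
          using M by (simp add: field_simps)
        with diff show "norm (lincomb v (xs m) - lincomb v (xs n)) < e"
          by (rule order.strict_trans1)
      qed
    qed
    then obtain y where "(\<lambda>n. lincomb v (xs n)) \<longlonglongrightarrow> y"
      by (meson Cauchy_convergent convergent_def)
    moreover have "(\<lambda>n. lincomb u (xs n)) \<longlonglongrightarrow> x"
      using f(2) by (simp flip: xs)
    ultimately show ?thesis
      unfolding G_def by blast
  qed
  define L where "L x = (THE y. G x y)" for x
  have L: "G x (L x)" for x
    unfolding L_def using G_total G_fun by (metis theI)
  have L_eq: "L x = y" if "G x y" for x y
    using G_fun L that by blast
  have L_scaleC: "L (c *\<^sub>C x) = c *\<^sub>C L x" for c x
    by (intro L_eq G_scale L)
  have "bounded_linear L"
  proof (rule bounded_linear_intro)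
    show "L (x + y) = L x + L y" for x y
      by (intro L_eq G_add L)
    show "L (r *\<^sub>R x) = r *\<^sub>R L x" for r x
      by (simp add: scaleR_scaleC L_scaleC)
    show "norm (L x) \<le> norm x * K" for x
      using G_bound [OF L] by (simp add: mult.commute)
  qed
  then have "bounded_clinear L"
    using L_scaleC by (simp add: bounded_clinear_def)
  moreover have "L (u i) = v i" for i
  proof -
    have "G (u i) (v i)"
      unfolding G_def by (intro exI [of _ "\<lambda>_. [(1, i)]"]) (simp add: scaleC_one)
    then show ?thesis by (rule L_eq)
  qed
  ultimately show ?thesis
    by (intro exI [of _ "Bop L"]) (simp add: Bop_inverse)
qed

section \<open>Positive operators and their square roots\<close>

lemma positive_op_iff:
  "positive_op T \<longleftrightarrow> (\<forall>h. Im (cinner (T h) h) = 0 \<and> 0 \<le> Re (cinner (T h) h))"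
  by (auto simp: positive_op_def complex_nonneg_Reals_iff)

definition selfadjoint_op :: "'a::complex_inner bop \<Rightarrow> bool"
  where "selfadjoint_op T \<longleftrightarrow> (\<forall>h k. cinner (T h) k = cinner h (T k))"

lemma selfadjoint_opD: "selfadjoint_op T \<Longrightarrow> cinner (T h) k = cinner h (T k)"
  by (simp add: selfadjoint_op_def)

text \<open>Polarization from the reality of the quadratic form: \<open>h + k\<close> settles the
  imaginary part of the sesquilinear form, \<open>h + \<i> *\<^sub>C k\<close> the real
  part.\<close>

lemma positive_op_selfadjoint:
  assumes "positive_op T"
  shows "selfadjoint_op T"
  unfolding selfadjoint_op_def
proof (intro allI)
  fix h k
  have im: "Im (cinner (T v) v) = 0" for v
    using assms by (simp add: positive_op_iff)
  have 1: "Im (cinner (T h) k) + Im (cinner (T k) h) = 0"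
    using im [of "h + k"] im [of h] im [of k] by (simp add: bop_add cinner_simps)
  have 2: "Re (cinner (T h) k) = Re (cinner (T k) h)"
    using im [of "h + \<i> *\<^sub>C k"] im [of h] im [of k]
    by (simp add: bop_add bop_scaleC cinner_simps)
  show "cinner (T h) k = cinner h (T k)"
    using 1 2 cinner_commute [of h "T k"] by (simp add: complex_eq_iff)
qed

lemma selfadjoint_op_Im_zero: "selfadjoint_op T \<Longrightarrow> Im (cinner (T h) h) = 0"
  using cinner_commute [of "T h" h] by (simp add: selfadjoint_op_def complex_eq_iff)

lemma selfadjoint_op_intros:
  shows "selfadjoint_op 0" "selfadjoint_op 1"
    and "selfadjoint_op S \<Longrightarrow> selfadjoint_op T \<Longrightarrow> selfadjoint_op (S + T)"
    and "selfadjoint_op S \<Longrightarrow> selfadjoint_op T \<Longrightarrow> selfadjoint_op (S - T)"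
    and "selfadjoint_op T \<Longrightarrow> selfadjoint_op (of_real r *\<^sub>C T)"
    and "selfadjoint_op S \<Longrightarrow> selfadjoint_op T \<Longrightarrow> S * T = T * S \<Longrightarrow> selfadjoint_op (S * T)"
  by (auto simp: selfadjoint_op_def bop_rep cinner_simps) (metis times_bop.rep_eq)

lemma bop_power_commute: "S * T = T * S \<Longrightarrow> S * T ^ n = T ^ n * (S :: 'a::complex_inner bop)"
  by (induction n) (simp, metis mult.assoc power_Suc)

lemma positive_op_Cauchy_Schwarz:
  assumes "positive_op T"
  shows "(cmod (cinner (T x) y))\<^sup>2 \<le> Re (cinner (T x) x) * Re (cinner (T y) y)"
proof (rule psd_form_Cauchy_Schwarz [of "\<lambda>x y. cinner (T x) y"])
  show "cinner (T x) y = cnj (cinner (T y) x)" for x y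
    using selfadjoint_opD [OF positive_op_selfadjoint [OF assms], of x y] cinner_commute by metis
qed (use assms in \<open>auto simp: bop_linear_simps cinner_simps positive_op_iff\<close>)

text \<open>The form inequality at \<open>x\<close> and \<open>T x\<close>, with one factor of
  squared norm of \<open>T x\<close> cancelled.\<close>

lemma positive_op_norm_le:
  assumes pos: "positive_op T" and le: "\<And>x. Re (cinner (T x) x) \<le> K * (norm x)\<^sup>2" and "K \<ge> 0"
  shows "norm (T x) \<le> K * norm x"
proof -
  have "(norm (T x))\<^sup>2 * (norm (T x))\<^sup>2 = (cmod (cinner (T x) (T x)))\<^sup>2"
    by (simp add: cinner_self power2_eq_square norm_mult)
  also have "\<dots> \<le> Re (cinner (T x) x) * Re (cinner (T (T x)) (T x))"
    using positive_op_Cauchy_Schwarz [OF pos] .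
  also have "\<dots> \<le> (K * (norm x)\<^sup>2) * (K * (norm (T x))\<^sup>2)"
    using le pos \<open>K \<ge> 0\<close> by (intro mult_mono) (auto simp: positive_op_iff)
  finally have *: "(norm (T x))\<^sup>2 * (norm (T x))\<^sup>2 \<le> (K * norm x)\<^sup>2 * (norm (T x))\<^sup>2"
    by (simp add: power2_eq_square mult_ac)
  show ?thesis
  proof (cases "T x = 0")
    case True
    then show ?thesis using \<open>K \<ge> 0\<close> by simp
  next
    case False
    then have "(norm (T x))\<^sup>2 \<le> (K * norm x)\<^sup>2"
      using mult_right_le_imp_le [OF *] by simp
    then show ?thesis
      by (rule power2_le_imp_le) (simp add: \<open>K \<ge> 0\<close>)
  qed
qed

lemma positive_op_kernel:
  assumes "positive_op T" "Re (cinner (T x) x) = 0"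
  shows "T x = 0"
  using positive_op_Cauchy_Schwarz [OF assms(1), of x "T x"] assms(2)
  by (simp add: cinner_self)

lemma positive_op_one: "positive_op 1"
  by (simp add: positive_op_iff bop_rep cinner_self)

lemma positive_op_add: "positive_op S \<Longrightarrow> positive_op T \<Longrightarrow> positive_op (S + T)"
  by (simp add: positive_op_iff bop_rep cinner_add_left)

lemma positive_op_scale: "positive_op T \<Longrightarrow> r \<ge> 0 \<Longrightarrow> positive_op (of_real r *\<^sub>C T)"
  by (simp add: positive_op_iff bop_rep cinner_scaleC_left)

lemma positive_op_conjugate:
  assumes "selfadjoint_op A" "positive_op T"
  shows "positive_op (A * T * A)"
  using assms by (auto simp: positive_op_iff bop_rep selfadjoint_op_def)

lemma positive_op_square: "selfadjoint_op A \<Longrightarrow> positive_op (A * A)"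
  using positive_op_conjugate [OF _ positive_op_one, of A] by simp

text \<open>The bounds \<open>\<parallel>S\<^sub>n\<parallel> \<le> s\<^sub>n\<close> and \<open>\<parallel>S\<^sub>n\<^sub>+\<^sub>1 - S\<^sub>n\<parallel> \<le> s\<^sub>n\<^sub>+\<^sub>1 - s\<^sub>n\<close> reduce the convergence of the
  iteration for \<open>1 - \<surd>(1 - A)\<close> to the scalar case \<open>A = 1\<close>.\<close>

fun sqrt_iter :: "'a::complex_inner bop \<Rightarrow> nat \<Rightarrow> 'a bop"
  where
    "sqrt_iter A 0 = 0"
  | "sqrt_iter A (Suc n) = (1 / 2) *\<^sub>C (A + sqrt_iter A n * sqrt_iter A n)"

fun sqrt_maj :: "nat \<Rightarrow> real"
  where "sqrt_maj 0 = 0" | "sqrt_maj (Suc n) = (1 + sqrt_maj n * sqrt_maj n) / 2"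

lemma sqrt_maj_bounds: "0 \<le> sqrt_maj n \<and> sqrt_maj n \<le> 1"
proof (induction n)
  case (Suc n)
  then have "sqrt_maj n * sqrt_maj n \<le> 1"
    by (simp add: mult_le_one)
  then show ?case by simp
qed simp

lemma sqrt_maj_mono: "sqrt_maj n \<le> sqrt_maj (Suc n)"
proof -
  have "0 \<le> (1 - sqrt_maj n)\<^sup>2" by simp
  then show ?thesis by (simp add: power2_eq_square algebra_simps)
qed

lemma convergent_sqrt_maj: "convergent sqrt_maj"
  using sqrt_maj_bounds sqrt_maj_mono
  by (intro Bseq_monoseq_convergent BseqI' [of _ 1]) (auto simp: incseq_SucI incseq_imp_monoseq)

lemma sqrt_iter_commute:
  assumes "C * A = A * C"
  shows "C * sqrt_iter A n = sqrt_iter A n * C"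
proof (induction n)
  case (Suc n)
  let ?S = "sqrt_iter A n"
  have "C * (?S * ?S) = (?S * ?S) * C"
    using Suc by (metis mult.assoc)
  then show ?case
    using assms by (simp add: scaleC_mult_bop distrib_left distrib_right)
qed simp

lemma sqrt_iter_selfadjoint: "selfadjoint_op A \<Longrightarrow> selfadjoint_op (sqrt_iter A n)"
proof (induction n)
  case (Suc n)
  then have "selfadjoint_op (of_real (1 / 2) *\<^sub>C (A + sqrt_iter A n * sqrt_iter A n))"
    by (intro selfadjoint_op_intros) auto
  then show ?case by simp
qed (simp add: selfadjoint_op_intros)

lemma sqrt_iter_bound:
  fixes A :: "'a::complex_inner bop"
  assumes A: "\<And>x. norm (A x) \<le> norm x"
  shows "norm (sqrt_iter A n x) \<le> sqrt_maj n * norm x"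
proof (induction n arbitrary: x)
  case (Suc n)
  let ?S = "sqrt_iter A n"
  have "norm (?S (?S x)) \<le> sqrt_maj n * (sqrt_maj n * norm x)"
    using Suc [of "?S x"] Suc [of x] sqrt_maj_bounds [of n]
    by (meson mult_left_mono order_trans)
  then have "norm (A x + ?S (?S x)) \<le> norm x + sqrt_maj n * (sqrt_maj n * norm x)"
    using A [of x] norm_triangle_mono by blast
  then show ?case
    by (simp only: sqrt_iter.simps sqrt_maj.simps bop_rep norm_scaleC) (simp add: norm_divide algebra_simps)
qed (simp add: bop_rep)

lemma sqrt_iter_contraction:
  fixes A :: "'a::complex_inner bop"
  assumes A: "\<And>x. norm (A x) \<le> norm x"
  shows "norm (sqrt_iter A n x) \<le> norm x"
  using sqrt_iter_bound [OF A, of n x] sqrt_maj_bounds [of n]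
    mult_right_mono [of "sqrt_maj n" 1 "norm x"] by simp

text \<open>Successive iterates commute, so the next increment is half of (S' - S)(S' + S). The
  scalar majorant factors in the same way, hence the bounds on the two factors multiply to the
  required one.\<close>

lemma sqrt_iter_step:
  fixes A :: "'a::complex_inner bop"
  assumes A: "\<And>x. norm (A x) \<le> norm x"
  shows "norm (sqrt_iter A (Suc n) x - sqrt_iter A n x) \<le> (sqrt_maj (Suc n) - sqrt_maj n) * norm x"
proof (induction n arbitrary: x)
  case 0
  then show ?case
    using A [of x] by (simp add: bop_rep norm_scaleC norm_divide)
next
  case (Suc n)
  let ?S = "sqrt_iter A n" and ?S' = "sqrt_iter A (Suc n)"
  have comm: "?S' * ?S = ?S * ?S'"
    by (intro sqrt_iter_commute sym [OF sqrt_iter_commute]) simp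
  have "sqrt_iter A (Suc (Suc n)) - ?S' =
      (1 / 2) *\<^sub>C ((A + ?S' * ?S') - (A + ?S * ?S))"
    by (simp only: sqrt_iter.simps complex_vector.scale_right_diff_distrib)
  also have "(A + ?S' * ?S') - (A + ?S * ?S) = (?S' - ?S) * (?S' + ?S)"
    using comm by (simp only: distrib_left left_diff_distrib) simp
  finally have eq: "sqrt_iter A (Suc (Suc n)) x - ?S' x = (1 / 2) *\<^sub>C ((?S' - ?S) ((?S' + ?S) x))"
    by (metis minus_bop.rep_eq scaleC_bop.rep_eq times_bop.rep_eq)
  have "norm ((?S' + ?S) x) \<le> (sqrt_maj (Suc n) + sqrt_maj n) * norm x"
    using sqrt_iter_bound [OF A, of n x] sqrt_iter_bound [OF A, of "Suc n" x]
    unfolding plus_bop.rep_eq distrib_right by (meson add_mono norm_triangle_le)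
  then have "norm ((?S' - ?S) ((?S' + ?S) x)) \<le>
      (sqrt_maj (Suc n) - sqrt_maj n) * ((sqrt_maj (Suc n) + sqrt_maj n) * norm x)"
    using Suc [of "(?S' + ?S) x"] sqrt_maj_mono [of n]
    unfolding minus_bop.rep_eq by (meson mult_left_mono order_trans diff_ge_0_iff_ge)
  also have "\<dots> = 2 * ((sqrt_maj (Suc (Suc n)) - sqrt_maj (Suc n)) * norm x)"
  proof -
    have "2 * (sqrt_maj (Suc (Suc n)) - sqrt_maj (Suc n)) =
        sqrt_maj (Suc n) * sqrt_maj (Suc n) - sqrt_maj n * sqrt_maj n"
      by (simp add: field_simps)
    also have "\<dots> = (sqrt_maj (Suc n) - sqrt_maj n) * (sqrt_maj (Suc n) + sqrt_maj n)"
      by (simp only: algebra_simps)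
    finally show ?thesis by (simp only: mult.assoc [symmetric])
  qed
  finally show ?case
    unfolding eq norm_scaleC by (simp only: norm_divide) simp
qed

lemma sqrt_iter_diff:
  fixes A :: "'a::complex_inner bop"
  assumes A: "\<And>x. norm (A x) \<le> norm x" and "m \<le> n"
  shows "norm (sqrt_iter A n x - sqrt_iter A m x) \<le> (sqrt_maj n - sqrt_maj m) * norm x"
  using \<open>m \<le> n\<close>
proof (induction n rule: dec_induct)
  case (step n)
  have "norm (sqrt_iter A (Suc n) x - sqrt_iter A m x) \<le>
      norm (sqrt_iter A (Suc n) x - sqrt_iter A n x) + norm (sqrt_iter A n x - sqrt_iter A m x)"
    by (metis diff_add_cancel norm_triangle_ineq add_diff_eq)
  also have "\<dots> \<le> (sqrt_maj (Suc n) - sqrt_maj n) * norm x + (sqrt_maj n - sqrt_maj m) * norm x"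
    using sqrt_iter_step [OF A] step.IH by (rule add_mono)
  finally show ?case by (simp only: left_diff_distrib)
qed simp

lemma sqrt_iter_limit:
  fixes A :: "'a::complex_hilbert bop"
  assumes A: "\<And>x. norm (A x) \<le> norm x"
  obtains B :: "'a bop" where "\<And>x. (\<lambda>n. sqrt_iter A n x) \<longlonglongrightarrow> B x"
proof -
  have "Cauchy (\<lambda>n. sqrt_iter A n x)" for x
  proof (rule CauchyI)
    fix e :: real assume "e > 0"
    have "Cauchy sqrt_maj"
      using convergent_sqrt_maj by (simp add: Cauchy_convergent_iff)
    moreover have "e / (norm x + 1) > 0"
      using \<open>e > 0\<close> by (simp add: add_nonneg_pos)
    ultimately obtain M where
      M: "\<And>m n. m \<ge> M \<Longrightarrow> n \<ge> M \<Longrightarrow> norm (sqrt_maj m - sqrt_maj n) < e / (norm x + 1)"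
      using CauchyD by meson
    have le: "norm (sqrt_iter A n x - sqrt_iter A m x) < e" if "M \<le> m" "m \<le> n" for m n
    proof -
      have "norm (sqrt_iter A n x - sqrt_iter A m x) \<le> (sqrt_maj n - sqrt_maj m) * norm x"
        using sqrt_iter_diff [OF A] that by blast
      also have "\<dots> \<le> \<bar>sqrt_maj n - sqrt_maj m\<bar> * (norm x + 1)"
        by (intro mult_mono) auto
      also have "\<dots> < e"
        using M [of n m] that by (simp add: pos_less_divide_eq add_nonneg_pos)
      finally show ?thesis .
    qed
    show "\<exists>M. \<forall>m\<ge>M. \<forall>n\<ge>M. norm (sqrt_iter A m x - sqrt_iter A n x) < e"
      using le by (metis nle_le norm_minus_commute)
  qed
  then have "\<forall>x. \<exists>y. (\<lambda>n. sqrt_iter A n x) \<longlonglongrightarrow> y"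
    by (meson Cauchy_convergent convergent_def)
  then obtain b where b: "\<And>x. (\<lambda>n. sqrt_iter A n x) \<longlonglongrightarrow> b x"
    by metis
  have scale: "b (c *\<^sub>C x) = c *\<^sub>C b x" for c x
  proof (rule LIMSEQ_unique [OF b])
    show "(\<lambda>n. sqrt_iter A n (c *\<^sub>C x)) \<longlonglongrightarrow> c *\<^sub>C b x"
      using tendsto_scaleC [OF b [of x], of c] by (simp add: bop_scaleC)
  qed
  have "bounded_linear b"
  proof (rule bounded_linear_intro)
    show "b (x + y) = b x + b y" for x y
    proof (rule LIMSEQ_unique [OF b])
      show "(\<lambda>n. sqrt_iter A n (x + y)) \<longlonglongrightarrow> b x + b y"
        using tendsto_add [OF b [of x] b [of y]] by (simp add: bop_add)
    qed
    show "b (r *\<^sub>R x) = r *\<^sub>R b x" for r x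
      by (simp add: scaleR_scaleC scale)
    show "norm (b x) \<le> norm x * 1" for x
      by (rule LIMSEQ_le_const2 [OF tendsto_norm [OF b]])
        (simp add: sqrt_iter_contraction [OF A])
  qed
  then have "bop_apply (Bop b) = b"
    using scale by (simp add: Bop_inverse bounded_clinear_def)
  with b that [of "Bop b"] show thesis by metis
qed

text \<open>With A = 1 - T the limit B of the iteration solves B = (A + B^2)/2, which is the same as
  (1 - B)^2 = T. Every iterate is a polynomial in A, so whatever commutes with T commutes with the
  limit.\<close>

lemma positive_sqrt_exists_contraction:
  fixes T :: "'a::complex_hilbert bop"
  assumes pos: "positive_op T" and le: "\<And>x. Re (cinner (T x) x) \<le> (norm x)\<^sup>2"
  shows "\<exists>S. positive_op S \<and> S * S = T \<and> (\<forall>C. C * T = T * C \<longrightarrow> C * S = S * C)"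
proof -
  define A where "A = 1 - T"
  have "positive_op A"
    using pos le by (simp add: A_def positive_op_iff bop_rep cinner_simps cinner_self)
  then have "norm (A x) \<le> 1 * norm x" for x
    by (rule positive_op_norm_le)
      (use pos in \<open>auto simp: A_def positive_op_iff bop_rep cinner_simps cinner_self\<close>)
  then have A: "norm (A x) \<le> norm x" for x
    by simp
  obtain B :: "'a bop" where B: "\<And>x. (\<lambda>n. sqrt_iter A n x) \<longlonglongrightarrow> B x"
    using sqrt_iter_limit [OF A] by blast
  note le1 = sqrt_iter_contraction [OF A]
  \<comment> \<open>Strong limits need not multiply in general; here the iterates are contractions,
    so the inner limit may be inserted first.\<close>
  have BB: "(\<lambda>n. sqrt_iter A n (sqrt_iter A n x)) \<longlonglongrightarrow> B (B x)" for x
  proof -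
    have "(\<lambda>n. sqrt_iter A n (sqrt_iter A n x - B x)) \<longlonglongrightarrow> 0"
    proof (rule Lim_null_comparison)
      show "\<forall>\<^sub>F n in sequentially. norm (sqrt_iter A n (sqrt_iter A n x - B x)) \<le> norm (sqrt_iter A n x - B x)"
        using le1 by simp
      show "(\<lambda>n. norm (sqrt_iter A n x - B x)) \<longlonglongrightarrow> 0"
        using B [of x] by (simp add: tendsto_norm_zero LIM_zero)
    qed
    from tendsto_add [OF this B [of "B x"]] show ?thesis
      by (simp add: bop_diff)
  qed
  have fix_eq: "B x = (1 / 2) *\<^sub>C (A x + B (B x))" for x
  proof (rule LIMSEQ_unique)
    show "(\<lambda>n. sqrt_iter A (Suc n) x) \<longlonglongrightarrow> B x"
      using LIMSEQ_Suc [OF B [of x]] .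
    show "(\<lambda>n. sqrt_iter A (Suc n) x) \<longlonglongrightarrow> (1 / 2) *\<^sub>C (A x + B (B x))"
      using tendsto_scaleC [OF tendsto_add [OF tendsto_const BB [of x]], of "1 / 2" "A x"]
      by (simp add: bop_rep)
  qed
  have sq: "(1 - B) * (1 - B) = T"
  proof (rule bop_eqI)
    fix x
    have "(2::complex) *\<^sub>C B x = A x + B (B x)"
      by (subst fix_eq) (simp add: scaleC_scaleC scaleC_one)
    moreover have "(2::complex) *\<^sub>C B x = B x + B x"
      using scaleC_add_left [of 1 1 "B x"] by (simp add: scaleC_one)
    ultimately have "B x + B x = x - T x + B (B x)"
      by (simp add: A_def bop_rep)
    then show "((1 - B) * (1 - B)) x = T x"
      by (simp add: bop_rep bop_diff algebra_simps)
  qed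
  have sa: "selfadjoint_op B"
    unfolding selfadjoint_op_def
  proof (intro allI)
    fix h k
    have "selfadjoint_op (sqrt_iter A n)" for n
      using \<open>positive_op A\<close> positive_op_selfadjoint sqrt_iter_selfadjoint by blast
    then have "(\<lambda>n. cinner (sqrt_iter A n h) k) = (\<lambda>n. cinner h (sqrt_iter A n k))"
      by (simp add: selfadjoint_op_def)
    then show "cinner (B h) k = cinner h (B k)"
      using tendsto_cinner_left [OF B [of h]] tendsto_cinner_right [OF B [of k]] LIMSEQ_unique
      by metis
  qed
  have "Re (cinner (B x) x) \<le> (norm x)\<^sup>2" for x
  proof -
    have "norm (B x) \<le> norm x"
      by (rule LIMSEQ_le_const2 [OF tendsto_norm [OF B]]) (use le1 in blast)
    then have "norm (B x) * norm x \<le> norm x * norm x"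
      by (rule mult_right_mono) simp
    moreover have "Re (cinner (B x) x) \<le> norm (B x) * norm x"
      using complex_Re_le_cmod Cauchy_Schwarz_cinner by (rule order_trans)
    ultimately show ?thesis
      by (simp add: power2_eq_square)
  qed
  then have "positive_op (1 - B)"
    using selfadjoint_op_Im_zero [OF sa]
    by (simp add: positive_op_iff bop_rep cinner_simps cinner_self)
  moreover have "C * (1 - B) = (1 - B) * C" if "C * T = T * C" for C
  proof (rule bop_eqI)
    fix x
    have "C * A = A * C"
      using that by (simp add: A_def right_diff_distrib left_diff_distrib)
    then have "C (sqrt_iter A n x) = sqrt_iter A n (C x)" for n
      using sqrt_iter_commute by (metis times_bop.rep_eq)
    then have "C (B x) = B (C x)"
      using bop_tendsto [OF B [of x], of C] B [of "C x"] LIMSEQ_unique by simp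
    then show "(C * (1 - B)) x = ((1 - B) * C) x"
      by (simp add: bop_rep bop_diff)
  qed
  ultimately show ?thesis
    using sq by blast
qed

lemma positive_sqrt_exists:
  fixes T :: "'a::complex_hilbert bop"
  assumes pos: "positive_op T"
  shows "\<exists>S. positive_op S \<and> S * S = T \<and> (\<forall>C. C * T = T * C \<longrightarrow> C * S = S * C)"
proof -
  obtain K where K: "K > 0" "\<And>x. norm (T x) \<le> K * norm x"
    by (rule bop_norm_bound [of T]) blast
  define U where "U = of_real (1 / K) *\<^sub>C T"
  have "Re (cinner (U x) x) \<le> (norm x)\<^sup>2" for x
  proof -
    have "Re (cinner (T x) x) \<le> norm (T x) * norm x"
      using complex_Re_le_cmod Cauchy_Schwarz_cinner by (rule order_trans)
    also have "\<dots> \<le> (K * norm x) * norm x"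
      using K(2) by (intro mult_right_mono) auto
    finally show ?thesis
      using K(1) by (simp add: U_def bop_rep cinner_simps power2_eq_square field_simps)
  qed
  moreover have "positive_op U"
    using K(1) pos unfolding U_def by (intro positive_op_scale) auto
  ultimately obtain S where S: "positive_op S" "S * S = U" "\<And>C. C * U = U * C \<Longrightarrow> C * S = S * C"
    using positive_sqrt_exists_contraction by metis
  define R where "R = of_real (sqrt K) *\<^sub>C S"
  have "positive_op R"
    using K(1) S(1) unfolding R_def by (intro positive_op_scale) auto
  moreover have "R * R = T"
  proof -
    have "R * R = (of_real (sqrt K) * of_real (sqrt K) * of_real (1 / K)) *\<^sub>C T"
      by (simp only: R_def scaleC_mult_bop scaleC_scaleC S(2) U_def mult.assoc)
    also have "of_real (sqrt K) * of_real (sqrt K) * of_real (1 / K) = (1 :: complex)"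
      using K(1) by (simp flip: of_real_mult)
    finally show ?thesis
      by (simp add: scaleC_one)
  qed
  moreover have "C * R = R * C" if "C * T = T * C" for C
    using that S(3) [of C] by (simp add: R_def U_def scaleC_mult_bop)
  ultimately show ?thesis by blast
qed

text \<open>For v = (S - R) x commutation gives (S + R) v = (S^2 - R^2) x = 0. Both quadratic forms
  are nonnegative at v, so S v = R v = 0, and then v is orthogonal to itself.\<close>

lemma positive_sqrt_unique:
  fixes S R :: "'a::complex_hilbert bop"
  assumes S: "positive_op S" and R: "positive_op R" and eq: "S * S = R * R" and comm: "S * R = R * S"
  shows "S = R"
proof (rule bop_eqI)
  fix x
  define v where "v = S x - R x"
  have "S v + R v = (S * S - S * R + (R * S - R * R)) x"
    by (simp add: v_def bop_rep bop_linear_simps)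
  also have "\<dots> = 0"
    using eq comm by (simp add: bop_rep)
  finally have "cinner (S v + R v) v = 0"
    by simp
  then have "Re (cinner (S v) v) + Re (cinner (R v) v) = 0"
    by (metis cinner_add_left plus_complex.simps(1) zero_complex.simps(1))
  moreover have "Re (cinner (S v) v) \<ge> 0" "Re (cinner (R v) v) \<ge> 0"
    using S R by (simp_all add: positive_op_iff)
  ultimately have "S v = 0" "R v = 0"
    using S R by (intro positive_op_kernel; simp)+
  have "cinner v v = cinner x (S v - R v)"
    using positive_op_selfadjoint [OF S] positive_op_selfadjoint [OF R]
    by (subst (1) v_def) (simp add: cinner_simps selfadjoint_op_def)
  then have "v = 0"
    using \<open>S v = 0\<close> \<open>R v = 0\<close> by simp
  then show "S x = R x"
    by (simp add: v_def)
qed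

text \<open>Any positive root R commutes with T = R^2 and therefore with the constructed root S,
  since S commutes with the commutant of T. That supplies the commutation needed for uniqueness and
  makes the description \<open>sqrt_op\<close> meaningful.\<close>

lemma sqrt_op_props:
  assumes "positive_op T"
  shows positive_sqrt_op: "positive_op (sqrt_op T)"
    and sqrt_op_square: "sqrt_op T * sqrt_op T = T"
    and sqrt_op_commute: "C * T = T * C \<Longrightarrow> C * sqrt_op T = sqrt_op T * C"
proof -
  obtain S where S: "positive_op S" "S * S = T" "\<And>C. C * T = T * C \<Longrightarrow> C * S = S * C"
    using positive_sqrt_exists [OF assms] by blast
  have "R = S" if R: "positive_op R" "R * R = T" for R
  proof (rule positive_sqrt_unique)
    show "R * S = S * R"
      using R(2) by (intro S(3)) (simp flip: R(2) add: mult.assoc)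
    show "R * R = S * S"
      using R(2) S(2) by simp
  qed (rule R S)+
  then have "sqrt_op T = S"
    unfolding sqrt_op_def using S(1,2) by (intro the_equality conjI) (blast+)
  then show "positive_op (sqrt_op T)" "sqrt_op T * sqrt_op T = T"
    "C * T = T * C \<Longrightarrow> C * sqrt_op T = sqrt_op T * C"
    using S by blast+
qed

lemma sqrt_op_eqI:
  assumes S: "positive_op S" and eq: "S * S = T"
  shows "sqrt_op T = S"
proof -
  have T: "positive_op T"
    using positive_op_square [OF positive_op_selfadjoint [OF S]] eq by simp
  show ?thesis
  proof (rule positive_sqrt_unique)
    show "sqrt_op T * S = S * sqrt_op T"
      by (rule sqrt_op_commute [OF T, symmetric]) (simp flip: eq add: mult.assoc)
    show "sqrt_op T * sqrt_op T = S * S"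
      using sqrt_op_square [OF T] eq by simp
  qed (rule positive_sqrt_op [OF T] S)+
qed

lemma selfadjoint_sqrt_op: "positive_op T \<Longrightarrow> selfadjoint_op (sqrt_op T)"
  by (simp add: positive_op_selfadjoint positive_sqrt_op)

lemma positive_op_mult_commute:
  fixes S T :: "'a::complex_hilbert bop"
  assumes "positive_op S" "positive_op T" "S * T = T * S"
  shows "positive_op (S * T)"
proof -
  have "T * sqrt_op S = sqrt_op S * T"
    using assms by (intro sqrt_op_commute) auto
  then have "S * T = sqrt_op S * T * sqrt_op S"
    using sqrt_op_square [OF assms(1)] by (metis mult.assoc)
  then show ?thesis
    using assms by (simp add: positive_op_conjugate selfadjoint_sqrt_op)
qed

lemma sqrt_op_mult:
  fixes S T :: "'a::complex_hilbert bop"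
  assumes "positive_op S" "positive_op T" "S * T = T * S"
  shows "sqrt_op (S * T) = sqrt_op S * sqrt_op T"
proof (rule sqrt_op_eqI)
  have "sqrt_op T * S = S * sqrt_op T"
    using sqrt_op_commute [OF assms(2), of S] assms(3) by simp
  then have comm: "sqrt_op T * sqrt_op S = sqrt_op S * sqrt_op T"
    by (intro sqrt_op_commute assms)
  then show "positive_op (sqrt_op S * sqrt_op T)"
    using assms by (intro positive_op_mult_commute positive_sqrt_op) auto
  show "sqrt_op S * sqrt_op T * (sqrt_op S * sqrt_op T) = S * T"
    using comm sqrt_op_square [OF assms(1)] sqrt_op_square [OF assms(2)] by (metis mult.assoc)
qed

section \<open>Moments and distributions\<close>

lemma prob_real_iff_real_distribution: "prob_real \<mu> \<longleftrightarrow> real_distribution \<mu>"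
  by (auto simp: prob_real_def real_distribution_def real_distribution_axioms_def)

lemma real_distribution_integrable_bounded:
  fixes f :: "real \<Rightarrow> 'a::{banach, second_countable_topology}"
  assumes "prob_real \<mu>" "f \<in> borel_measurable borel" "AE t in \<mu>. norm (f t) \<le> B"
  shows "integrable \<mu> f"
proof -
  interpret real_distribution \<mu>
    using assms(1) by (simp add: prob_real_iff_real_distribution)
  show ?thesis
    using assms by (intro integrable_const_bound [of f B]) auto
qed

lemma compact_support_integrable:
  fixes f :: "real \<Rightarrow> 'a::{banach, second_countable_topology}"
  assumes "prob_real \<mu>" "compact_support \<mu>" "continuous_on UNIV f"
  shows "integrable \<mu> f"
proof -
  obtain r where r: "AE t in \<mu>. \<bar>t\<bar> \<le> r"
    using assms(2) by (auto simp: compact_support_def)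
  have "compact (f ` {-r..r})"
    using assms(3) by (intro compact_continuous_image) (auto intro: continuous_on_subset)
  then obtain B where B: "\<And>t. t \<in> {-r..r} \<Longrightarrow> norm (f t) \<le> B"
    by (meson bounded_iff compact_imp_bounded imageI)
  show ?thesis
    using assms(1)
  proof (rule real_distribution_integrable_bounded)
    show "f \<in> borel_measurable borel"
      using assms(3) by (rule borel_measurable_continuous_onI)
    show "AE t in \<mu>. norm (f t) \<le> B"
      using r by eventually_elim (rule B, auto)
  qed
qed

text \<open>The support bound r makes the n-th absolute moment at most |r|^n, so the Taylor
  remainder of the characteristic function is at most 2 (|t| |r|)^n / n!. Levy's uniqueness theorem
  then carries equality of moments over to measures.\<close>

lemma char_from_moments:
  assumes "prob_real \<mu>" "compact_support \<mu>"
  shows "(\<lambda>n. \<Sum>k\<le>n. ((\<i> * complex_of_real t) ^ k / fact k) * (\<integral>x. x ^ k \<partial>\<mu>)) \<longlonglongrightarrow> char \<mu> t"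
proof -
  interpret real_distribution \<mu>
    using assms(1) by (simp add: prob_real_iff_real_distribution)
  obtain r where r: "AE t in \<mu>. \<bar>t\<bar> \<le> r"
    using assms(2) by (auto simp: compact_support_def)
  have moments: "integrable \<mu> (\<lambda>x. x ^ k)" for k
    using assms by (rule compact_support_integrable) (intro continuous_intros)
  have abs_moment: "expectation (\<lambda>x. \<bar>x\<bar> ^ n) \<le> \<bar>r\<bar> ^ n" for n
  proof -
    have "expectation (\<lambda>x. \<bar>x\<bar> ^ n) \<le> expectation (\<lambda>x. \<bar>r\<bar> ^ n)"
    proof (rule integral_mono_AE)
      show "integrable \<mu> (\<lambda>x. \<bar>x\<bar> ^ n)"
        using assms by (rule compact_support_integrable) (intro continuous_intros)
      show "AE x in \<mu>. \<bar>x\<bar> ^ n \<le> \<bar>r\<bar> ^ n"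
        using r by eventually_elim (intro power_mono, auto)
    qed simp
    then show ?thesis by (simp add: prob_space del: space_eq_univ)
  qed
  have "(\<lambda>n. (\<Sum>k\<le>n. ((\<i> * complex_of_real t) ^ k / fact k) * (\<integral>x. x ^ k \<partial>\<mu>)) - char \<mu> t) \<longlonglongrightarrow> 0"
  proof (rule Lim_null_comparison)
    show "\<forall>\<^sub>F n in sequentially.
        norm ((\<Sum>k\<le>n. ((\<i> * complex_of_real t) ^ k / fact k) * (\<integral>x. x ^ k \<partial>\<mu>)) - char \<mu> t)
        \<le> 2 * (inverse (fact n) * (\<bar>t\<bar> * \<bar>r\<bar>) ^ n)"
    proof (rule always_eventually, rule allI)
      fix n
      have "norm ((\<Sum>k\<le>n. ((\<i> * complex_of_real t) ^ k / fact k) * (\<integral>x. x ^ k \<partial>\<mu>)) - char \<mu> t)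
          \<le> (2 * \<bar>t\<bar> ^ n / fact n) * expectation (\<lambda>x. \<bar>x\<bar> ^ n)"
        using char_approx1 [of n t] moments by (simp add: norm_minus_commute)
      also have "\<dots> \<le> (2 * \<bar>t\<bar> ^ n / fact n) * \<bar>r\<bar> ^ n"
        using abs_moment by (intro mult_left_mono) auto
      finally show "norm ((\<Sum>k\<le>n. ((\<i> * complex_of_real t) ^ k / fact k) * (\<integral>x. x ^ k \<partial>\<mu>)) - char \<mu> t)
          \<le> 2 * (inverse (fact n) * (\<bar>t\<bar> * \<bar>r\<bar>) ^ n)"
        by (simp add: field_simps power_mult_distrib)
    qed
    have "(\<lambda>n. inverse (fact n) * (\<bar>t\<bar> * \<bar>r\<bar>) ^ n) \<longlonglongrightarrow> 0"
      using summable_exp by (rule summable_LIMSEQ_zero)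
    then show "(\<lambda>n. 2 * (inverse (fact n) * (\<bar>t\<bar> * \<bar>r\<bar>) ^ n)) \<longlonglongrightarrow> 0"
      by (rule tendsto_mult_right_zero)
  qed
  then show ?thesis
    by (rule LIM_zero_cancel)
qed

lemma compact_support_moments_unique:
  assumes "prob_real \<mu>" "compact_support \<mu>" "prob_real \<nu>" "compact_support \<nu>"
    and "\<And>n. (\<integral>t. t ^ n \<partial>\<mu>) = (\<integral>t. t ^ n \<partial>\<nu>)"
  shows "\<mu> = \<nu>"
proof (rule Levy_uniqueness)
  show "char \<mu> = char \<nu>"
  proof
    fix t
    show "char \<mu> t = char \<nu> t"
      using char_from_moments [OF assms(1,2), of t] char_from_moments [OF assms(3,4), of t]
      unfolding assms(5) by (rule LIMSEQ_unique)
  qed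
qed (use assms in \<open>simp_all add: prob_real_iff_real_distribution\<close>)

lemma has_distribution_unique:
  assumes "has_distribution \<omega> a \<mu>" "has_distribution \<omega>' b \<nu>" "distribution \<omega> a = distribution \<omega>' b"
  shows "\<mu> = \<nu>"
proof -
  have "(\<lambda>n. complex_of_real (\<integral>t. t ^ n \<partial>\<mu>)) = (\<lambda>n. complex_of_real (\<integral>t. t ^ n \<partial>\<nu>))"
    using assms by (simp add: has_distribution_def)
  then show ?thesis
    using assms by (intro compact_support_moments_unique)
      (simp_all add: has_distribution_def fun_eq_iff)
qed

section \<open>The Hausdorff moment problem on the unit interval\<close>

lemma sum_choose_Suc_split:
  fixes f :: "nat \<Rightarrow> real"
  shows "(\<Sum>k\<le>Suc n. real (Suc n choose k) * f k) = (\<Sum>k\<le>n. real (n choose k) * (f k + f (Suc k)))"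
proof -
  have "(\<Sum>k\<le>Suc n. real (Suc n choose k) * f k) =
      f 0 + (\<Sum>k\<le>n. real (n choose Suc k) * f (Suc k)) + (\<Sum>k\<le>n. real (n choose k) * f (Suc k))"
    by (subst sum.atMost_Suc_shift) (simp add: sum.distrib algebra_simps)
  also have "f 0 + (\<Sum>k\<le>n. real (n choose Suc k) * f (Suc k)) = (\<Sum>k\<le>Suc n. real (n choose k) * f k)"
    by (subst sum.atMost_Suc_shift) simp
  also have "\<dots> = (\<Sum>k\<le>n. real (n choose k) * f k)"
    by simp
  finally show ?thesis
    by (simp add: sum.distrib algebra_simps)
qed

text \<open>Think of \<open>D a b\<close> as the integral of t^a (1 - t)^b; the sum is then the
  integral of (t + (1 - t))^n. It will be the total mass of the discrete approximations.\<close>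

lemma binomial_difference_sum:
  fixes D :: "nat \<Rightarrow> nat \<Rightarrow> real"
  assumes D: "\<And>a b. D a b = D (Suc a) b + D a (Suc b)"
  shows "(\<Sum>k\<le>n. real (n choose k) * D k (n - k)) = D 0 0"
  using assms
proof (induction n arbitrary: D)
  case 0
  show ?case by simp
next
  case (Suc n)
  have "(\<Sum>k\<le>Suc n. real (Suc n choose k) * D k (Suc n - k)) =
      (\<Sum>k\<le>n. real (n choose k) * (D k (Suc n - k) + D (Suc k) (n - k)))"
    by (subst sum_choose_Suc_split) simp
  also have "\<dots> = (\<Sum>k\<le>n. real (n choose k) * D (Suc k) (n - k)) +
      (\<Sum>k\<le>n. real (n choose k) * D k (Suc (n - k)))"
    by (simp add: sum.distrib algebra_simps Suc_diff_le)
  also have "\<dots> = D (Suc 0) 0 + D 0 (Suc 0)"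
    using Suc.IH [of "\<lambda>a b. D (Suc a) b", OF Suc.prems]
      Suc.IH [of "\<lambda>a b. D a (Suc b)", OF Suc.prems] by (simp only:)
  finally show ?case
    using Suc.prems [of 0 0] by (simp only:)
qed

text \<open>The absorption identity \<open>(n choose k) * k = n * (n - 1 choose k - 1)\<close> trades a factor \<open>k / n\<close>
  for a shift of \<open>D\<close>; the parameters \<open>c\<close> and \<open>d\<close> absorb the resulting shifts of \<open>k\<close> and \<open>n\<close>.\<close>

lemma bernstein_moments_tendsto:
  fixes D :: "nat \<Rightarrow> nat \<Rightarrow> real"
  assumes D: "\<And>a b. D a b = D (Suc a) b + D a (Suc b)"
  shows "(\<lambda>n. \<Sum>k\<le>n. real (n choose k) * (real (k + c) / real (n + d)) ^ j * D k (n - k)) \<longlonglongrightarrow> D j 0"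
  using assms
proof (induction j arbitrary: D c d)
  case 0
  show ?case
    using binomial_difference_sum [of D, OF 0] by simp
next
  case (Suc j)
  let ?S = "\<lambda>D c d n. \<Sum>k\<le>n. real (n choose k) * (real (k + c) / real (n + d)) ^ j * D k (n - k)"
  let ?D' = "\<lambda>a b. D (Suc a) b"
  have "(\<Sum>k\<le>Suc n. real (Suc n choose k) * (real (k + c) / real (Suc n + d)) ^ Suc j * D k (Suc n - k)) =
     real (Suc n) / real (Suc n + d) * ?S ?D' (Suc c) (Suc d) n + real c / real (Suc n + d) * ?S D c d (Suc n)" for n
  proof -
    let ?q = "\<lambda>k. real (k + c) / real (Suc n + d)"
    have "(\<Sum>k\<le>Suc n. real (Suc n choose k) * ?q k ^ Suc j * D k (Suc n - k)) =
        (\<Sum>k\<le>Suc n. real (Suc n choose k) * real k / real (Suc n + d) * ?q k ^ j * D k (Suc n - k)) +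
        (\<Sum>k\<le>Suc n. real c / real (Suc n + d) * (real (Suc n choose k) * ?q k ^ j * D k (Suc n - k)))"
      unfolding sum.distrib [symmetric]
    proof (intro sum.cong refl)
      have split: "b * ((x + y) / N * w) * e = b * x / N * w * e + y / N * (b * w * e)"
        for b x y N w e :: real
        by (simp add: add_divide_distrib algebra_simps)
      show "real (Suc n choose k) * ?q k ^ Suc j * D k (Suc n - k) =
          real (Suc n choose k) * real k / real (Suc n + d) * ?q k ^ j * D k (Suc n - k) +
          real c / real (Suc n + d) * (real (Suc n choose k) * ?q k ^ j * D k (Suc n - k))" for k
        unfolding power_Suc of_nat_add [of k c] by (rule split)
    qed
    also have "(\<Sum>k\<le>Suc n. real (Suc n choose k) * real k / real (Suc n + d) * ?q k ^ j * D k (Suc n - k)) =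
        (\<Sum>k\<le>n. real (Suc n choose Suc k) * real (Suc k) / real (Suc n + d) * ?q (Suc k) ^ j * D (Suc k) (n - k))"
      by (subst sum.atMost_Suc_shift) simp
    also have "\<dots> = (\<Sum>k\<le>n. real (Suc n) / real (Suc n + d) *
        (real (n choose k) * (real (k + Suc c) / real (n + Suc d)) ^ j * D (Suc k) (n - k)))"
    proof (intro sum.cong refl)
      fix k
      have "real (Suc n choose Suc k) * real (Suc k) = real (Suc n) * real (n choose k)"
        unfolding of_nat_mult [symmetric] by (simp only: Suc_times_binomial_eq)
      then show "real (Suc n choose Suc k) * real (Suc k) / real (Suc n + d) * ?q (Suc k) ^ j * D (Suc k) (n - k) =
          real (Suc n) / real (Suc n + d) *
          (real (n choose k) * (real (k + Suc c) / real (n + Suc d)) ^ j * D (Suc k) (n - k))"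
        by (simp only: add_Suc add_Suc_right) simp
    qed
    finally show ?thesis
      by (simp only: sum_distrib_left)
  qed
  moreover have "(\<lambda>n. real (Suc n) / real (Suc n + d) * ?S ?D' (Suc c) (Suc d) n +
      real c / real (Suc n + d) * ?S D c d (Suc n)) \<longlonglongrightarrow> 1 * ?D' j 0 + 0 * D j 0"
  proof (intro tendsto_add tendsto_mult)
    show "(\<lambda>n. real (Suc n) / real (Suc n + d)) \<longlonglongrightarrow> 1"
      by real_asymp
    show "(\<lambda>n. real c / real (Suc n + d)) \<longlonglongrightarrow> 0"
      by real_asymp
    show "(\<lambda>n. ?S ?D' (Suc c) (Suc d) n) \<longlonglongrightarrow> ?D' j 0"
      by (rule Suc.IH) (rule Suc.prems)
    show "(\<lambda>n. ?S D c d (Suc n)) \<longlonglongrightarrow> D j 0"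
      by (rule LIMSEQ_Suc) (rule Suc.IH, rule Suc.prems)
  qed
  ultimately show ?case
    by (subst filterlim_sequentially_Suc [symmetric]) (simp del: sum.atMost_Suc)
qed

text \<open>The approximating measures put the Bernstein weights (n choose k)
  \<open>D k (n - k)\<close> on a grid in the unit interval. They are tight, a subsequence converges
  weakly, and \<open>bernstein_moments_tendsto\<close> identifies the moments of the limit.\<close>

lemma hausdorff_moments:
  fixes D :: "nat \<Rightarrow> nat \<Rightarrow> real"
  assumes D: "\<And>a b. D a b = D (Suc a) b + D a (Suc b)"
    and nonneg: "\<And>a b. 0 \<le> D a b" and one: "D 0 0 = 1"
  shows "\<exists>\<mu>. prob_real \<mu> \<and> (AE t in \<mu>. 0 \<le> t \<and> t \<le> 1) \<and> (\<forall>n. (\<integral>t. t ^ n \<partial>\<mu>) = D n 0)"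
proof -
  define P where "P n = point_measure {..n} (\<lambda>k. ennreal (real (n choose k) * D k (n - k)))" for n :: nat
  \<comment> \<open>The nodes have the shape c = 0, d = 1 of
    \<open>bernstein_moments_tendsto\<close>, so the denominator never vanishes.\<close>
  define X where "X n k = real (k + 0) / real (n + 1)" for n k :: nat
  define M where "M n = distr (P n) borel (X n)" for n
  have meas [measurable]: "X n \<in> measurable (P n) borel" for n
    by (simp add: P_def)
  have "emeasure (P n) (space (P n)) = 1" for n
  proof -
    have "emeasure (P n) (space (P n)) = (\<Sum>k\<le>n. ennreal (real (n choose k) * D k (n - k)))"
      unfolding P_def by (simp add: space_point_measure emeasure_point_measure_finite)
    also have "\<dots> = ennreal (\<Sum>k\<le>n. real (n choose k) * D k (n - k))"
      using nonneg by (intro sum_ennreal) simp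
    finally show ?thesis
      using binomial_difference_sum [of D n, OF D] one by simp
  qed
  then interpret P: prob_space "P n" for n
    by (rule prob_spaceI)
  have M: "real_distribution (M n)" for n
    unfolding M_def by (simp add: real_distribution_def real_distribution_axioms_def P.prob_space_distr)
  have int_M: "(\<integral>t. f t \<partial>M n) = (\<Sum>k\<le>n. real (n choose k) * D k (n - k) * f (X n k))"
    if [measurable]: "f \<in> borel_measurable borel" for f :: "real \<Rightarrow> real" and n
  proof -
    have "(\<integral>t. f t \<partial>M n) = (\<integral>k. f (X n k) \<partial>P n)"
      unfolding M_def by (rule integral_distr) simp_all
    then show ?thesis
      using nonneg by (simp add: P_def lebesgue_integral_point_measure_finite)
  qed
  have X01: "0 \<le> X n k \<and> X n k \<le> 1" if "k \<le> n" for n k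
    using that by (simp add: X_def field_simps)
  have AE_M: "AE t in M n. 0 \<le> t \<and> t \<le> 1" for n
  proof -
    have "AE k in P n. 0 \<le> X n k \<and> X n k \<le> 1"
      unfolding P_def AE_point_measure using X01 by blast
    then show ?thesis
      unfolding M_def by (subst AE_distr_iff) simp_all
  qed
  have "tight M"
    unfolding tight_def
  proof (intro conjI allI impI)
    fix e :: real assume "e > 0"
    \<comment> \<open>The interval is open on the left; starting it at -1 keeps the node 0
      inside.\<close>
    have "measure (M n) {-1<..1} = 1" for n
    proof -
      interpret Mn: real_distribution "M n" by (rule M)
      show ?thesis
        using AE_M [of n] by (subst Mn.prob_eq_1) auto
    qed
    then show "\<exists>a b. a < b \<and> (\<forall>n. 1 - e < measure (M n) {a<..b})"
      using \<open>e > 0\<close> by (intro exI [of _ "-1"] exI [of _ 1]) simp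
  qed (rule M)
  then obtain r \<mu> where r: "strict_mono (r :: nat \<Rightarrow> nat)" and mu: "real_distribution \<mu>"
    and conv: "weak_conv_m (M \<circ> id \<circ> r) \<mu>"
    using tight_imp_convergent_subsubsequence [of M id] by (auto simp: strict_mono_def)
  interpret mu: real_distribution \<mu> by (rule mu)
  have lim: "(\<lambda>n. \<integral>t. f t \<partial>M (r n)) \<longlonglongrightarrow> (\<integral>t. f t \<partial>\<mu>)"
    if "continuous_on UNIV f" "\<And>x. \<bar>f x\<bar> \<le> 1" for f :: "real \<Rightarrow> real"
    using weak_conv_imp_integral_bdd_continuous_conv [OF _ mu conv, of f 1] M that
    by (simp add: continuous_on_eq_continuous_at)
  \<comment> \<open>Weak convergence tests only bounded continuous functions, so powers of t are
    replaced by powers of the clamped variable. The function \<open>g\<close> below, tested in the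
    same way, shows that the limit measure does not see the clamping.\<close>
  define cl where "cl t = max 0 (min 1 t)" for t :: real
  have cl_cont: "continuous_on UNIV cl"
    unfolding cl_def by (intro continuous_intros)
  have cl01: "0 \<le> cl t" "cl t \<le> 1" for t
    by (simp_all add: cl_def)
  have cl_id: "cl t = t" if "0 \<le> t" "t \<le> 1" for t
    using that by (simp add: cl_def)
  define g where "g t = min 1 \<bar>t - cl t\<bar>" for t
  have g_cont: "continuous_on UNIV g"
    unfolding g_def by (intro continuous_intros cl_cont)
  have "(\<integral>t. g t \<partial>M n) = 0" for n
    using int_M [OF borel_measurable_continuous_onI [OF g_cont]] X01
    by (simp add: g_def cl_id)
  then have "(\<integral>t. g t \<partial>\<mu>) = 0"
    using lim [OF g_cont] LIMSEQ_unique [OF _ tendsto_const] by (simp add: g_def)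
  moreover have "integrable \<mu> g"
    using mu by (intro real_distribution_integrable_bounded [of _ _ 1] borel_measurable_continuous_onI g_cont)
      (auto simp: prob_real_iff_real_distribution g_def)
  ultimately have "AE t in \<mu>. g t = 0"
    by (subst (asm) integral_nonneg_eq_0_iff_AE) (auto simp: g_def)
  then have AE_cl: "AE t in \<mu>. t = cl t"
    by eventually_elim (auto simp: g_def min_def split: if_splits)
  have "(\<integral>t. t ^ n \<partial>\<mu>) = D n 0" for n
  proof -
    have cont: "continuous_on UNIV (\<lambda>t. cl t ^ n)"
      by (intro continuous_intros cl_cont)
    have "(\<lambda>m. \<integral>t. cl t ^ n \<partial>M m) = (\<lambda>m. \<Sum>k\<le>m. real (m choose k) * (real (k + 0) / real (m + 1)) ^ n * D k (m - k))"
    proof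
      fix m
      have "(\<integral>t. cl t ^ n \<partial>M m) = (\<Sum>k\<le>m. real (m choose k) * D k (m - k) * cl (X m k) ^ n)"
        by (rule int_M) (rule borel_measurable_continuous_onI [OF cont])
      also have "\<dots> = (\<Sum>k\<le>m. real (m choose k) * (real (k + 0) / real (m + 1)) ^ n * D k (m - k))"
        using X01 by (intro sum.cong refl) (simp add: cl_id, simp add: X_def)
      finally show "(\<integral>t. cl t ^ n \<partial>M m) = \<dots>" .
    qed
    then have "(\<lambda>m. \<integral>t. cl t ^ n \<partial>M m) \<longlonglongrightarrow> D n 0"
      using bernstein_moments_tendsto [of D 0 1 n, OF D] by (simp only:)
    then have "(\<lambda>m. \<integral>t. cl t ^ n \<partial>M (r m)) \<longlonglongrightarrow> D n 0"
      using LIMSEQ_subseq_LIMSEQ [OF _ r] by (simp add: comp_def)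
    moreover have "(\<lambda>m. \<integral>t. cl t ^ n \<partial>M (r m)) \<longlonglongrightarrow> (\<integral>t. cl t ^ n \<partial>\<mu>)"
      by (rule lim [OF cont]) (simp add: cl01 power_le_one)
    ultimately have "(\<integral>t. cl t ^ n \<partial>\<mu>) = D n 0"
      by (simp add: LIMSEQ_unique)
    moreover have "(\<integral>t. t ^ n \<partial>\<mu>) = (\<integral>t. cl t ^ n \<partial>\<mu>)"
    proof (rule integral_cong_AE)
      show "(\<lambda>t. cl t ^ n) \<in> borel_measurable \<mu>"
        using borel_measurable_continuous_onI [OF cont] by simp
      show "AE t in \<mu>. t ^ n = cl t ^ n"
        using AE_cl by eventually_elim simp
    qed simp
    ultimately show ?thesis by simp
  qed
  moreover have "AE t in \<mu>. 0 \<le> t \<and> t \<le> 1"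
    using AE_cl by eventually_elim (metis cl01)
  ultimately show ?thesis
    using mu by (auto simp: prob_real_iff_real_distribution)
qed

lemma positive_op_power: "positive_op T \<Longrightarrow> positive_op (T ^ n)"
  by (induction n)
    (auto intro!: positive_op_one positive_op_mult_commute simp: power_commutes)

text \<open>After scaling, U and V = 1 - U are commuting positive operators, so the vacuum moments
  of U^a V^b are nonnegative and satisfy the difference relation because U + V = 1. The Hausdorff
  problem applies, and the scaling is undone by pushing the measure forward.\<close>

lemma positive_op_has_distribution:
  fixes T :: "'a::complex_hilbert bop"
  assumes pos: "positive_op T" and unit: "norm \<xi> = 1"
  shows "\<exists>\<mu>. has_distribution (vector_state \<xi>) T \<mu> \<and> nonneg_support \<mu>"
proof -
  obtain K where K: "K > 0" "\<And>x. norm (T x) \<le> K * norm x"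
    by (rule bop_norm_bound [of T]) blast
  define U where "U = of_real (1 / K) *\<^sub>C T"
  define V where "V = 1 - U"
  have U: "positive_op U"
    using K(1) pos unfolding U_def by (intro positive_op_scale) auto
  have "Re (cinner (U x) x) \<le> (norm x)\<^sup>2" for x
  proof -
    have "Re (cinner (T x) x) \<le> norm (T x) * norm x"
      using complex_Re_le_cmod Cauchy_Schwarz_cinner by (rule order_trans)
    also have "\<dots> \<le> (K * norm x) * norm x"
      using K(2) by (intro mult_right_mono) auto
    finally show ?thesis
      using K(1) by (simp add: U_def bop_rep cinner_simps power2_eq_square field_simps)
  qed
  then have V: "positive_op V"
    using U by (simp add: V_def positive_op_iff bop_rep cinner_simps cinner_self)
  have UV: "U * V = V * U"
    by (simp add: V_def right_diff_distrib left_diff_distrib)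
  define D where "D a b = Re (cinner ((U ^ a * V ^ b) \<xi>) \<xi>)" for a b
  have "D a b = D (Suc a) b + D a (Suc b)" for a b
  proof -
    have "U ^ Suc a * V ^ b + U ^ a * V ^ Suc b = U ^ a * (U + V) * V ^ b"
      by (simp add: distrib_left distrib_right power_commutes mult.assoc)
    also have "U + V = 1"
      by (simp add: V_def)
    finally have "U ^ a * V ^ b = U ^ Suc a * V ^ b + U ^ a * V ^ Suc b"
      by simp
    then show ?thesis
      unfolding D_def by (metis cinner_add_left plus_bop.rep_eq plus_complex.simps(1))
  qed
  moreover have "0 \<le> D a b" for a b
  proof -
    have "U ^ a * V ^ b = V ^ b * U ^ a"
      using UV by (metis bop_power_commute)
    then have "positive_op (U ^ a * V ^ b)"
      using U V by (intro positive_op_mult_commute positive_op_power)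
    then show ?thesis
      by (simp add: D_def positive_op_iff)
  qed
  moreover have "D 0 0 = 1"
    using unit by (simp add: D_def bop_rep cinner_self)
  ultimately obtain \<nu> where nu: "prob_real \<nu>" "AE t in \<nu>. 0 \<le> t \<and> t \<le> 1"
    "\<And>n. (\<integral>t. t ^ n \<partial>\<nu>) = D n 0"
    using hausdorff_moments [of D] by blast
  interpret nu: real_distribution \<nu>
    using nu(1) by (simp add: prob_real_iff_real_distribution)
  define \<mu> where "\<mu> = distr \<nu> borel (\<lambda>u. K * u)"
  have "prob_real \<mu>"
    unfolding \<mu>_def prob_real_def by (auto intro!: nu.prob_space_distr)
  moreover have AE: "AE t in \<mu>. 0 \<le> t \<and> t \<le> K"
    unfolding \<mu>_def using nu(2) K(1)
    by (subst AE_distr_iff) (auto elim!: eventually_mono)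
  then have "compact_support \<mu>"
    unfolding compact_support_def by (intro exI [of _ K]) (auto elim: eventually_mono)
  moreover have "nonneg_support \<mu>"
    unfolding nonneg_support_def using AE by eventually_elim simp
  moreover have "vector_state \<xi> (T ^ n) = complex_of_real (\<integral>t. t ^ n \<partial>\<mu>)" for n
  proof -
    have "T ^ n = of_real (K ^ n) *\<^sub>C (U ^ n)"
    proof (induction n)
      case (Suc n)
      have "T = of_real K *\<^sub>C U"
        using K(1) by (simp add: U_def scaleC_scaleC scaleC_one flip: of_real_mult)
      then have "T ^ Suc n = (of_real K *\<^sub>C U) * (of_real (K ^ n) *\<^sub>C (U ^ n))"
        using Suc by simp
      then show ?case
        by (simp only: scaleC_mult_bop scaleC_scaleC) (simp add: mult.commute)
    qed (simp add: scaleC_one)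
    moreover have "cinner ((U ^ n) \<xi>) \<xi> = of_real (D n 0)"
      using positive_op_power [OF U, of n] by (simp add: D_def positive_op_iff complex_eq_iff)
    ultimately have "vector_state \<xi> (T ^ n) = of_real (K ^ n * D n 0)"
      by (simp add: vector_state_def bop_rep cinner_simps)
    moreover have "(\<integral>t. t ^ n \<partial>\<mu>) = K ^ n * D n 0"
      unfolding \<mu>_def by (subst integral_distr) (simp_all add: power_mult_distrib nu(3))
    ultimately show ?thesis by simp
  qed
  ultimately show ?thesis
    by (auto simp: has_distribution_def distribution_def)
qed

section \<open>The transforms of a distribution\<close>

text \<open>This is the moment generating function G = 1 + \<psi>. Its integrand is the resolvent
  kernel itself, which is easier to expand and to bound.\<close>

definition cauchy_kernel_transform :: "real measure \<Rightarrow> complex \<Rightarrow> complex"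
  where "cauchy_kernel_transform \<mu> z = (\<integral>t. 1 / (1 - z * complex_of_real t) \<partial>\<mu>)"

text \<open>The substitution s = t/(1 + t) compactifies the half-line: |1 - z t|/(1 + t) becomes |(1
  - s) - z s| on the unit interval, which attains its minimum and vanishes only if z is a
  nonnegative real.\<close>

lemma one_minus_mult_lower_bound:
  fixes z :: complex
  assumes "z \<notin> \<real>\<^sub>\<ge>\<^sub>0"
  obtains c where "c > 0" "\<And>t. 0 \<le> t \<Longrightarrow> c * (1 + t) \<le> cmod (1 - z * complex_of_real t)"
proof -
  define f where "f s = cmod (complex_of_real (1 - s) - z * complex_of_real s)" for s :: real
  have "\<exists>s\<in>{0..1}. \<forall>y\<in>{0..1}. f s \<le> f y"
    unfolding f_def by (intro continuous_attains_inf continuous_intros) auto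
  then obtain s where s: "s \<in> {0..1}" "\<And>y. y \<in> {0..1} \<Longrightarrow> f s \<le> f y"
    by blast
  have "f s \<noteq> 0"
  proof
    assume "f s = 0"
    then have eq: "complex_of_real (1 - s) = z * complex_of_real s"
      by (simp add: f_def)
    then have "s \<noteq> 0" by auto
    then have "z = complex_of_real ((1 - s) / s)"
      using eq by (simp add: field_simps)
    moreover have "0 \<le> (1 - s) / s"
      using s(1) by simp
    ultimately show False
      using assms by (simp only: nonneg_Reals_of_real_iff simp_thms)
  qed
  then have "f s > 0"
    by (simp add: f_def)
  moreover have "f s * (1 + t) \<le> cmod (1 - z * complex_of_real t)" if t: "0 \<le> t" for t
  proof -
    have "f s \<le> f (t / (1 + t))"
      using t by (intro s(2)) simp
    also have "f (t / (1 + t)) = cmod ((1 - z * complex_of_real t) / complex_of_real (1 + t))"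
    proof -
      have "1 - t / (1 + t) = 1 / (1 + t)"
        using t by (simp add: field_simps)
      then show ?thesis
        unfolding f_def by (simp add: diff_divide_distrib)
    qed
    also have "\<dots> = cmod (1 - z * complex_of_real t) / (1 + t)"
      using t unfolding norm_divide norm_of_real by simp
    finally show ?thesis
      using t by (simp add: field_simps)
  qed
  ultimately show thesis by (rule that)
qed

lemma one_minus_mult_nonzero:
  assumes "z \<notin> \<real>\<^sub>\<ge>\<^sub>0" "0 \<le> t"
  shows "1 - z * complex_of_real t \<noteq> 0"
proof -
  obtain c where "c > 0" "c * (1 + t) \<le> cmod (1 - z * complex_of_real t)"
    using one_minus_mult_lower_bound [OF assms(1)] assms(2) by metis
  moreover have "c * (1 + t) > 0"
    using \<open>c > 0\<close> assms(2) by simp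
  ultimately show ?thesis by auto
qed

lemma integrable_cauchy_kernel:
  assumes "prob_real \<mu>" "nonneg_support \<mu>" "z \<notin> \<real>\<^sub>\<ge>\<^sub>0"
  shows "integrable \<mu> (\<lambda>t. 1 / (1 - z * complex_of_real t))"
proof -
  obtain c where c: "c > 0" "\<And>t. 0 \<le> t \<Longrightarrow> c * (1 + t) \<le> cmod (1 - z * complex_of_real t)"
    using one_minus_mult_lower_bound [OF assms(3)] by metis
  have bound: "norm (1 / (1 - z * complex_of_real t)) \<le> 1 / c" if "0 \<le> t" for t
  proof -
    have "c \<le> c * (1 + t)"
      using c(1) that by simp
    then have "c \<le> cmod (1 - z * complex_of_real t)"
      using c(2) [OF that] by linarith
    then show ?thesis
      using c(1) by (simp add: norm_divide frac_le)
  qed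
  show ?thesis
  proof (rule real_distribution_integrable_bounded [OF assms(1)])
    show "AE t in \<mu>. norm (1 / (1 - z * complex_of_real t)) \<le> 1 / c"
      using assms(2) unfolding nonneg_support_def by eventually_elim (rule bound)
  qed measurable
qed

text \<open>Phrased by integrability instead of membership in the slit plane, so that it also covers
  small positive z, where the Neumann series are evaluated as well.\<close>

lemma psi_transform_eq:
  assumes "prob_real \<mu>" "AE t in \<mu>. 1 - z * complex_of_real t \<noteq> 0"
    and "integrable \<mu> (\<lambda>t. 1 / (1 - z * complex_of_real t))"
  shows "psi_transform \<mu> z = cauchy_kernel_transform \<mu> z - 1"
proof -
  interpret real_distribution \<mu>
    using assms(1) by (simp add: prob_real_iff_real_distribution)
  have "psi_transform \<mu> z = (\<integral>t. 1 / (1 - z * complex_of_real t) - 1 \<partial>\<mu>)"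
    unfolding psi_transform_def
  proof (rule integral_cong_AE)
    show "AE t in \<mu>. z * complex_of_real t / (1 - z * complex_of_real t) =
        1 / (1 - z * complex_of_real t) - 1"
      using assms(2) by eventually_elim (simp add: field_simps)
  qed measurable
  also have "\<dots> = cauchy_kernel_transform \<mu> z - 1"
    unfolding cauchy_kernel_transform_def using assms(3)
    by (subst Bochner_Integration.integral_diff) (simp_all add: prob_space del: space_eq_univ)
  finally show ?thesis .
qed

lemma psi_transform_cauchy_kernel:
  assumes "prob_real \<mu>" "nonneg_support \<mu>" "z \<notin> \<real>\<^sub>\<ge>\<^sub>0"
  shows "psi_transform \<mu> z = cauchy_kernel_transform \<mu> z - 1"
proof (rule psi_transform_eq)
  show "AE t in \<mu>. 1 - z * complex_of_real t \<noteq> 0"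
    using assms(2) unfolding nonneg_support_def
    by eventually_elim (rule one_minus_mult_nonzero [OF assms(3)])
qed (use assms in \<open>simp_all add: integrable_cauchy_kernel\<close>)

text \<open>Expansion of \<open>1 / (1 - z t) = \<Sum>\<^sub>k (z - w)\<^sup>k t\<^sup>k / (1 - w t)\<^sup>k\<^sup>+\<^sup>1\<close> around \<open>w\<close>; for \<open>w = 0\<close> this is
  the moment series.\<close>

lemma cauchy_kernel_transform_power_series:
  fixes w z :: complex
  assumes mu: "prob_real \<mu>" and C: "C \<ge> 0" and small: "C * cmod (z - w) < 1"
    and bound: "AE t in \<mu>. 1 - w * complex_of_real t \<noteq> 0 \<and>
      \<bar>t\<bar> \<le> C * cmod (1 - w * complex_of_real t) \<and> 1 \<le> C' * cmod (1 - w * complex_of_real t)"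
  shows "(\<lambda>k. (\<integral>t. complex_of_real t ^ k / (1 - w * complex_of_real t) ^ Suc k \<partial>\<mu>) * (z - w) ^ k)
      sums cauchy_kernel_transform \<mu> z"
    and "AE t in \<mu>. 1 - z * complex_of_real t \<noteq> 0"
    and "integrable \<mu> (\<lambda>t. 1 / (1 - z * complex_of_real t))"
proof -
  interpret real_distribution \<mu>
    using mu by (simp add: prob_real_iff_real_distribution)
  define q where "q = C * cmod (z - w)"
  have q: "0 \<le> q" "q < 1"
    using C small by (simp_all add: q_def)
  define f where "f k t = complex_of_real t ^ k / (1 - w * complex_of_real t) ^ Suc k * (z - w) ^ k"
    for k t
  \<comment> \<open>The constant \<open>C\<close> bounds the ratio of the geometric series by q, and
    \<open>C'\<close> bounds its leading factor. Neither bound depends on t, which permits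
    integration term by term.\<close>
  have pointwise: "norm (f k t) \<le> \<bar>C'\<bar> * q ^ k \<and> (\<lambda>k. f k t) sums (1 / (1 - z * complex_of_real t))
      \<and> 1 - z * complex_of_real t \<noteq> 0 \<and> norm (1 / (1 - z * complex_of_real t)) \<le> \<bar>C'\<bar> / (1 - q)"
    if t: "1 - w * complex_of_real t \<noteq> 0" "\<bar>t\<bar> \<le> C * cmod (1 - w * complex_of_real t)"
      "1 \<le> C' * cmod (1 - w * complex_of_real t)" for k t
  proof -
    define u where "u = 1 - w * complex_of_real t"
    define p where "p = complex_of_real t * (z - w) / u"
    have u: "u \<noteq> 0" "\<bar>t\<bar> \<le> C * cmod u" "1 \<le> C' * cmod u"
      using t by (simp_all add: u_def)
    have "\<bar>t\<bar> * cmod (z - w) \<le> C * cmod u * cmod (z - w)"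
      using u(2) by (rule mult_right_mono) simp
    then have "\<bar>t\<bar> * cmod (z - w) \<le> q * cmod u"
      by (simp add: q_def mult_ac)
    then have p: "cmod p \<le> q"
      using u(1) by (simp add: p_def norm_divide norm_mult pos_divide_le_eq)
    then have p1: "cmod p < 1"
      using q by simp
    have f: "f k t = 1 / u * p ^ k" for k
      by (simp add: f_def p_def u_def power_mult_distrib power_divide)
    have inv: "cmod (1 / u) \<le> \<bar>C'\<bar>"
    proof -
      have "1 \<le> \<bar>C'\<bar> * cmod u"
        using u(3) by (smt (verit) mult_right_mono norm_ge_zero)
      then show ?thesis
        using u(1) by (simp add: norm_divide field_simps)
    qed
    have eq: "u * (1 - p) = 1 - z * complex_of_real t"
      using u(1) by (simp add: p_def u_def field_simps)
    have nz: "1 - p \<noteq> 0"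
      using p1 by auto
    have "(\<lambda>k. 1 / u * p ^ k) sums (1 / u * (1 / (1 - p)))"
      using p1 by (intro sums_mult geometric_sums)
    moreover have inveq: "1 / u * (1 / (1 - p)) = 1 / (1 - z * complex_of_real t)"
      unfolding eq [symmetric] by simp
    moreover have "norm (f k t) \<le> \<bar>C'\<bar> * q ^ k"
      unfolding f norm_mult norm_power using inv p by (intro mult_mono power_mono) auto
    moreover have "1 - z * complex_of_real t \<noteq> 0"
      unfolding eq [symmetric] using u(1) nz by simp
    moreover have "norm (1 / u * (1 / (1 - p))) \<le> \<bar>C'\<bar> * (1 / (1 - q))"
    proof -
      have "1 - q \<le> cmod (1 - p)"
        using p norm_triangle_ineq2 [of 1 p] by simp
      then have "cmod (1 / (1 - p)) \<le> 1 / (1 - q)"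
        using q by (simp add: norm_divide frac_le)
      then show ?thesis
        unfolding norm_mult using inv by (intro mult_mono) auto
    qed
    ultimately show ?thesis
      by (simp add: f)
  qed
  have meas [measurable]: "f k \<in> borel_measurable borel" for k
    unfolding f_def by measurable
  have int_f: "integrable \<mu> (f k)" for k
  proof (rule real_distribution_integrable_bounded [OF mu meas])
    show "AE t in \<mu>. norm (f k t) \<le> \<bar>C'\<bar> * q ^ k"
      using bound by eventually_elim (use pointwise in blast)
  qed
  show nz: "AE t in \<mu>. 1 - z * complex_of_real t \<noteq> 0"
    using bound by eventually_elim (use pointwise in blast)
  show "integrable \<mu> (\<lambda>t. 1 / (1 - z * complex_of_real t))"
  proof (rule real_distribution_integrable_bounded [OF mu])
    show "AE t in \<mu>. norm (1 / (1 - z * complex_of_real t)) \<le> \<bar>C'\<bar> / (1 - q)"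
      using bound by eventually_elim (use pointwise in blast)
  qed measurable
  have summable_q: "summable (\<lambda>k. \<bar>C'\<bar> * q ^ k)"
    using q by (intro summable_mult summable_geometric) simp
  have "(\<lambda>k. integral\<^sup>L \<mu> (f k)) sums (\<integral>t. suminf (\<lambda>k. f k t) \<partial>\<mu>)"
  proof (rule sums_integral [OF int_f])
    show "AE t in \<mu>. summable (\<lambda>k. norm (f k t))"
      using bound
    proof eventually_elim
      case (elim t)
      then show ?case
        using pointwise by (intro summable_comparison_test' [OF summable_q, of 0]) auto
    qed
    show "summable (\<lambda>k. \<integral>t. norm (f k t) \<partial>\<mu>)"
    proof (rule summable_comparison_test' [OF summable_q, of 0])
      fix k
      have "(\<integral>t. norm (f k t) \<partial>\<mu>) \<le> (\<integral>t. \<bar>C'\<bar> * q ^ k \<partial>\<mu>)"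
      proof (rule integral_mono_AE)
        show "AE t in \<mu>. norm (f k t) \<le> \<bar>C'\<bar> * q ^ k"
          using bound by eventually_elim (use pointwise in blast)
      qed (simp_all add: int_f integrable_norm)
      then show "norm (\<integral>t. norm (f k t) \<partial>\<mu>) \<le> \<bar>C'\<bar> * q ^ k"
        by (simp add: prob_space del: space_eq_univ)
    qed
  qed
  moreover have "(\<integral>t. suminf (\<lambda>k. f k t) \<partial>\<mu>) = cauchy_kernel_transform \<mu> z"
    unfolding cauchy_kernel_transform_def
  proof (rule integral_cong_AE)
    show "AE t in \<mu>. suminf (\<lambda>k. f k t) = 1 / (1 - z * complex_of_real t)"
      using bound by eventually_elim (use pointwise in \<open>metis sums_unique\<close>)
  qed measurable
  moreover have "integral\<^sup>L \<mu> (f k) =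
      (\<integral>t. complex_of_real t ^ k / (1 - w * complex_of_real t) ^ Suc k \<partial>\<mu>) * (z - w) ^ k" for k
    unfolding f_def by (rule integral_mult_left_zero)
  ultimately show "(\<lambda>k. (\<integral>t. complex_of_real t ^ k / (1 - w * complex_of_real t) ^ Suc k \<partial>\<mu>) * (z - w) ^ k)
      sums cauchy_kernel_transform \<mu> z"
    by simp
qed

lemma cauchy_kernel_transform_local_series:
  assumes "prob_real \<mu>" "nonneg_support \<mu>" "w \<notin> \<real>\<^sub>\<ge>\<^sub>0"
  obtains r where "r > 0" "\<And>z. z \<in> ball w r \<Longrightarrow>
    (\<lambda>k. (\<integral>t. complex_of_real t ^ k / (1 - w * complex_of_real t) ^ Suc k \<partial>\<mu>) * (z - w) ^ k)
      sums cauchy_kernel_transform \<mu> z"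
proof -
  obtain c where c: "c > 0" "\<And>t. 0 \<le> t \<Longrightarrow> c * (1 + t) \<le> cmod (1 - w * complex_of_real t)"
    using one_minus_mult_lower_bound [OF assms(3)] by metis
  have bound: "AE t in \<mu>. 1 - w * complex_of_real t \<noteq> 0 \<and>
      \<bar>t\<bar> \<le> 1 / c * cmod (1 - w * complex_of_real t) \<and> 1 \<le> 1 / c * cmod (1 - w * complex_of_real t)"
    using assms(2) unfolding nonneg_support_def
  proof eventually_elim
    case (elim t)
    have "1 + t \<le> cmod (1 - w * complex_of_real t) / c"
      using c(1) c(2) [OF elim] by (simp add: pos_le_divide_eq mult.commute)
    then have "t \<le> cmod (1 - w * complex_of_real t) / c" "1 \<le> cmod (1 - w * complex_of_real t) / c"
      using elim by linarith+
    then show ?case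
      using one_minus_mult_nonzero [OF assms(3) elim] elim by simp
  qed
  show thesis
  proof (rule that [OF c(1)])
    fix z assume "z \<in> ball w c"
    then have "1 / c * cmod (z - w) < 1"
      using c(1) by (simp add: dist_norm norm_minus_commute)
    then show "(\<lambda>k. (\<integral>t. complex_of_real t ^ k / (1 - w * complex_of_real t) ^ Suc k \<partial>\<mu>) * (z - w) ^ k)
      sums cauchy_kernel_transform \<mu> z"
      using cauchy_kernel_transform_power_series [OF assms(1) _ _ bound, of z] c(1) by simp
  qed
qed

lemma cauchy_kernel_transform_moments:
  assumes "prob_real \<mu>" "AE t in \<mu>. \<bar>t\<bar> \<le> r" "r * cmod z < 1" "0 \<le> r"
  shows "(\<lambda>k. complex_of_real (\<integral>t. t ^ k \<partial>\<mu>) * z ^ k) sums cauchy_kernel_transform \<mu> z"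
    and "AE t in \<mu>. 1 - z * complex_of_real t \<noteq> 0"
    and "integrable \<mu> (\<lambda>t. 1 / (1 - z * complex_of_real t))"
proof -
  have bound: "AE t in \<mu>. 1 - 0 * complex_of_real t \<noteq> 0 \<and>
      \<bar>t\<bar> \<le> r * cmod (1 - 0 * complex_of_real t) \<and> 1 \<le> 1 * cmod (1 - 0 * complex_of_real t)"
    using assms(2) by simp
  note series = cauchy_kernel_transform_power_series [OF assms(1) assms(4) _ bound, of z]
  have "(\<integral>t. complex_of_real t ^ k \<partial>\<mu>) = complex_of_real (\<integral>t. t ^ k \<partial>\<mu>)" for k
    unfolding of_real_power [symmetric] by (rule integral_complex_of_real)
  then show "(\<lambda>k. complex_of_real (\<integral>t. t ^ k \<partial>\<mu>) * z ^ k) sums cauchy_kernel_transform \<mu> z"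
    using series(1) assms(3) by simp
  show "AE t in \<mu>. 1 - z * complex_of_real t \<noteq> 0"
    "integrable \<mu> (\<lambda>t. 1 / (1 - z * complex_of_real t))"
    using series(2,3) assms(3) by simp_all
qed

section \<open>Holomorphy and mapping properties on the slit plane\<close>

lemma open_Compl_nonneg_Reals: "open (- \<real>\<^sub>\<ge>\<^sub>0 :: complex set)"
  using closed_nonneg_Reals_complex by (rule open_Compl)

lemma connected_Compl_nonneg_Reals: "connected (- \<real>\<^sub>\<ge>\<^sub>0 :: complex set)"
proof -
  have "(\<real>\<^sub>\<ge>\<^sub>0 :: complex set) = complex_of_real ` {0..}"
    by (auto simp: nonneg_Reals_def)
  then show ?thesis
    using starlike_slotted_complex_plane_right [of 0] by (simp add: starlike_imp_connected)
qed

lemma cauchy_kernel_transform_holomorphic: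
  assumes "prob_real \<mu>" "nonneg_support \<mu>"
  shows "cauchy_kernel_transform \<mu> holomorphic_on (- \<real>\<^sub>\<ge>\<^sub>0)"
proof -
  have "cauchy_kernel_transform \<mu> field_differentiable (at w)" if "w \<in> - \<real>\<^sub>\<ge>\<^sub>0" for w
  proof -
    obtain r where r: "r > 0" "\<And>z. z \<in> ball w r \<Longrightarrow>
        (\<lambda>k. (\<integral>t. complex_of_real t ^ k / (1 - w * complex_of_real t) ^ Suc k \<partial>\<mu>) * (z - w) ^ k)
          sums cauchy_kernel_transform \<mu> z"
      using cauchy_kernel_transform_local_series [OF assms, of w] \<open>w \<in> - \<real>\<^sub>\<ge>\<^sub>0\<close> by auto
    then have "cauchy_kernel_transform \<mu> holomorphic_on ball w r"
      by (intro power_series_holomorphic)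
    then show ?thesis
      using r(1) by (simp add: holomorphic_on_imp_differentiable_at)
  qed
  then show ?thesis
    by (simp add: holomorphic_on_def field_differentiable_at_within)
qed

lemma prob_real_eq_delta:
  assumes "prob_real \<mu>" "AE t in \<mu>. t = c"
  shows "\<mu> = delta c"
proof -
  interpret real_distribution \<mu>
    using assms(1) by (simp add: prob_real_iff_real_distribution)
  have "distr \<mu> borel (\<lambda>t. t) = distr \<mu> borel (\<lambda>_. c)"
    using assms(2) by (intro distr_cong_AE) auto
  moreover have "distr \<mu> borel (\<lambda>t. t) = \<mu>"
    by (rule distr_id2) simp
  moreover have "distr \<mu> borel (\<lambda>_. c) = delta c"
    by (rule prob_space.distr_const) (simp_all add: prob_space_axioms)
  ultimately show ?thesis by simp
qed

text \<open>Source of the strict inequalities below: a zero integral forces f = 0 almost everywhere,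
  hence t = 0 almost everywhere, and the measure would be the point mass at 0.\<close>

lemma not_delta_0_integral_pos:
  fixes f :: "real \<Rightarrow> real"
  assumes mu: "prob_real \<mu>" "nonneg_support \<mu>" "\<mu> \<noteq> delta 0"
    and int: "integrable \<mu> f" and pos: "\<And>t. 0 \<le> t \<Longrightarrow> 0 \<le> f t" "\<And>t. 0 < t \<Longrightarrow> 0 < f t"
  shows "0 < (\<integral>t. f t \<partial>\<mu>)"
proof -
  have nonneg: "AE t in \<mu>. 0 \<le> f t"
    using mu(2) unfolding nonneg_support_def by eventually_elim (rule pos)
  have "(\<integral>t. f t \<partial>\<mu>) \<noteq> 0"
  proof
    assume "(\<integral>t. f t \<partial>\<mu>) = 0"
    then have "AE t in \<mu>. f t = 0"
      using integral_nonneg_eq_0_iff_AE [OF int nonneg] by simp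
    with mu(2) have "AE t in \<mu>. t = 0"
      unfolding nonneg_support_def
      by eventually_elim (metis less_eq_real_def less_irrefl pos(2))
    then show False
      using prob_real_eq_delta mu by blast
  qed
  moreover have "0 \<le> (\<integral>t. f t \<partial>\<mu>)"
    using nonneg by (rule integral_nonneg_AE)
  ultimately show ?thesis by simp
qed

lemma cauchy_kernel_transform_delta_0 [simp]: "cauchy_kernel_transform (delta 0) z = 1"
  unfolding cauchy_kernel_transform_def by (subst integral_return) auto

lemma Im_cauchy_kernel:
  "Im (1 / (1 - z * complex_of_real t)) = Im z * (t / (cmod (1 - z * complex_of_real t))\<^sup>2)"
  by (simp add: Im_divide cmod_power2)

text \<open>G keeps the upper and the lower half plane apart. This excludes zeros of G off the real
  line and keeps \<eta> off it.\<close>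

lemma Im_cauchy_kernel_transform:
  assumes mu: "prob_real \<mu>" "nonneg_support \<mu>" "\<mu> \<noteq> delta 0" and z: "Im z \<noteq> 0"
  shows "\<exists>p>0. Im (cauchy_kernel_transform \<mu> z) = Im z * p"
proof -
  have z': "z \<notin> \<real>\<^sub>\<ge>\<^sub>0"
    using z by (auto simp: complex_nonneg_Reals_iff)
  note int = integrable_cauchy_kernel [OF mu(1,2) z']
  define f where "f t = t / (cmod (1 - z * complex_of_real t))\<^sup>2" for t
  have "integrable \<mu> (\<lambda>t. Im (1 / (1 - z * complex_of_real t)))"
    using int by (rule integrable_Im)
  then have "integrable \<mu> (\<lambda>t. Im z * f t)"
    by (simp add: Im_cauchy_kernel f_def)
  then have int_f: "integrable \<mu> f"
    using z by simp
  have "0 < (\<integral>t. f t \<partial>\<mu>)"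
  proof (rule not_delta_0_integral_pos [OF mu int_f])
    show "0 < f t" if "0 < t" for t
      using one_minus_mult_nonzero [OF z', of t] that by (simp add: f_def)
  qed (simp add: f_def)
  moreover have "Im (cauchy_kernel_transform \<mu> z) = Im z * (\<integral>t. f t \<partial>\<mu>)"
    unfolding cauchy_kernel_transform_def integral_Im [OF int, symmetric] Im_cauchy_kernel f_def
    by (rule integral_mult_right_zero)
  ultimately show ?thesis by blast
qed

lemma cauchy_kernel_transform_neg:
  assumes "x < 0"
  shows "cauchy_kernel_transform \<mu> (complex_of_real x) = complex_of_real (\<integral>t. 1 / (1 - x * t) \<partial>\<mu>)"
  unfolding cauchy_kernel_transform_def by (simp flip: integral_complex_of_real)

lemma integrable_real_kernel:
  assumes "prob_real \<mu>" "nonneg_support \<mu>" "x < 0"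
  shows "integrable \<mu> (\<lambda>t. 1 / (1 - x * t))"
proof (rule real_distribution_integrable_bounded [OF assms(1)])
  show "AE t in \<mu>. norm (1 / (1 - x * t)) \<le> 1"
    using assms(2) unfolding nonneg_support_def
  proof eventually_elim
    case (elim t)
    then have "x * t \<le> 0"
      using assms(3) by (simp add: mult_nonpos_nonneg)
    then show ?case by simp
  qed
qed measurable

lemma real_kernel_transform_bounds:
  assumes mu: "prob_real \<mu>" "nonneg_support \<mu>" "\<mu> \<noteq> delta 0" and x: "x < 0"
  shows "0 < (\<integral>t. 1 / (1 - x * t) \<partial>\<mu>)" "(\<integral>t. 1 / (1 - x * t) \<partial>\<mu>) < 1"
proof -
  interpret real_distribution \<mu>
    using mu(1) by (simp add: prob_real_iff_real_distribution)
  note int = integrable_real_kernel [OF mu(1,2) x]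
  have den: "1 - x * t > 0" if "0 \<le> t" for t
    using x that mult_nonpos_nonneg [of x t] by linarith
  show "0 < (\<integral>t. 1 / (1 - x * t) \<partial>\<mu>)"
    by (rule not_delta_0_integral_pos [OF mu int])
      (use den in \<open>auto simp: less_imp_le\<close>)
  have "0 < (\<integral>t. 1 - 1 / (1 - x * t) \<partial>\<mu>)"
  proof (rule not_delta_0_integral_pos [OF mu])
    show "integrable \<mu> (\<lambda>t. 1 - 1 / (1 - x * t))"
      using int by simp
    show "0 < 1 - 1 / (1 - x * t)" if "0 < t" for t
    proof -
      have "x * t < 0"
        using x that by (rule mult_neg_pos)
      then show ?thesis by simp
    qed
    show "0 \<le> 1 - 1 / (1 - x * t)" if "0 \<le> t" for t
    proof -
      have "x * t \<le> 0"
        using x that by (simp add: mult_nonpos_nonneg)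
      then show ?thesis by simp
    qed
  qed
  also have "(\<integral>t. 1 - 1 / (1 - x * t) \<partial>\<mu>) = 1 - (\<integral>t. 1 / (1 - x * t) \<partial>\<mu>)"
    using int by (subst Bochner_Integration.integral_diff) (simp_all add: prob_space del: space_eq_univ)
  finally show "(\<integral>t. 1 / (1 - x * t) \<partial>\<mu>) < 1"
    by simp
qed

lemma nonneg_Reals_compl_cases:
  assumes "z \<notin> \<real>\<^sub>\<ge>\<^sub>0"
  obtains "Im z \<noteq> 0" | x where "z = complex_of_real x" "x < 0"
  using assms by (metis complex_eq_iff complex_nonneg_Reals_iff complex_of_real_def
      complex.sel linorder_not_less Im_complex_of_real Re_complex_of_real)

lemma cauchy_kernel_transform_nonzero:
  assumes mu: "prob_real \<mu>" "nonneg_support \<mu>" and z: "z \<notin> \<real>\<^sub>\<ge>\<^sub>0"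
  shows "cauchy_kernel_transform \<mu> z \<noteq> 0"
proof (cases "\<mu> = delta 0")
  case False
  show ?thesis
    using z
  proof (cases rule: nonneg_Reals_compl_cases)
    case 1
    then show ?thesis
      using Im_cauchy_kernel_transform [OF mu False 1] by auto
  next
    case (2 x)
    then show ?thesis
      using real_kernel_transform_bounds [OF mu False 2(2)] by (simp add: cauchy_kernel_transform_neg)
  qed
qed simp

lemma eta_transform_eq:
  assumes "prob_real \<mu>" "nonneg_support \<mu>" "z \<notin> \<real>\<^sub>\<ge>\<^sub>0"
  shows "eta_transform \<mu> z = 1 - 1 / cauchy_kernel_transform \<mu> z"
  using cauchy_kernel_transform_nonzero [OF assms] psi_transform_cauchy_kernel [OF assms]
  by (simp add: eta_transform_def field_simps)

lemma eta_transform_holomorphic: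
  assumes "prob_real \<mu>" "nonneg_support \<mu>"
  shows "eta_transform \<mu> holomorphic_on (- \<real>\<^sub>\<ge>\<^sub>0)"
proof (rule holomorphic_transform)
  show "(\<lambda>z. 1 - 1 / cauchy_kernel_transform \<mu> z) holomorphic_on (- \<real>\<^sub>\<ge>\<^sub>0)"
    using cauchy_kernel_transform_nonzero [OF assms]
    by (intro holomorphic_intros cauchy_kernel_transform_holomorphic assms) auto
qed (simp add: eta_transform_eq [OF assms])

lemma eta_transform_neg:
  assumes mu: "prob_real \<mu>" "nonneg_support \<mu>" "\<mu> \<noteq> delta 0" and x: "x < 0"
  shows "\<exists>e<0. eta_transform \<mu> (complex_of_real x) = complex_of_real e"
proof (intro exI conjI)
  have "complex_of_real x \<notin> \<real>\<^sub>\<ge>\<^sub>0"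
    using x by (simp add: complex_nonneg_Reals_iff)
  then show "eta_transform \<mu> (complex_of_real x) = complex_of_real (1 - 1 / (\<integral>t. 1 / (1 - x * t) \<partial>\<mu>))"
    using mu x by (simp add: eta_transform_eq cauchy_kernel_transform_neg)
  show "1 - 1 / (\<integral>t. 1 / (1 - x * t) \<partial>\<mu>) < 0"
    using real_kernel_transform_bounds [OF mu x] by simp
qed

text \<open>This is what makes a composition of two transforms \<eta> defined and holomorphic on the
  slit plane.\<close>

lemma eta_transform_notin_nonneg_Reals:
  assumes mu: "prob_real \<mu>" "nonneg_support \<mu>" "\<mu> \<noteq> delta 0" and z: "z \<notin> \<real>\<^sub>\<ge>\<^sub>0"
  shows "eta_transform \<mu> z \<notin> \<real>\<^sub>\<ge>\<^sub>0"
  using z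
proof (cases rule: nonneg_Reals_compl_cases)
  case 1
  have "Im (cauchy_kernel_transform \<mu> z) \<noteq> 0"
    using Im_cauchy_kernel_transform [OF mu 1] 1 by auto
  moreover from this have "cauchy_kernel_transform \<mu> z \<noteq> 0"
    by auto
  ultimately have "Im (eta_transform \<mu> z) \<noteq> 0"
    by (simp add: eta_transform_eq [OF mu(1,2) z] Im_divide complex_eq_iff)
  then show ?thesis
    by (auto simp: complex_nonneg_Reals_iff)
next
  case (2 x)
  then show ?thesis
    using eta_transform_neg [OF mu 2(2)] by (auto simp: complex_nonneg_Reals_iff)
qed

text \<open>For t > 0 the kernel 1/(1 - x t) is strictly increasing in x < 0; integration keeps this
  strict since the measure is not concentrated at 0.\<close>

lemma eta_transform_inj_neg:
  assumes mu: "prob_real \<mu>" "nonneg_support \<mu>" "\<mu> \<noteq> delta 0" and "a < 0" "b < 0"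
    and eq: "eta_transform \<mu> (complex_of_real a) = eta_transform \<mu> (complex_of_real b)"
  shows "a = b"
proof -
  have less: "(\<integral>t. 1 / (1 - a * t) \<partial>\<mu>) < (\<integral>t. 1 / (1 - b * t) \<partial>\<mu>)" if "a < b" "b < 0" for a b
  proof -
    have "a < 0"
      using that by simp
    note int = integrable_real_kernel [OF mu(1,2) \<open>a < 0\<close>] integrable_real_kernel [OF mu(1,2) \<open>b < 0\<close>]
    have den: "1 - x * t > 0" if "0 \<le> t" "x < 0" for t x :: real
      using that mult_nonpos_nonneg [of x t] by linarith
    have "0 < (\<integral>t. 1 / (1 - b * t) - 1 / (1 - a * t) \<partial>\<mu>)"
    proof (rule not_delta_0_integral_pos [OF mu])
      show "integrable \<mu> (\<lambda>t. 1 / (1 - b * t) - 1 / (1 - a * t))"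
        using int by simp
      show "0 < 1 / (1 - b * t) - 1 / (1 - a * t)" if "0 < t" for t
        using den [of t a] den [of t b] that \<open>a < b\<close> \<open>a < 0\<close> \<open>b < 0\<close>
        by (simp add: divide_strict_left_mono)
      show "0 \<le> 1 / (1 - b * t) - 1 / (1 - a * t)" if "0 \<le> t" for t
        using den [of t a] den [of t b] that \<open>a < b\<close> \<open>a < 0\<close> \<open>b < 0\<close>
        by (simp add: frac_le mult_right_mono)
    qed
    then show ?thesis
      using int by simp
  qed
  have nn: "complex_of_real a \<notin> \<real>\<^sub>\<ge>\<^sub>0" "complex_of_real b \<notin> \<real>\<^sub>\<ge>\<^sub>0"
    using assms by (simp_all add: complex_nonneg_Reals_iff)
  have "(\<integral>t. 1 / (1 - a * t) \<partial>\<mu>) = (\<integral>t. 1 / (1 - b * t) \<partial>\<mu>)"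
    using eq unfolding eta_transform_eq [OF mu(1,2) nn(1)] eta_transform_eq [OF mu(1,2) nn(2)]
      cauchy_kernel_transform_neg [OF \<open>a < 0\<close>] cauchy_kernel_transform_neg [OF \<open>b < 0\<close>]
    by simp
  then show ?thesis
    using less [of a b] less [of b a] assms(4,5) by linarith
qed

section \<open>Uniqueness of measures from their transforms, and of the s-free pair\<close>

text \<open>With \<open>u = 1 / (1 + t)\<close> the Taylor coefficients at \<open>z = -1\<close> are the integrals of
  \<open>u (1 - u)\<^sup>k\<close>, which determine the moments of \<open>u\<close>.\<close>

lemma cauchy_kernel_transform_neg_unique:
  assumes mu: "prob_real \<mu>" "nonneg_support \<mu>" and nu: "prob_real \<nu>" "nonneg_support \<nu>"
    and eq: "\<And>x. x < 0 \<Longrightarrow>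
      cauchy_kernel_transform \<mu> (complex_of_real x) = cauchy_kernel_transform \<nu> (complex_of_real x)"
  shows "\<mu> = \<nu>"
proof -
  define U where "U t = 1 / (1 + t)" for t :: real
  have U [measurable]: "U \<in> borel_measurable borel"
    unfolding U_def by measurable
  have U01: "0 < U t \<and> U t \<le> 1" if "0 \<le> t" for t
    using that by (simp add: U_def)
  define a where "a \<mu> k = (\<integral>t. U t * (1 - U t) ^ k \<partial>\<mu>)" for \<mu> k
  have AE_U: "AE t in \<mu>. norm (U t * g (1 - U t)) \<le> B"
    if "nonneg_support \<mu>" "\<And>v. 0 \<le> v \<Longrightarrow> v \<le> 1 \<Longrightarrow> \<bar>g v\<bar> \<le> B"
    for \<mu> and g :: "real \<Rightarrow> real" and B
    using that(1) unfolding nonneg_support_def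
  proof eventually_elim
    case (elim t)
    have "\<bar>U t\<bar> * \<bar>g (1 - U t)\<bar> \<le> 1 * B"
      using U01 [OF elim] that(2) [of "1 - U t"] by (intro mult_mono) auto
    then show ?case by (simp add: abs_mult)
  qed
  have int_a: "integrable \<mu> (\<lambda>t. U t * (1 - U t) ^ k)" if "prob_real \<mu>" "nonneg_support \<mu>" for \<mu> k
    by (rule real_distribution_integrable_bounded [OF that(1)], measurable)
      (rule AE_U [OF that(2), where g = "\<lambda>v. v ^ k" and B = 1], simp add: power_le_one power_abs)
  have series: "\<exists>r>0. \<forall>x. \<bar>x - (-1)\<bar> < r \<longrightarrow>
      (\<lambda>k. a \<mu> k * (x - (-1)) ^ k) sums Re (cauchy_kernel_transform \<mu> (complex_of_real x))"
    if m: "prob_real \<mu>" "nonneg_support \<mu>" for \<mu>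
  proof -
    have neg: "(-1 :: complex) \<notin> \<real>\<^sub>\<ge>\<^sub>0"
      by (simp add: complex_nonneg_Reals_iff)
    obtain r where r: "r > 0" "\<And>z. z \<in> ball (-1) r \<Longrightarrow>
        (\<lambda>k. (\<integral>t. complex_of_real t ^ k / (1 - (-1) * complex_of_real t) ^ Suc k \<partial>\<mu>) * (z - (-1)) ^ k)
          sums cauchy_kernel_transform \<mu> z"
      by (rule cauchy_kernel_transform_local_series [OF m neg]) blast
    have coeff: "(\<integral>t. complex_of_real t ^ k / (1 - (-1) * complex_of_real t) ^ Suc k \<partial>\<mu>) = complex_of_real (a \<mu> k)" for k
    proof -
      interpret real_distribution \<mu>
        using m(1) by (simp add: prob_real_iff_real_distribution)
      have "(\<integral>t. complex_of_real t ^ k / (1 - (-1) * complex_of_real t) ^ Suc k \<partial>\<mu>) =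
          (\<integral>t. complex_of_real (U t * (1 - U t) ^ k) \<partial>\<mu>)"
      proof (rule integral_cong_AE)
        show "AE t in \<mu>. complex_of_real t ^ k / (1 - (-1) * complex_of_real t) ^ Suc k =
            complex_of_real (U t * (1 - U t) ^ k)"
          using m(2) unfolding nonneg_support_def
        proof eventually_elim
          case (elim t)
          then have "1 - U t = t / (1 + t)"
            by (simp add: U_def field_simps)
          then have "U t * (1 - U t) ^ k = t ^ k / (1 + t) ^ Suc k"
            by (simp add: U_def power_divide)
          then show ?case by simp
        qed
      qed measurable
      then show ?thesis
        unfolding a_def integral_complex_of_real .
    qed
    show ?thesis
    proof (intro exI conjI allI impI)
      fix x :: real assume x: "\<bar>x - (-1)\<bar> < r"
      have "cmod (complex_of_real (x - (-1))) < r"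
        unfolding norm_of_real using x by simp
      then have "complex_of_real x \<in> ball (-1) r"
        unfolding mem_ball dist_commute [of "-1"] by (simp add: dist_norm)
      from sums_Re [OF r(2) [OF this, unfolded coeff]]
      have "(\<lambda>k. Re (complex_of_real (a \<mu> k) * (complex_of_real x - (-1)) ^ k))
          sums Re (cauchy_kernel_transform \<mu> (complex_of_real x))" .
      moreover have "Re (complex_of_real (a \<mu> k) * (complex_of_real x - (-1)) ^ k) = a \<mu> k * (x - (-1)) ^ k" for k
      proof -
        have "complex_of_real (a \<mu> k) * (complex_of_real x - (-1)) ^ k =
            complex_of_real (a \<mu> k * (x - (-1)) ^ k)"
          by simp
        then show ?thesis
          by (simp only: Re_complex_of_real)
      qed
      ultimately show "(\<lambda>k. a \<mu> k * (x - (-1)) ^ k) sums Re (cauchy_kernel_transform \<mu> (complex_of_real x))"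
        by (simp only:)
    qed (rule r(1))
  qed
  have a_eq: "a \<mu> k = a \<nu> k" for k
  proof -
    obtain r where r: "r > 0" "\<And>x. \<bar>x - (-1)\<bar> < r \<Longrightarrow>
        (\<lambda>k. a \<mu> k * (x - (-1)) ^ k) sums Re (cauchy_kernel_transform \<mu> (complex_of_real x))"
      using series [OF mu] by blast
    obtain s where s: "s > 0" "\<And>x. \<bar>x - (-1)\<bar> < s \<Longrightarrow>
        (\<lambda>k. a \<nu> k * (x - (-1)) ^ k) sums Re (cauchy_kernel_transform \<nu> (complex_of_real x))"
      using series [OF nu] by blast
    \<comment> \<open>The bound 1 keeps every x with |x + 1| < m negative, where the two transforms
      are known to agree.\<close>
    define m where "m = min 1 (min r s)"
    have "m > 0"
      using r(1) s(1) by (simp add: m_def)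
    have diff: "(\<lambda>k. (a \<mu> k - a \<nu> k) * (x - (-1)) ^ k) sums 0" if "norm (x - (-1)) < m" for x
    proof -
      have "x < 0" "\<bar>x - (-1)\<bar> < r" "\<bar>x - (-1)\<bar> < s"
        using that by (auto simp: m_def)
      then show ?thesis
        using sums_diff [OF r(2) s(2), of x x] eq [of x] by (simp add: left_diff_distrib)
    qed
    \<comment> \<open>The isolation of zeros in \<open>powser_0_nonzero\<close> asks for a nonzero
      coefficient of positive index; the constant coefficient is read off at the centre -1.\<close>
    show ?thesis
    proof (cases "k = 0")
      case True
      have "(\<lambda>k. (a \<mu> k - a \<nu> k) * 0 ^ k) sums (a \<mu> 0 - a \<nu> 0)"
        by (rule powser_sums_zero)
      then show ?thesis
        using diff [of "-1"] \<open>m > 0\<close> True by (simp add: sums_unique2)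
    next
      case False
      show ?thesis
      proof (rule ccontr)
        assume "a \<mu> k \<noteq> a \<nu> k"
        then have nz: "a \<mu> k - a \<nu> k \<noteq> 0" by simp
        have "k > 0" using False by simp
        show False
        proof (rule powser_0_nonzero [of m "-1" "\<lambda>k. a \<mu> k - a \<nu> k" "\<lambda>_. 0",
              OF \<open>m > 0\<close> diff refl nz \<open>k > 0\<close>])
          fix e :: real
          assume "0 < e" "\<And>x :: real. x \<in> cball (-1) e - {-1} \<Longrightarrow> (0::real) \<noteq> 0"
          from this(1) this(2) [of "-1 + e"] show False
            by (simp add: dist_norm)
        qed
      qed
    qed
  qed
  have moment: "(\<integral>t. U t ^ Suc n \<partial>\<mu>) = (\<Sum>k\<le>n. real (n choose k) * (- 1) ^ k * a \<mu> k)"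
    if m: "prob_real \<mu>" "nonneg_support \<mu>" for \<mu> n
  proof -
    \<comment> \<open>Binomial expansion of U (1 - (1 - U))^n.\<close>
    have "U t ^ Suc n = (\<Sum>k\<le>n. real (n choose k) * (- 1) ^ k * (U t * (1 - U t) ^ k))" for t
    proof -
      have "U t ^ n = (\<Sum>k\<le>n. real (n choose k) * (- (1 - U t)) ^ k)"
        using binomial_ring [of "U t - 1" 1 n] by simp
      then show ?thesis
        using power_minus [of "1 - U t"]
        by (simp only: power_Suc sum_distrib_left) (simp add: mult_ac)
    qed
    then have "(\<integral>t. U t ^ Suc n \<partial>\<mu>) =
        (\<integral>t. (\<Sum>k\<le>n. real (n choose k) * (- 1) ^ k * (U t * (1 - U t) ^ k)) \<partial>\<mu>)"
      by simp
    also have "\<dots> = (\<Sum>k\<le>n. real (n choose k) * (- 1) ^ k * a \<mu> k)"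
      unfolding a_def using int_a [OF m] by (subst Bochner_Integration.integral_sum) auto
    finally show ?thesis .
  qed
  have distr: "prob_real (distr \<mu> borel U)" "compact_support (distr \<mu> borel U)"
    "(\<integral>u. u ^ n \<partial>distr \<mu> borel U) = (\<integral>t. U t ^ n \<partial>\<mu>)" "distr (distr \<mu> borel U) borel (\<lambda>u. 1 / u - 1) = \<mu>"
    if m: "prob_real \<mu>" "nonneg_support \<mu>" for \<mu> n
  proof -
    interpret real_distribution \<mu>
      using m(1) by (simp add: prob_real_iff_real_distribution)
    show "prob_real (distr \<mu> borel U)"
      unfolding prob_real_def by (auto intro!: prob_space_distr)
    show "compact_support (distr \<mu> borel U)"
      unfolding compact_support_def using m(2) U01 unfolding nonneg_support_def
      by (intro exI [of _ 1]) (subst AE_distr_iff, auto elim!: eventually_mono simp: abs_le_iff less_imp_le, smt (verit) U01)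
    show "(\<integral>u. u ^ n \<partial>distr \<mu> borel U) = (\<integral>t. U t ^ n \<partial>\<mu>)"
      by (rule integral_distr) simp_all
    \<comment> \<open>The map u to 1/u - 1 inverts U on the half-line, so the law of U determines
      the measure.\<close>
    have "distr (distr \<mu> borel U) borel (\<lambda>u. 1 / u - 1) = distr \<mu> borel ((\<lambda>u. 1 / u - 1) \<circ> U)"
      by (rule distr_distr) simp_all
    also have "\<dots> = distr \<mu> borel (\<lambda>t. t)"
    proof (rule distr_cong_AE)
      show "AE t in \<mu>. ((\<lambda>u. 1 / u - 1) \<circ> U) t = t"
        using m(2) unfolding nonneg_support_def by eventually_elim (simp add: U_def)
    qed simp_all
    also have "\<dots> = \<mu>"
      by (rule distr_id2) simp
    finally show "distr (distr \<mu> borel U) borel (\<lambda>u. 1 / u - 1) = \<mu>" .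
  qed
  have "(\<integral>u. u ^ n \<partial>distr \<mu> borel U) = (\<integral>u. u ^ n \<partial>distr \<nu> borel U)" for n
  proof (cases n)
    case 0
    interpret mu: real_distribution \<mu>
      using mu(1) by (simp add: prob_real_iff_real_distribution)
    interpret nu: real_distribution \<nu>
      using nu(1) by (simp add: prob_real_iff_real_distribution)
    show ?thesis
      unfolding distr(3) [OF mu] distr(3) [OF nu]
      using 0 mu.prob_space nu.prob_space by simp
  next
    case (Suc k)
    then show ?thesis
      unfolding distr(3) [OF mu] distr(3) [OF nu] using moment [OF mu, of k] moment [OF nu, of k]
      by (simp add: a_eq del: power_Suc)
  qed
  then have eq: "distr \<mu> borel U = distr \<nu> borel U"
    by (rule compact_support_moments_unique
        [OF distr(1) [OF mu] distr(2) [OF mu] distr(1) [OF nu] distr(2) [OF nu]])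
  show ?thesis
    by (rule trans [OF distr(4) [OF mu, symmetric] trans [OF _ distr(4) [OF nu]]]) (simp only: eq)
qed

lemma eta_transform_neg_unique:
  assumes mu: "prob_real \<mu>" "nonneg_support \<mu>" and nu: "prob_real \<nu>" "nonneg_support \<nu>"
    and eq: "\<And>x. x < 0 \<Longrightarrow> eta_transform \<mu> (complex_of_real x) = eta_transform \<nu> (complex_of_real x)"
  shows "\<mu> = \<nu>"
proof (rule cauchy_kernel_transform_neg_unique [OF mu nu])
  fix x :: real assume x: "x < 0"
  then have z: "complex_of_real x \<notin> \<real>\<^sub>\<ge>\<^sub>0"
    by (simp add: complex_nonneg_Reals_iff)
  show "cauchy_kernel_transform \<mu> (complex_of_real x) = cauchy_kernel_transform \<nu> (complex_of_real x)"
    using eq [OF x] unfolding eta_transform_eq [OF mu z] eta_transform_eq [OF nu z] by simp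
qed

text \<open>On the negative axis the inner transforms take negative values, where the outer \<eta>
  is injective and can be cancelled; the values of \<eta> there determine the measure.\<close>

lemma s_free_mult_conv_pair_unique:
  assumes mu: "prob_real \<mu>" "nonneg_support \<mu>" "\<mu> \<noteq> delta 0"
    and nu: "prob_real \<nu>" "nonneg_support \<nu>" "\<nu> \<noteq> delta 0"
    and 1: "s_free_mult_conv_pair \<mu> \<nu> \<sigma> \<tau>" and 2: "s_free_mult_conv_pair \<mu> \<nu> \<sigma>' \<tau>'"
  shows "\<sigma> = \<sigma>' \<and> \<tau> = \<tau>'"
proof -
  have unique: "\<sigma> = \<sigma>'"
    if mu: "prob_real \<mu>" "nonneg_support \<mu>" "\<mu> \<noteq> delta 0"
      and s: "prob_real \<sigma>" "nonneg_support \<sigma>" "\<sigma> \<noteq> delta 0"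
      and s': "prob_real \<sigma>'" "nonneg_support \<sigma>'" "\<sigma>' \<noteq> delta 0"
      and eq: "\<And>z. z \<notin> \<real>\<^sub>\<ge>\<^sub>0 \<Longrightarrow> eta_transform \<mu> (eta_transform \<sigma> z) = eta_transform \<mu> (eta_transform \<sigma>' z)"
    for \<mu> \<sigma> \<sigma>'
  proof (rule eta_transform_neg_unique [OF s(1,2) s'(1,2)])
    fix x :: real assume x: "x < 0"
    obtain e e' where e: "e < 0" "eta_transform \<sigma> (complex_of_real x) = complex_of_real e"
      "e' < 0" "eta_transform \<sigma>' (complex_of_real x) = complex_of_real e'"
      using eta_transform_neg [OF s x] eta_transform_neg [OF s' x] by blast
    then have "eta_transform \<mu> (complex_of_real e) = eta_transform \<mu> (complex_of_real e')"
      using eq [of "complex_of_real x"] x by (simp add: complex_nonneg_Reals_iff)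
    then show "eta_transform \<sigma> (complex_of_real x) = eta_transform \<sigma>' (complex_of_real x)"
      using eta_transform_inj_neg [OF mu] e by auto
  qed
  show ?thesis
  proof
    note defs = 1 [unfolded s_free_mult_conv_pair_def] 2 [unfolded s_free_mult_conv_pair_def]
    show "\<sigma> = \<sigma>'"
    proof (rule unique [OF nu])
      show "eta_transform \<nu> (eta_transform \<sigma> z) = eta_transform \<nu> (eta_transform \<sigma>' z)"
        if "z \<notin> \<real>\<^sub>\<ge>\<^sub>0" for z
        using defs that by metis
    qed (use defs in blast)+
    show "\<tau> = \<tau>'"
    proof (rule unique [OF mu])
      show "eta_transform \<mu> (eta_transform \<tau> z) = eta_transform \<mu> (eta_transform \<tau>' z)"
        if "z \<notin> \<real>\<^sub>\<ge>\<^sub>0" for z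
        using defs that by metis
    qed (use defs in blast)+
  qed
qed

lemma s_free_mult_conv_eqI:
  assumes mu: "prob_real \<mu>" "nonneg_support \<mu>" "\<mu> \<noteq> delta 0"
    and nu: "prob_real \<nu>" "nonneg_support \<nu>" "\<nu> \<noteq> delta 0"
    and pair: "s_free_mult_conv_pair \<mu> \<nu> \<sigma> \<tau>"
  shows "s_free_mult_conv \<mu> \<nu> = \<sigma>"
proof -
  have "(THE (\<sigma>, \<tau>). s_free_mult_conv_pair \<mu> \<nu> \<sigma> \<tau>) = (\<sigma>, \<tau>)"
  proof (rule the_equality)
    show "\<And>p. (case p of (\<sigma>', \<tau>') \<Rightarrow> s_free_mult_conv_pair \<mu> \<nu> \<sigma>' \<tau>') \<Longrightarrow> p = (\<sigma>, \<tau>)"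
      using s_free_mult_conv_pair_unique [OF mu nu pair] by (clarsimp split: prod.splits)
  qed (simp add: pair)
  then show ?thesis
    using mu(3) nu(3) by (simp add: s_free_mult_conv_def)
qed

lemma eta_transform_subordination_extend:
  assumes rho: "prob_real \<rho>" "nonneg_support \<rho>" and mu: "prob_real \<mu>" "nonneg_support \<mu>"
    and sigma: "prob_real \<sigma>" "nonneg_support \<sigma>" "\<sigma> \<noteq> delta 0"
    and small: "\<epsilon> > 0" "\<And>z. z \<notin> \<real>\<^sub>\<ge>\<^sub>0 \<Longrightarrow> cmod z < \<epsilon> \<Longrightarrow> eta_transform \<rho> z = eta_transform \<mu> (eta_transform \<sigma> z)"
    and z: "z \<notin> \<real>\<^sub>\<ge>\<^sub>0"
  shows "eta_transform \<rho> z = eta_transform \<mu> (eta_transform \<sigma> z)"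
proof -
  let ?S = "- \<real>\<^sub>\<ge>\<^sub>0 :: complex set"
  show ?thesis
  proof (rule analytic_continuation_open [where s = "ball 0 \<epsilon> \<inter> ?S" and s' = ?S
        and f = "eta_transform \<rho>" and g = "\<lambda>z. eta_transform \<mu> (eta_transform \<sigma> z)"])
    show "open (ball 0 \<epsilon> \<inter> ?S)" "open ?S" "connected ?S" "ball 0 \<epsilon> \<inter> ?S \<subseteq> ?S" "z \<in> ?S"
      using open_Compl_nonneg_Reals connected_Compl_nonneg_Reals z by auto
    show "ball 0 \<epsilon> \<inter> ?S \<noteq> {}"
    proof -
      have "complex_of_real (- (\<epsilon> / 2)) \<in> ball 0 \<epsilon> \<inter> ?S"
        using small(1) by (simp add: complex_nonneg_Reals_iff)
      then show ?thesis by blast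
    qed
    show "eta_transform \<rho> holomorphic_on ?S"
      using rho by (rule eta_transform_holomorphic)
    have "eta_transform \<mu> \<circ> eta_transform \<sigma> holomorphic_on ?S"
      using sigma mu eta_transform_notin_nonneg_Reals [OF sigma]
      by (intro holomorphic_on_compose_gen [where t = ?S] eta_transform_holomorphic) auto
    then show "(\<lambda>z. eta_transform \<mu> (eta_transform \<sigma> z)) holomorphic_on ?S"
      by (simp add: comp_def)
  qed (use small in auto)
qed

section \<open>Operators on the free product space\<close>

fun swap_letter :: "'a + 'b \<Rightarrow> 'b + 'a"
  where "swap_letter (Inl h) = Inr h" | "swap_letter (Inr h) = Inl h"

text \<open>The same space with the two factors renamed: facts about \<open>lambda2\<close> become
  facts about \<open>lambda1\<close>, and the whole construction can be instantiated a second time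
  with \<open>X1\<close> and \<open>X2\<close> exchanged.\<close>

definition swap_product :: "('a, 'b, 'h) free_product \<Rightarrow> ('b, 'a, 'h) free_product"
  where "swap_product F = \<lparr>vec1 = vec2 F, vec2 = vec1 F, tensor = (\<lambda>w. tensor F (map swap_letter w))\<rparr>"

text \<open>Reversing the words turns the left actions into right actions.\<close>

definition rev_product :: "('a, 'b, 'h) free_product \<Rightarrow> ('a, 'b, 'h) free_product"
  where "rev_product F = \<lparr>vec1 = vec1 F, vec2 = vec2 F, tensor = (\<lambda>w. tensor F (rev w))\<rparr>"

lemma swap_product_sel [simp]:
  "vec1 (swap_product F) = vec2 F" "vec2 (swap_product F) = vec1 F"
  "tensor (swap_product F) w = tensor F (map swap_letter w)"
  by (simp_all add: swap_product_def)

lemma rev_product_sel [simp]: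
  "vec1 (rev_product F) = vec1 F" "vec2 (rev_product F) = vec2 F"
  "tensor (rev_product F) w = tensor F (rev w)"
  by (simp_all add: rev_product_def)

lemma swap_letter_swap [simp]: "swap_letter (swap_letter l) = l"
  by (cases l) simp_all

lemma swap_letter_comp_id [simp]: "swap_letter \<circ> swap_letter = id"
  by (simp add: fun_eq_iff)

lemma other_other [simp]: "other (other i) = i"
  by (cases i) simp_all

lemma other_neq [simp]: "other i \<noteq> i" "i \<noteq> other i"
  by (cases i; simp)+

lemma neq_iff_eq_other: "i \<noteq> j \<longleftrightarrow> i = other j"
  by (cases i; cases j) simp_all

lemma inj_other: "inj_on other A"
  by (rule inj_onI) (metis other_other)

lemma index_of_swap [simp]: "index_of (swap_letter l) = other (index_of l)"
  by (cases l) simp_all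

lemma map_index_of_swap [simp]:
  "map (index_of \<circ> swap_letter) w = map other (map index_of w)"
  "map index_of (map swap_letter w) = map other (map index_of w)"
  by simp_all

lemma in_H0_swap [simp]: "in_H0 (swap_product F) l \<longleftrightarrow> in_H0 F (swap_letter l)"
  by (cases l) simp_all

lemma in_H0_rev [simp]: "in_H0 (rev_product F) l \<longleftrightarrow> in_H0 F l"
  by (cases l) simp_all

lemma reduced_words_swap [simp]:
  "w \<in> reduced_words (swap_product F) \<longleftrightarrow> map swap_letter w \<in> reduced_words F"
  unfolding reduced_words_def mem_Collect_eq
  using distinct_adj_map_iff [OF inj_other, of "map index_of w"] by simp

lemma reduced_words_rev [simp]:
  "w \<in> reduced_words (rev_product F) \<longleftrightarrow> rev w \<in> reduced_words F"
  unfolding reduced_words_def mem_Collect_eq by (simp add: rev_map [symmetric])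

lemma letter_inner_swap [simp]: "letter_inner (swap_letter k) (swap_letter l) = letter_inner k l"
  by (cases k; cases l) simp_all

lemma map2_letter_inner_swap:
  "map2 letter_inner (map swap_letter v) (map swap_letter w) = map2 letter_inner v w"
  by (induction v w rule: list_induct2') simp_all

lemma map_swap_letter_involution: "map swap_letter (map swap_letter w) = w"
  by simp

lemma is_free_product_swap:
  assumes F: "is_free_product F"
  shows "is_free_product (swap_product F)"
  unfolding is_free_product_def
proof (intro conjI ballI)
  show "norm (vec1 (swap_product F)) = 1" "norm (vec2 (swap_product F)) = 1"
    using F by (simp_all add: is_free_product_def)
next
  fix v w assume "v \<in> reduced_words (swap_product F)" "w \<in> reduced_words (swap_product F)"
  then show "cinner (tensor (swap_product F) v) (tensor (swap_product F) w) =
      (if length v = length w then prod_list (map2 letter_inner v w) else 0)"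
    using F map2_letter_inner_swap [of v w] by (simp add: is_free_product_def)
next
  have "tensor (swap_product F) ` reduced_words (swap_product F) = tensor F ` reduced_words F"
  proof (intro equalityI subsetI)
    fix t assume "t \<in> tensor F ` reduced_words F"
    then obtain w where "w \<in> reduced_words F" "t = tensor F w" by blast
    then have "map swap_letter w \<in> reduced_words (swap_product F)"
      "t = tensor (swap_product F) (map swap_letter w)"
      by simp_all
    then show "t \<in> tensor (swap_product F) ` reduced_words (swap_product F)" by blast
  qed auto
  then show "closure (cspan (tensor (swap_product F) ` reduced_words (swap_product F))) = UNIV"
    using F by (simp add: is_free_product_def)
qed

lemma is_free_product_rev:
  assumes F: "is_free_product F"
  shows "is_free_product (rev_product F)"
  unfolding is_free_product_def
proof (intro conjI ballI)
  show "norm (vec1 (rev_product F)) = 1" "norm (vec2 (rev_product F)) = 1"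
    using F by (simp_all add: is_free_product_def)
next
  fix v w assume vw: "v \<in> reduced_words (rev_product F)" "w \<in> reduced_words (rev_product F)"
  have "prod_list (map2 letter_inner (rev v) (rev w)) = prod_list (map2 letter_inner v w)"
    if "length v = length w"
  proof -
    have "map2 letter_inner (rev v) (rev w) = rev (map2 letter_inner v w)"
      using that by (simp add: zip_rev rev_map)
    moreover have "prod_list (rev xs) = prod_list xs" for xs :: "complex list"
      by (induction xs) (simp_all add: mult.commute)
    ultimately show ?thesis by simp
  qed
  then show "cinner (tensor (rev_product F) v) (tensor (rev_product F) w) =
      (if length v = length w then prod_list (map2 letter_inner v w) else 0)"
    using F vw by (simp add: is_free_product_def)
next
  have "tensor (rev_product F) ` reduced_words (rev_product F) = tensor F ` reduced_words F"
  proof (intro equalityI subsetI)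
    fix t assume "t \<in> tensor F ` reduced_words F"
    then obtain w where "w \<in> reduced_words F" "t = tensor F w" by blast
    then have "rev w \<in> reduced_words (rev_product F)" "t = tensor (rev_product F) (rev w)"
      by simp_all
    then show "t \<in> tensor (rev_product F) ` reduced_words (rev_product F)" by blast
  qed auto
  then show "closure (cspan (tensor (rev_product F) ` reduced_words (rev_product F))) = UNIV"
    using F by (simp add: is_free_product_def)
qed

section \<open>Elementary tensors and the left actions\<close>

lemma free_product_dense:
  "is_free_product F \<Longrightarrow> closure (cspan (tensor F ` reduced_words F)) = UNIV"
  by (simp add: is_free_product_def)

lemma norm_vec1: "is_free_product F \<Longrightarrow> norm (vec1 F) = 1"
  by (simp add: is_free_product_def)

lemma cinner_vec1_vec1: "is_free_product F \<Longrightarrow> cinner (vec1 F) (vec1 F) = 1"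
  by (simp add: cinner_self norm_vec1)

lemma tensor_inner:
  "is_free_product F \<Longrightarrow> v \<in> reduced_words F \<Longrightarrow> w \<in> reduced_words F \<Longrightarrow>
    cinner (tensor F v) (tensor F w) =
      (if length v = length w then prod_list (map2 letter_inner v w) else 0)"
  by (simp add: is_free_product_def)

lemma tensor_eqI:
  assumes "is_free_product F" "\<And>w. w \<in> reduced_words F \<Longrightarrow> cinner x (tensor F w) = cinner y (tensor F w)"
  shows "x = y"
  by (rule cinner_dense_eqI [OF free_product_dense [OF assms(1)]]) (use assms(2) in auto)

lemma bop_eq_on_tensors:
  assumes "is_free_product F" "\<And>w. w \<in> reduced_words F \<Longrightarrow> bop_apply S (tensor F w) = bop_apply T (tensor F w)"
  shows "S = T"
  by (rule bop_eq_on_dense [OF free_product_dense [OF assms(1)]]) (use assms(2) in auto)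

lemma Nil_reduced [simp]: "[] \<in> reduced_words F"
  by (simp add: reduced_words_def)

lemma norm_vacuum: "is_free_product F \<Longrightarrow> norm (vacuum F) = 1"
  using tensor_inner [of F "[]" "[]"] by (simp add: vacuum_def norm_eq_sqrt_cinner)

lemma reduced_slot_iff:
  "u @ Inl h # v \<in> reduced_words F \<longleftrightarrow>
    u \<in> reduced_words F \<and> v \<in> reduced_words F \<and> cinner h (vec1 F) = 0 \<and>
    (u = [] \<or> index_of (last u) \<noteq> I1) \<and> (v = [] \<or> index_of (hd v) \<noteq> I1)"
  by (auto simp: reduced_words_def distinct_adj_append_iff distinct_adj_Cons last_map hd_map)

text \<open>Multilinearity is not part of \<open>is_free_product\<close>. It follows from the inner
  product formula, which is linear in each slot, tested against the dense span of all reduced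
  words.\<close>

lemma tensor_slot_linear:
  assumes F: "is_free_product F"
    and red: "u @ Inl h # v \<in> reduced_words F" "u @ Inl k # v \<in> reduced_words F"
  shows "tensor F (u @ Inl (c *\<^sub>C h + k) # v) =
    c *\<^sub>C tensor F (u @ Inl h # v) + tensor F (u @ Inl k # v)"
proof (rule tensor_eqI [OF F])
  fix w assume w: "w \<in> reduced_words F"
  have red': "u @ Inl (c *\<^sub>C h + k) # v \<in> reduced_words F"
    using red by (simp add: reduced_slot_iff cinner_simps)
  show "cinner (tensor F (u @ Inl (c *\<^sub>C h + k) # v)) (tensor F w) =
      cinner (c *\<^sub>C tensor F (u @ Inl h # v) + tensor F (u @ Inl k # v)) (tensor F w)"
  proof (cases "length w = Suc (length u + length v)")
    case False
    then show ?thesis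
      using F red red' w by (auto simp: tensor_inner cinner_simps)
  next
    case True
    define u' where "u' = take (length u) w"
    have len: "length u' = length u"
      using True by (simp add: u'_def)
    obtain l v' where "drop (length u) w = l # v'"
      using True by (cases "drop (length u) w") auto
    then have weq: "w = u' @ l # v'"
      unfolding u'_def by (metis append_take_drop_id)
    have *: "cinner (tensor F (u @ Inl g # v)) (tensor F w) =
        prod_list (map2 letter_inner u u') * letter_inner (Inl g) l * prod_list (map2 letter_inner v v')"
      if "u @ Inl g # v \<in> reduced_words F" for g
      using tensor_inner [OF F that w] True len unfolding weq by simp
    have "letter_inner (Inl (c *\<^sub>C h + k) :: 'a + 'b) l = c * letter_inner (Inl h) l + letter_inner (Inl k) l"
      by (cases l) (simp_all add: cinner_simps)
    then show ?thesis
      unfolding cinner_add_left cinner_scaleC_left * [OF red'] * [OF red(1)] * [OF red(2)]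
      by (simp add: algebra_simps)
  qed
qed

lemma tensor_slot_zero:
  assumes F: "is_free_product F" and red: "u @ Inl 0 # v \<in> reduced_words F"
  shows "tensor F (u @ Inl 0 # v) = 0"
  using tensor_slot_linear [OF F red red, of 1] by (simp add: scaleC_one)

lemma words_avoiding_reduced: "w \<in> words_avoiding F i \<Longrightarrow> w \<in> reduced_words F"
  by (simp add: words_avoiding_def)

definition vec1_perp :: "('a::complex_hilbert, 'b, 'h) free_product \<Rightarrow> 'a \<Rightarrow> 'a"
  where "vec1_perp F h = h - cinner h (vec1 F) *\<^sub>C vec1 F"

lemma vec1_perp_inner: "is_free_product F \<Longrightarrow> cinner (vec1_perp F h) (vec1 F) = 0"
  by (simp add: vec1_perp_def cinner_simps cinner_vec1_vec1)

lemma vec1_perp_vec1 [simp]: "is_free_product F \<Longrightarrow> vec1_perp F (vec1 F) = 0"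
  by (simp add: vec1_perp_def cinner_vec1_vec1 scaleC_one)

lemma vec1_perp_linear: "vec1_perp F (c *\<^sub>C h + k) = c *\<^sub>C vec1_perp F h + vec1_perp F k"
  by (simp add: vec1_perp_def cinner_simps scaleC_add_left scaleC_scaleC
      complex_vector.scale_right_diff_distrib)

lemma prepend1_eq:
  "prepend1 F h w = cinner h (vec1 F) *\<^sub>C tensor F w + tensor F (Inl (vec1_perp F h) # w)"
  by (simp add: prepend1_def vec1_perp_def)

lemma Cons_vec1_perp_reduced:
  assumes "is_free_product F" "w \<in> words_avoiding F I1"
  shows "Inl (vec1_perp F h) # w \<in> reduced_words F"
  using reduced_slot_iff [of "[]" "vec1_perp F h" w F] assms
  by (auto simp: words_avoiding_def vec1_perp_inner)

lemma prepend1_linear: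
  assumes F: "is_free_product F" and w: "w \<in> words_avoiding F I1"
  shows "prepend1 F (c *\<^sub>C h + k) w = c *\<^sub>C prepend1 F h w + prepend1 F k w"
  using tensor_slot_linear [OF F, of "[]" "vec1_perp F h" w "vec1_perp F k" c]
    Cons_vec1_perp_reduced [OF F w]
  by (simp add: prepend1_eq vec1_perp_linear cinner_simps scaleC_add_left scaleC_add_right scaleC_scaleC)

lemma prepend1_zero: "is_free_product F \<Longrightarrow> w \<in> words_avoiding F I1 \<Longrightarrow> prepend1 F 0 w = 0"
  using prepend1_linear [of F w 1 0 0] by (simp add: scaleC_one)

lemma prepend1_add: "is_free_product F \<Longrightarrow> w \<in> words_avoiding F I1 \<Longrightarrow>
    prepend1 F (h + k) w = prepend1 F h w + prepend1 F k w"
  using prepend1_linear [of F w 1 h k] by (simp add: scaleC_one)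

lemma prepend1_scaleC: "is_free_product F \<Longrightarrow> w \<in> words_avoiding F I1 \<Longrightarrow>
    prepend1 F (c *\<^sub>C h) w = c *\<^sub>C prepend1 F h w"
  using prepend1_linear [of F w c h 0] by (simp add: prepend1_zero)

lemma prepend1_vec1: "is_free_product F \<Longrightarrow> w \<in> words_avoiding F I1 \<Longrightarrow> prepend1 F (vec1 F) w = tensor F w"
  using tensor_slot_zero [of F "[]" w] Cons_vec1_perp_reduced [of F w "vec1 F"]
  by (simp add: prepend1_eq cinner_vec1_vec1 scaleC_one)

lemma prepend1_perp: "cinner h (vec1 F) = 0 \<Longrightarrow> prepend1 F h w = tensor F (Inl h # w)"
  by (simp add: prepend1_def)

lemma Nil_avoiding [simp]: "[] \<in> words_avoiding F i"
  by (simp add: words_avoiding_def)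

lemma reduced_cases1:
  assumes w: "w \<in> reduced_words F"
  obtains "w \<in> words_avoiding F I1"
  | h v where "w = Inl h # v" "cinner h (vec1 F) = 0" "v \<in> words_avoiding F I1"
proof (cases w)
  case (Cons l v)
  show ?thesis
  proof (cases l)
    case (Inl h)
    then show ?thesis
      using that(2) [of h v] w Cons reduced_slot_iff [of "[]" h v F] by (auto simp: words_avoiding_def)
  next
    case (Inr k)
    then show ?thesis
      using that(1) w Cons by (simp add: words_avoiding_def)
  qed
qed (use that(1) in simp)

text \<open>A word that does not start in the first space has \<open>vec1 F\<close> as an invisible
  first letter.\<close>

lemma tensor_prepend1_cases:
  assumes F: "is_free_product F" and w: "w \<in> reduced_words F"
  obtains h v where "v \<in> words_avoiding F I1" "tensor F w = prepend1 F h v"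
  using w
proof (cases rule: reduced_cases1)
  case 1
  then show ?thesis
    using that [of w "vec1 F"] F by (simp add: prepend1_vec1)
next
  case (2 h v)
  then show ?thesis
    using that [of v h] by (simp add: prepend1_perp)
qed

text \<open>Isometry of the natural map from the tensor product. The mixed terms vanish because one
  of the two words starts in the first space and the other does not.\<close>

lemma prepend1_inner:
  assumes F: "is_free_product F" and v: "v \<in> words_avoiding F I1" and w: "w \<in> words_avoiding F I1"
  shows "cinner (prepend1 F h v) (prepend1 F k w) = cinner h k * cinner (tensor F v) (tensor F w)"
proof -
  note red = words_avoiding_reduced [OF v] words_avoiding_reduced [OF w]
    Cons_vec1_perp_reduced [OF F v, of h] Cons_vec1_perp_reduced [OF F w, of k]
  have no: "cinner (tensor F (Inl g # v')) (tensor F w') = 0"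
    if "Inl g # v' \<in> reduced_words F" "w' \<in> words_avoiding F I1" for g v' w'
  proof (cases w')
    case (Cons l w'')
    then have "index_of l \<noteq> I1"
      using that(2) by (simp add: words_avoiding_def)
    then have "letter_inner (Inl g) l = 0"
      by (cases l) simp_all
    then show ?thesis
      using tensor_inner [OF F that(1) words_avoiding_reduced [OF that(2)]] Cons by simp
  qed (use tensor_inner [OF F that(1) words_avoiding_reduced [OF that(2)]] in simp)
  have no': "cinner (tensor F w') (tensor F (Inl g # v')) = 0"
    if "Inl g # v' \<in> reduced_words F" "w' \<in> words_avoiding F I1" for g v' w'
    using no [OF that] by (metis cinner_commute complex_cnj_zero)
  have "cinner (tensor F (Inl (vec1_perp F h) # v)) (tensor F (Inl (vec1_perp F k) # w)) =
      cinner (vec1_perp F h) (vec1_perp F k) * cinner (tensor F v) (tensor F w)"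
    using red F by (simp add: tensor_inner)
  moreover have "cinner (vec1_perp F h) (vec1_perp F k) = cinner h k - cinner h (vec1 F) * cnj (cinner k (vec1 F))"
    using vec1_perp_inner [OF F, of h] cinner_commute [of "vec1 F" k]
    by (simp add: vec1_perp_def [of F k] cinner_diff_right cinner_scaleC_right)
      (simp add: vec1_perp_def cinner_simps)
  ultimately show ?thesis
    using no [OF red(3) w] no' [OF red(4) v]
    by (simp add: prepend1_eq cinner_simps algebra_simps)
qed

definition prepended1 :: "('a::complex_hilbert, 'b::complex_hilbert, 'h::complex_hilbert) free_product \<Rightarrow> 'h set"
  where "prepended1 F = {prepend1 F h w | h w. w \<in> words_avoiding F I1}"

lemma prepended1_dense:
  assumes F: "is_free_product F"
  shows "closure (cspan (prepended1 F)) = UNIV"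
proof -
  have "tensor F ` reduced_words F \<subseteq> prepended1 F"
  proof clarify
    fix w assume "w \<in> reduced_words F"
    then show "tensor F w \<in> prepended1 F"
      using tensor_prepend1_cases [OF F] unfolding prepended1_def by blast
  qed
  then have "closure (cspan (tensor F ` reduced_words F)) \<subseteq> closure (cspan (prepended1 F))"
    by (intro closure_mono complex_vector.span_mono)
  then show ?thesis
    using free_product_dense [OF F] by blast
qed

lemma bop_eq_on_prepend1:
  assumes "is_free_product F"
    and "\<And>h w. w \<in> words_avoiding F I1 \<Longrightarrow> bop_apply S (prepend1 F h w) = bop_apply T (prepend1 F h w)"
  shows "S = T"
  by (rule bop_eq_on_dense [OF prepended1_dense [OF assms(1)]]) (use assms(2) in \<open>auto simp: prepended1_def\<close>)

text \<open>Boundedness of \<open>a \<otimes> 1\<close>: the Gram matrix of the words and the form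
  \<open>\<parallel>a\<parallel>\<^sup>2 \<langle>h, k\<rangle> - \<langle>a h, a k\<rangle>\<close> are positive semidefinite, hence so is their Schur product.\<close>

lemma lambda1_exists:
  fixes F :: "('a::complex_hilbert, 'b::complex_hilbert, 'h::complex_hilbert) free_product"
    and a :: "'a bop"
  assumes F: "is_free_product F"
  shows "\<exists>L :: 'h bop. \<forall>h. \<forall>w\<in>words_avoiding F I1. L (prepend1 F h w) = prepend1 F (a h) w"
proof -
  \<comment> \<open>The extension lemma wants a family over a whole type; inadmissible words are
    given the vector 0, consistently in \<open>u\<close>, \<open>v\<close> and
    \<open>W\<close>.\<close>
  define u where "u i = (case i of (h, w) \<Rightarrow> if w \<in> words_avoiding F I1 then prepend1 F h w else 0)" for i
  define v where "v i = (case i of (h, w) \<Rightarrow> if w \<in> words_avoiding F I1 then prepend1 F (a h) w else 0)" for i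
  define W where "W i = (case i of (h, w) \<Rightarrow> if w \<in> words_avoiding F I1 then tensor F w else 0)"
    for i :: "'a \<times> ('a + 'b) list"
  obtain K where K: "K > 0" "\<And>x. norm (a x) \<le> K * norm x"
    by (rule bop_norm_bound [of a]) blast
  have inner_u: "cinner (u i) (u j) = cinner (fst i) (fst j) * cinner (W i) (W j)" for i j
    by (auto simp: u_def W_def prepend1_inner [OF F] split: prod.splits)
  have inner_v: "cinner (v i) (v j) = cinner (a (fst i)) (a (fst j)) * cinner (W i) (W j)" for i j
    by (auto simp: v_def W_def prepend1_inner [OF F] split: prod.splits)
  have "prepended1 F \<subseteq> range u"
  proof
    fix t assume "t \<in> prepended1 F"
    then obtain h w where "t = prepend1 F h w" "w \<in> words_avoiding F I1"
      by (auto simp: prepended1_def)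
    then have "t = u (h, w)"
      by (simp add: u_def)
    then show "t \<in> range u" by blast
  qed
  then have "closure (cspan (prepended1 F)) \<subseteq> closure (cspan (range u))"
    by (intro closure_mono complex_vector.span_mono)
  then have dense: "closure (cspan (range u)) = UNIV"
    using prepended1_dense [OF F] by blast
  have "norm (lincomb v xs) \<le> K * norm (lincomb u xs)" for xs
  proof -
    let ?n = "length xs"
    define h where "h i = fst (xs ! i) *\<^sub>C fst (snd (xs ! i))" for i
    define V where "V i = W (snd (xs ! i))" for i
    define q where "q g k = of_real (K\<^sup>2) * cinner g k - cinner (a g) (a k)" for g k
    have U: "cinner (lincomb u xs) (lincomb u xs) =
        (\<Sum>i<?n. \<Sum>j<?n. cinner (h i) (h j) * cinner (V i) (V j))"
      unfolding lincomb_sum cinner_sum_left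
      by (simp add: cinner_sum_right cinner_simps inner_u h_def V_def mult_ac)
    have Vsum: "cinner (lincomb v xs) (lincomb v xs) =
        (\<Sum>i<?n. \<Sum>j<?n. cinner (a (h i)) (a (h j)) * cinner (V i) (V j))"
      unfolding lincomb_sum cinner_sum_left
      by (simp add: cinner_sum_right cinner_simps inner_v h_def V_def bop_scaleC mult_ac)
    have "0 \<le> Re (\<Sum>i<?n. \<Sum>j<?n. q (h i) (h j) * cinner (V i) (V j))"
    proof (rule psd_form_Schur_product)
      show "q x y = cnj (q y x)" for x y
        by (simp add: q_def flip: cinner_commute)
      show "0 \<le> Re (q x x)" for x
        using power_mono [OF K(2) norm_ge_zero, of x 2]
        by (simp add: q_def cinner_self power_mult_distrib flip: of_real_power)
    qed (auto simp: q_def bop_linear_simps cinner_simps algebra_simps)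
    also have "(\<Sum>i<?n. \<Sum>j<?n. q (h i) (h j) * cinner (V i) (V j)) =
        of_real (K\<^sup>2) * cinner (lincomb u xs) (lincomb u xs) - cinner (lincomb v xs) (lincomb v xs)"
      unfolding U Vsum q_def sum_distrib_left sum_subtractf [symmetric]
      by (simp only: left_diff_distrib mult.assoc)
    also have "Re \<dots> = K\<^sup>2 * (norm (lincomb u xs))\<^sup>2 - (norm (lincomb v xs))\<^sup>2"
      by (simp add: cinner_self flip: of_real_power)
    finally have "(norm (lincomb v xs))\<^sup>2 \<le> (K * norm (lincomb u xs))\<^sup>2"
      by (simp add: power_mult_distrib)
    then show ?thesis
      by (rule power2_le_imp_le) (use K(1) in simp)
  qed
  from bop_extension [OF dense this] obtain L :: "'h bop" where L: "\<And>i. L (u i) = v i"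
    by blast
  have "L (prepend1 F h w) = prepend1 F (a h) w" if "w \<in> words_avoiding F I1" for h w
    using L [of "(h, w)"] that by (simp add: u_def v_def)
  then show ?thesis by blast
qed

lemma lambda1_prepend1:
  fixes F :: "('a::complex_hilbert, 'b::complex_hilbert, 'h::complex_hilbert) free_product"
    and a :: "'a bop"
  assumes F: "is_free_product F" and w: "w \<in> words_avoiding F I1"
  shows "lambda1 F a (prepend1 F h w) = prepend1 F (a h) w"
proof -
  have "\<exists>!L :: 'h bop. \<forall>h. \<forall>w\<in>words_avoiding F I1. L (prepend1 F h w) = prepend1 F (a h) w"
    using lambda1_exists [OF F, of a] by (auto intro: bop_eq_on_prepend1 [OF F])
  from theI' [OF this] show ?thesis
    using w unfolding lambda1_def by blast
qed

lemma lambda1_eqI: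
  assumes F: "is_free_product F"
    and "\<And>h w. w \<in> words_avoiding F I1 \<Longrightarrow> bop_apply L (prepend1 F h w) = prepend1 F (bop_apply a h) w"
  shows "lambda1 F a = L"
  by (rule bop_eq_on_prepend1 [OF F]) (simp add: lambda1_prepend1 [OF F] assms(2))

lemma lambda1_hom:
  assumes F: "is_free_product F"
  shows lambda1_mult: "lambda1 F (a * b) = lambda1 F a * lambda1 F b"
    and lambda1_add: "lambda1 F (a + b) = lambda1 F a + lambda1 F b"
    and lambda1_scaleC: "lambda1 F (c *\<^sub>C a) = c *\<^sub>C lambda1 F a"
    and lambda1_one: "lambda1 F 1 = 1"
  by (auto intro!: lambda1_eqI [OF F]
      simp: bop_rep lambda1_prepend1 [OF F] prepend1_add [OF F] prepend1_scaleC [OF F])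

lemma lambda1_diff:
  assumes F: "is_free_product F"
  shows "lambda1 F (a - b) = lambda1 F a - lambda1 F b"
  using lambda1_add [OF F, of "a - b" b] by (simp add: algebra_simps)

lemma adjoint_pair_on_dense:
  fixes S T :: "'a::complex_inner bop"
  assumes dense: "closure (cspan A) = UNIV"
    and eq: "\<And>x y. x \<in> A \<Longrightarrow> y \<in> A \<Longrightarrow> cinner (S x) y = cinner x (T y)"
  shows "cinner (S x) y = cinner x (T y)"
proof -
  have left: "cinner (S x) y = cinner x (T y)" if "y \<in> A" for x y
  proof -
    have "closure (cspan A) \<subseteq> {x. cinner (S x) y = cinner x (T y)}"
    proof (rule closure_cspan_subset)
      show "csubspace {x. cinner (S x) y = cinner x (T y)}"
        by (auto simp: complex_vector.subspace_def bop_linear_simps cinner_simps)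
      show "closed {x. cinner (S x) y = cinner x (T y)}"
        by (intro closed_Collect_eq linear_continuous_on bounded_linear_cinner_left
            bounded_linear_compose [OF bounded_linear_cinner_left bop_bounded_linear])
    qed (use eq that in blast)
    then show ?thesis using dense by blast
  qed
  have "closure (cspan A) \<subseteq> {y. cinner (S x) y = cinner x (T y)}"
  proof (rule closure_cspan_subset)
    show "csubspace {y. cinner (S x) y = cinner x (T y)}"
      by (auto simp: complex_vector.subspace_def bop_linear_simps cinner_simps)
    show "closed {y. cinner (S x) y = cinner x (T y)}"
      by (intro closed_Collect_eq linear_continuous_on bounded_linear_cinner_right
          bounded_linear_compose [OF bounded_linear_cinner_right bop_bounded_linear])
  qed (use left in blast)
  then show ?thesis using dense by blast
qed

lemma lambda1_adjoint:
  assumes F: "is_free_product F" and ab: "\<And>h k. cinner (bop_apply a h) k = cinner h (bop_apply b k)"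
  shows "cinner (lambda1 F a x) y = cinner x (lambda1 F b y)"
  by (rule adjoint_pair_on_dense [OF prepended1_dense [OF F]])
    (auto simp: prepended1_def lambda1_prepend1 [OF F] prepend1_inner [OF F] ab)

lemma lambda1_selfadjoint: "is_free_product F \<Longrightarrow> selfadjoint_op a \<Longrightarrow> selfadjoint_op (lambda1 F a)"
  unfolding selfadjoint_op_def by (intro allI lambda1_adjoint) simp_all

lemma vacuum_inner: "is_free_product F \<Longrightarrow> cinner (tensor F []) (tensor F []) = 1"
  by (simp add: tensor_inner)

lemma lambda1_positive_iff:
  assumes F: "is_free_product F"
  shows "positive_op (lambda1 F a) \<longleftrightarrow> positive_op a"
proof
  assume pos: "positive_op (lambda1 F a)"
  \<comment> \<open>The vectors \<open>prepend1 F h []\<close> form a copy of the first space on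
    which the left action is \<open>a\<close> itself.\<close>
  have "cinner (a h) h = cinner (lambda1 F a (prepend1 F h [])) (prepend1 F h [])" for h
    by (simp add: lambda1_prepend1 [OF F] prepend1_inner [OF F] vacuum_inner [OF F])
  then show "positive_op a"
    using pos by (simp add: positive_op_def)
next
  assume a: "positive_op a"
  have "lambda1 F a = lambda1 F (sqrt_op a) * lambda1 F (sqrt_op a)"
    by (simp add: sqrt_op_square [OF a] flip: lambda1_mult [OF F])
  then show "positive_op (lambda1 F a)"
    using positive_op_square [OF lambda1_selfadjoint [OF F selfadjoint_sqrt_op [OF a]]] by simp
qed

lemma lambda1_sqrt:
  assumes F: "is_free_product F" and a: "positive_op a"
  shows "sqrt_op (lambda1 F a) = lambda1 F (sqrt_op a)"
  by (rule sqrt_op_eqI)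
    (simp_all add: lambda1_positive_iff [OF F] positive_sqrt_op [OF a] sqrt_op_square [OF a]
      flip: lambda1_mult [OF F])

lemma prepend2_swap: "prepend2 F h w = prepend1 (swap_product F) h (map swap_letter w)"
  by (simp add: prepend2_def prepend1_def)

lemma words_avoiding_swap:
  "w \<in> words_avoiding (swap_product F) i \<longleftrightarrow> map swap_letter w \<in> words_avoiding F (other i)"
  by (cases w) (auto simp: words_avoiding_def neq_iff_eq_other)

text \<open>Relabelling letters turns one defining condition literally into the other, so the two
  descriptions agree.\<close>

lemma lambda2_swap: "lambda2 F b = lambda1 (swap_product F) b"
proof -
  have *: "(\<forall>w\<in>words_avoiding F I2. P w) \<longleftrightarrow>
      (\<forall>w\<in>words_avoiding (swap_product F) I1. P (map swap_letter w))" for P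
  proof
    assume P: "\<forall>w\<in>words_avoiding (swap_product F) I1. P (map swap_letter w)"
    show "\<forall>w\<in>words_avoiding F I2. P w"
    proof
      fix w assume "w \<in> words_avoiding F I2"
      then have "P (map swap_letter (map swap_letter w))"
        using P words_avoiding_swap [of "map swap_letter w" F I1] by (metis other.simps(1) map_swap_letter_involution)
      then show "P w" by simp
    qed
  qed (simp add: words_avoiding_swap)
  show ?thesis
    unfolding lambda2_def lambda1_def * prepend2_swap map_swap_letter_involution ..
qed

subsection \<open>Projections onto words of prescribed types\<close>

text \<open>Every projection of the proof is onto the span of words whose sequence of indices lies
  in some set \<open>D\<close>. Products, sums and complements of these projections reduce to set
  operations on \<open>D\<close>.\<close>

definition type_words :: "('a::complex_hilbert, 'b::complex_hilbert, 'h) free_product \<Rightarrow> index list set \<Rightarrow> ('a + 'b) list set"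
  where "type_words F D = {w \<in> reduced_words F. map index_of w \<in> D}"

definition type_space :: "('a::complex_hilbert, 'b::complex_hilbert, 'h::complex_hilbert) free_product \<Rightarrow> index list set \<Rightarrow> 'h set"
  where "type_space F D = closure (cspan (tensor F ` type_words F D))"

definition type_proj :: "('a::complex_hilbert, 'b::complex_hilbert, 'h::complex_hilbert) free_product \<Rightarrow> index list set \<Rightarrow> 'h bop"
  where "type_proj F D = projection (type_space F D)"

lemma projection_eqI:
  fixes P :: "'a::complex_hilbert bop"
  assumes M: "csubspace M" and P: "\<And>h. P h \<in> M" "\<And>h m. m \<in> M \<Longrightarrow> cinner (h - P h) m = 0"
  shows "projection M = P"
  unfolding projection_def
proof (rule the_equality)
  fix R :: "'a bop" assume R: "\<forall>h. R h \<in> M \<and> (\<forall>m\<in>M. cinner (h - R h) m = 0)"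
  show "R = P"
  proof (rule bop_eqI)
    fix h
    have "R h - P h \<in> M"
      using R P(1) M by (simp add: complex_vector.subspace_diff)
    then have "cinner (h - P h) (R h - P h) = 0" "cinner (h - R h) (R h - P h) = 0"
      using R P(2) by auto
    moreover have "R h - P h = (h - P h) - (h - R h)"
      by simp
    ultimately have "cinner (R h - P h) (R h - P h) = 0"
      by (metis cinner_diff_left diff_0_right)
    then show "R h = P h" by simp
  qed
qed (use P in blast)

lemma tensor_inner_types:
  assumes F: "is_free_product F" and vw: "v \<in> reduced_words F" "w \<in> reduced_words F"
    and ne: "map index_of v \<noteq> map index_of w"
  shows "cinner (tensor F v) (tensor F w) = 0"
proof -
  have "prod_list (map2 letter_inner v w) = 0" if "length v = length w" "map index_of v \<noteq> map index_of w"
    for v :: "('a::complex_hilbert + 'b::complex_hilbert) list" and w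
    using that
  proof (induction v w rule: list_induct2)
    case (Cons x xs y ys)
    then show ?case
      by (cases x; cases y) auto
  qed simp
  then show ?thesis
    using tensor_inner [OF F vw] ne by auto
qed

text \<open>Words of different types are orthogonal, so discarding the words outside
  \<open>D\<close> cannot increase the norm of a combination, by Pythagoras.\<close>

lemma type_proj_exists:
  fixes F :: "('a::complex_hilbert, 'b::complex_hilbert, 'h::complex_hilbert) free_product"
  assumes F: "is_free_product F"
  shows "\<exists>P :: 'h bop. \<forall>w\<in>reduced_words F. P (tensor F w) = (if map index_of w \<in> D then tensor F w else 0)"
proof -
  define u where "u w = (if w \<in> reduced_words F then tensor F w else 0)" for w
  define v where "v w = (if map index_of w \<in> D then u w else 0)" for w
  define v' where "v' w = (if map index_of w \<in> D then 0 else u w)" for w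
  have "tensor F ` reduced_words F \<subseteq> range u"
    by (auto simp: u_def image_iff)
  then have "closure (cspan (tensor F ` reduced_words F)) \<subseteq> closure (cspan (range u))"
    by (intro closure_mono complex_vector.span_mono)
  then have dense: "closure (cspan (range u)) = UNIV"
    using free_product_dense [OF F] by blast
  have orth: "cinner (v x) (v' y) = 0" for x y
    by (auto simp: v_def v'_def u_def intro!: tensor_inner_types [OF F])
  have "norm (lincomb v xs) \<le> 1 * norm (lincomb u xs)" for xs
  proof -
    have eq: "lincomb u xs = lincomb v xs + lincomb v' xs"
      unfolding lincomb_sum by (simp add: v_def v'_def sum.distrib [symmetric] complex_vector.scale_zero_right)
        (intro sum.cong refl, auto simp: complex_vector.scale_zero_right)
    have "cinner (lincomb v xs) (lincomb v' xs) = 0"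
      unfolding lincomb_sum cinner_sum_left cinner_sum_right by (simp add: cinner_simps orth)
    moreover from this have "cinner (lincomb v' xs) (lincomb v xs) = 0"
      by (metis cinner_commute complex_cnj_zero)
    ultimately have "cinner (lincomb u xs) (lincomb u xs) =
        cinner (lincomb v xs) (lincomb v xs) + cinner (lincomb v' xs) (lincomb v' xs)"
      by (simp add: eq cinner_simps)
    then have "(norm (lincomb u xs))\<^sup>2 = (norm (lincomb v xs))\<^sup>2 + (norm (lincomb v' xs))\<^sup>2"
      unfolding cinner_self of_real_add [symmetric] of_real_eq_iff .
    then have "(norm (lincomb v xs))\<^sup>2 \<le> (norm (lincomb u xs))\<^sup>2"
      by simp
    then have "norm (lincomb v xs) \<le> norm (lincomb u xs)"
      by (rule power2_le_imp_le) simp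
    then show ?thesis by simp
  qed
  from bop_extension [OF dense this] obtain P :: "'h bop" where P: "\<And>w. P (u w) = v w"
    by blast
  have "\<forall>w\<in>reduced_words F. P (tensor F w) = (if map index_of w \<in> D then tensor F w else 0)"
  proof
    fix w assume "w \<in> reduced_words F"
    then show "P (tensor F w) = (if map index_of w \<in> D then tensor F w else 0)"
      using P [of w] by (simp add: u_def v_def)
  qed
  then show ?thesis by blast
qed

lemma csubspace_type_space: "csubspace (type_space F D)"
  by (simp add: type_space_def csubspace_closure)

lemma closed_type_space: "closed (type_space F D)"
  by (simp add: type_space_def)

lemma tensor_in_type_space: "w \<in> type_words F D \<Longrightarrow> tensor F w \<in> type_space F D"
  unfolding type_space_def by (rule subsetD [OF closure_cspan_superset]) (rule imageI)

lemma type_proj_props: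
  fixes F :: "('a::complex_hilbert, 'b::complex_hilbert, 'h::complex_hilbert) free_product"
  assumes F: "is_free_product F"
  shows type_proj_tensor: "w \<in> reduced_words F \<Longrightarrow>
      type_proj F D (tensor F w) = (if map index_of w \<in> D then tensor F w else 0)"
    and type_proj_in: "type_proj F D h \<in> type_space F D"
    and type_proj_selfadjoint: "selfadjoint_op (type_proj F D)"
    and type_proj_id: "h \<in> type_space F D \<Longrightarrow> type_proj F D h = h"
proof -
  obtain P :: "'h bop" where
    P: "\<And>w. w \<in> reduced_words F \<Longrightarrow> P (tensor F w) = (if map index_of w \<in> D then tensor F w else 0)"
    using type_proj_exists [OF F] by blast
  have P_in: "P h \<in> type_space F D" for h
  proof (rule bop_closure_cspan_into [of "tensor F ` reduced_words F"])
    show "P t \<in> type_space F D" if "t \<in> tensor F ` reduced_words F" for t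
      using that P complex_vector.subspace_0 [OF csubspace_type_space [of F D]]
      by (auto intro!: tensor_in_type_space simp: type_words_def)
  qed (simp_all add: csubspace_type_space closed_type_space free_product_dense [OF F])
  have sa: "cinner (P x) y = cinner x (P y)" for x y
  proof (rule adjoint_pair_on_dense [OF free_product_dense [OF F]])
    fix x y assume "x \<in> tensor F ` reduced_words F" "y \<in> tensor F ` reduced_words F"
    then obtain v w where vw: "v \<in> reduced_words F" "w \<in> reduced_words F"
      and xy: "x = tensor F v" "y = tensor F w"
      by blast
    show "cinner (P x) y = cinner x (P y)"
    proof (cases "map index_of v = map index_of w")
      case True
      then show ?thesis
        using vw by (simp add: xy P)
    next
      case False
      then show ?thesis
        using vw by (simp add: xy P tensor_inner_types [OF F])
    qed
  qed
  have P_id: "P h = h" if "h \<in> type_space F D" for h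
  proof -
    have "type_space F D \<subseteq> {h. P h = bop_apply 1 h}"
      unfolding type_space_def
      by (intro closure_cspan_subset closed_bop_eq csubspace_bop_eq)
        (auto simp: type_words_def P bop_rep)
    then show ?thesis
      using that by (auto simp: bop_rep)
  qed
  have "type_proj F D = P"
    unfolding type_proj_def
  proof (rule projection_eqI [OF csubspace_type_space P_in])
    fix h m assume "m \<in> type_space F D"
    then have "cinner (h - P h) m = cinner (P (h - P h)) m"
      by (simp add: sa P_id)
    then show "cinner (h - P h) m = 0"
      by (simp add: bop_diff P_id P_in)
  qed
  then show "w \<in> reduced_words F \<Longrightarrow>
      type_proj F D (tensor F w) = (if map index_of w \<in> D then tensor F w else 0)"
    "type_proj F D h \<in> type_space F D" "selfadjoint_op (type_proj F D)"
    "h \<in> type_space F D \<Longrightarrow> type_proj F D h = h"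
    using P P_in sa P_id by (auto simp: selfadjoint_op_def)
qed

lemma reduced_distinct_adj: "w \<in> reduced_words F \<Longrightarrow> distinct_adj (map index_of w)"
  by (simp add: reduced_words_def)

lemma type_proj_eqI:
  assumes F: "is_free_product F"
    and "\<And>w. w \<in> reduced_words F \<Longrightarrow>
      bop_apply T (tensor F w) = (if map index_of w \<in> D then tensor F w else 0)"
  shows "type_proj F D = T"
  by (rule bop_eq_on_tensors [OF F]) (simp add: type_proj_tensor [OF F] assms(2))

lemma type_proj_cong:
  assumes F: "is_free_product F" and "\<And>t. distinct_adj t \<Longrightarrow> t \<in> D \<longleftrightarrow> t \<in> E"
  shows "type_proj F D = type_proj F E"
  by (rule type_proj_eqI [OF F]) (simp add: type_proj_tensor [OF F] assms(2) reduced_distinct_adj)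

lemma type_proj_mult:
  assumes F: "is_free_product F"
  shows "type_proj F D * type_proj F E = type_proj F (D \<inter> E)"
  by (rule sym, rule type_proj_eqI [OF F]) (simp add: bop_rep type_proj_tensor [OF F])

lemma type_proj_add:
  assumes F: "is_free_product F" and "D \<inter> E = {}"
  shows "type_proj F D + type_proj F E = type_proj F (D \<union> E)"
  by (rule sym, rule type_proj_eqI [OF F])
    (use assms(2) in \<open>auto simp: bop_rep type_proj_tensor [OF F]\<close>)

lemma type_proj_Compl:
  assumes F: "is_free_product F"
  shows "1 - type_proj F D = type_proj F (- D)"
  by (rule sym, rule type_proj_eqI [OF F]) (simp add: bop_rep type_proj_tensor [OF F])

lemma type_proj_swap:
  assumes F: "is_free_product F"
  shows "type_proj (swap_product F) D = type_proj F {t. map other t \<in> D}"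
proof (rule sym, rule bop_eq_on_tensors [OF F])
  fix w assume w: "w \<in> reduced_words F"
  have "type_proj (swap_product F) D (tensor (swap_product F) (map swap_letter w)) =
      (if map index_of (map swap_letter w) \<in> D then tensor (swap_product F) (map swap_letter w) else 0)"
    using w by (intro type_proj_tensor is_free_product_swap F) simp
  then show "type_proj F {t. map other t \<in> D} (tensor F w) = type_proj (swap_product F) D (tensor F w)"
    using w type_proj_tensor [OF F w, of "{t. map other t \<in> D}"] unfolding map_index_of_swap
    by (simp add: comp_def)
qed

lemma type_proj_rev:
  assumes F: "is_free_product F"
  shows "type_proj (rev_product F) D = type_proj F {t. rev t \<in> D}"
proof (rule sym, rule bop_eq_on_tensors [OF F])
  fix w assume w: "w \<in> reduced_words F"
  have "type_proj (rev_product F) D (tensor (rev_product F) (rev w)) =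
      (if map index_of (rev w) \<in> D then tensor (rev_product F) (rev w) else 0)"
    using w by (intro type_proj_tensor is_free_product_rev F) simp
  then show "type_proj F {t. rev t \<in> D} (tensor F w) = type_proj (rev_product F) D (tensor F w)"
    using type_proj_tensor [OF F w, of "{t. rev t \<in> D}"] by (simp add: rev_map)
qed

lemma type_proj_prepend1:
  assumes F: "is_free_product F" and w: "w \<in> words_avoiding F I1"
    and D: "map index_of w \<in> D \<longleftrightarrow> I1 # map index_of w \<in> D"
  shows "type_proj F D (prepend1 F h w) = (if map index_of w \<in> D then prepend1 F h w else 0)"
  using Cons_vec1_perp_reduced [OF F w, of h] words_avoiding_reduced [OF w] D
  by (auto simp: prepend1_eq bop_linear_simps type_proj_tensor [OF F] complex_vector.scale_zero_right)

text \<open>The left action only mixes a word that avoids the first space in front with the words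
  obtained by prepending such a letter; the condition says that \<open>D\<close> does not separate
  the two.\<close>

lemma type_proj_lambda1_commute:
  assumes F: "is_free_product F"
    and D: "\<And>t. distinct_adj t \<Longrightarrow> t = [] \<or> hd t \<noteq> I1 \<Longrightarrow> t \<in> D \<longleftrightarrow> I1 # t \<in> D"
  shows "type_proj F D * lambda1 F a = lambda1 F a * type_proj F D"
proof (rule bop_eq_on_prepend1 [OF F])
  fix h w assume w: "w \<in> words_avoiding F I1"
  have "map index_of w \<in> D \<longleftrightarrow> I1 # map index_of w \<in> D"
    using w by (intro D) (auto simp: words_avoiding_def reduced_distinct_adj hd_map)
  then show "(type_proj F D * lambda1 F a) (prepend1 F h w) = (lambda1 F a * type_proj F D) (prepend1 F h w)"
    using w by (simp add: bop_rep lambda1_prepend1 [OF F] type_proj_prepend1 [OF F])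
qed

subsection \<open>Left and right actions\<close>

definition append1 ::
    "('a::complex_hilbert, 'b::complex_hilbert, 'h::complex_hilbert) free_product \<Rightarrow> 'a \<Rightarrow> ('a + 'b) list \<Rightarrow> 'h"
  where "append1 F k w = cinner k (vec1 F) *\<^sub>C tensor F w + tensor F (w @ [Inl (vec1_perp F k)])"

definition ends_avoiding ::
    "('a::complex_hilbert, 'b::complex_hilbert, 'h) free_product \<Rightarrow> index \<Rightarrow> ('a + 'b) list set"
  where "ends_avoiding F i = {w \<in> reduced_words F. w \<noteq> [] \<longrightarrow> index_of (last w) \<noteq> i}"

abbreviation rho1 ::
    "('a::complex_hilbert, 'b::complex_hilbert, 'h::complex_hilbert) free_product \<Rightarrow> 'a bop \<Rightarrow> 'h bop"
  where "rho1 F b \<equiv> lambda1 (rev_product F) b"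

lemma vec1_perp_rev [simp]: "vec1_perp (rev_product F) k = vec1_perp F k"
  by (simp add: vec1_perp_def)

lemma rho1_append1:
  assumes F: "is_free_product F" and w: "w \<in> ends_avoiding F I1"
  shows "rho1 F b (append1 F k w) = append1 F (b k) w"
proof -
  have "rev w \<in> words_avoiding (rev_product F) I1"
    using w by (auto simp: words_avoiding_def ends_avoiding_def hd_rev)
  from lambda1_prepend1 [OF is_free_product_rev [OF F] this] show ?thesis
    by (simp add: prepend1_eq append1_def)
qed

lemma append1_vec1:
  assumes F: "is_free_product F" and w: "w \<in> ends_avoiding F I1"
  shows "append1 F (vec1 F) w = tensor F w"
proof -
  have "w @ Inl (0::'a) # [] \<in> reduced_words F"
    using w by (auto simp: reduced_slot_iff ends_avoiding_def)
  then show ?thesis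
    using tensor_slot_zero [OF F, of w "[]"]
    by (simp add: append1_def cinner_vec1_vec1 [OF F] scaleC_one F)
qed

lemma reduced_cases_end:
  assumes w: "w \<in> reduced_words F"
  obtains "w \<in> ends_avoiding F I1"
  | k v where "w = v @ [Inl k]" "cinner k (vec1 F) = 0" "v \<in> ends_avoiding F I1"
proof (cases w rule: rev_cases)
  case Nil
  then show ?thesis
    using that(1) by (simp add: ends_avoiding_def)
next
  case (snoc v l)
  show ?thesis
  proof (cases l)
    case (Inl h)
    then show ?thesis
      using that(2) [of v h] w snoc reduced_slot_iff [of v h "[]" F] by (auto simp: ends_avoiding_def)
  next
    case (Inr k)
    then show ?thesis
      using that(1) w snoc by (simp add: ends_avoiding_def)
  qed
qed

lemma prepend2_vec2:
  assumes F: "is_free_product F" and w: "w \<in> words_avoiding F I2"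
  shows "prepend2 F (vec2 F) w = tensor F w"
proof -
  have "map swap_letter w \<in> words_avoiding (swap_product F) I1"
    using w by (simp add: words_avoiding_swap)
  from prepend1_vec1 [OF is_free_product_swap [OF F] this] show ?thesis
    by (simp add: prepend2_swap)
qed

lemma prepend2_perp: "cinner h (vec2 F) = 0 \<Longrightarrow> prepend2 F h w = tensor F (Inr h # w)"
  by (simp add: prepend2_def complex_vector.scale_zero_left)

lemma lambda2_prepend2:
  assumes F: "is_free_product F" and w: "w \<in> words_avoiding F I2"
  shows "lambda2 F b (prepend2 F h w) = prepend2 F (b h) w"
  using lambda1_prepend1 [OF is_free_product_swap [OF F], of "map swap_letter w"] w
  by (simp add: prepend2_swap lambda2_swap words_avoiding_swap)

lemma Cons_Inr_reduced:
  "Inr h # w \<in> reduced_words F \<longleftrightarrow> w \<in> words_avoiding F I2 \<and> cinner h (vec2 F) = 0"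
  by (auto simp: words_avoiding_def reduced_words_def distinct_adj_Cons hd_map)

lemma reduced_cases2:
  assumes w: "w \<in> reduced_words F"
  obtains "w \<in> words_avoiding F I2"
  | h v where "w = Inr h # v" "cinner h (vec2 F) = 0" "v \<in> words_avoiding F I2"
proof (cases w)
  case (Cons l v)
  show ?thesis
  proof (cases l)
    case (Inr h)
    then show ?thesis
      using that(2) [of h v] w Cons by (simp add: Cons_Inr_reduced)
  next
    case (Inl k)
    then show ?thesis
      using that(1) w Cons by (simp add: words_avoiding_def)
  qed
qed (use that(1) in simp)

lemma Cons_Inl_reduced:
  "Inl h # w \<in> reduced_words F \<longleftrightarrow> w \<in> words_avoiding F I1 \<and> cinner h (vec1 F) = 0"
  by (auto simp: words_avoiding_def reduced_words_def distinct_adj_Cons hd_map)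

lemma snoc_Inl_reduced:
  "w @ [Inl h] \<in> reduced_words F \<longleftrightarrow> w \<in> ends_avoiding F I1 \<and> cinner h (vec1 F) = 0"
  by (auto simp: ends_avoiding_def reduced_words_def distinct_adj_append_iff last_map)

text \<open>Here \<open>B h k c\<close> stands for h \<otimes> c \<otimes> k with h in the second
  and k in the first space. The left action changes h and the right action changes k; these are
  different slots even for empty c.\<close>

lemma lambda2_rho1_commute:
  assumes F: "is_free_product F"
  shows "lambda2 F a * rho1 F b = rho1 F b * lambda2 F a"
proof -
  define B where "B h k c = cinner k (vec1 F) *\<^sub>C prepend2 F h c + prepend2 F h (c @ [Inl (vec1_perp F k)])" for h k c
  define p where "p h = h - cinner h (vec2 F) *\<^sub>C vec2 F" for h
  have B_eq: "B h k c = cinner h (vec2 F) *\<^sub>C append1 F k c + append1 F k (Inr (p h) # c)" for h k c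
    by (simp add: B_def prepend2_def append1_def p_def scaleC_add_right scaleC_scaleC algebra_simps)
  have p: "cinner (p h) (vec2 F) = 0" for h
    using vec1_perp_inner [OF is_free_product_swap [OF F], of h] by (simp add: vec1_perp_def p_def)
  have left: "lambda2 F a (B h k c) = B (a h) k c"
    if "c \<in> words_avoiding F I2" "c \<in> ends_avoiding F I1" for h k c
  proof -
    have "c @ [Inl (vec1_perp F k)] \<in> words_avoiding F I2"
      using that snoc_Inl_reduced [of c "vec1_perp F k" F] vec1_perp_inner [OF F]
      by (auto simp: words_avoiding_def hd_append)
    then show ?thesis
      by (simp add: B_def bop_linear_simps lambda2_prepend2 [OF F] that)
  qed
  have right: "rho1 F b (B h k c) = B h (b k) c"
    if "c \<in> words_avoiding F I2" "c \<in> ends_avoiding F I1" for h k c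
  proof -
    have "Inr (p h) # c \<in> ends_avoiding F I1"
      using that Cons_Inr_reduced [of "p h" c F] p by (auto simp: ends_avoiding_def)
    then show ?thesis
      by (simp add: B_eq bop_linear_simps rho1_append1 [OF F] that)
  qed
  show ?thesis
  proof (rule bop_eq_on_tensors [OF F])
    fix w assume w: "w \<in> reduced_words F"
    \<comment> \<open>Strip the first letter, then the last one; a missing letter is supplied by the
      distinguished vector.\<close>
    have "\<exists>h c'. c' \<in> words_avoiding F I2 \<and> tensor F w = prepend2 F h c'"
      using w
    proof (cases rule: reduced_cases2)
      case 1
      then show ?thesis
        using prepend2_vec2 [OF F] by metis
    next
      case (2 h v)
      then show ?thesis
        using prepend2_perp by metis
    qed
    then obtain h c' where c': "c' \<in> words_avoiding F I2" "tensor F w = prepend2 F h c'"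
      by blast
    have "\<exists>k c. c \<in> words_avoiding F I2 \<and> c \<in> ends_avoiding F I1 \<and> prepend2 F h c' = B h k c"
      using words_avoiding_reduced [OF c'(1)]
    proof (cases rule: reduced_cases_end)
      case 1
      have "Inr (p h) # c' \<in> ends_avoiding F I1"
        using c'(1) 1 Cons_Inr_reduced [of "p h" c' F] p by (auto simp: ends_avoiding_def)
      then have "B h (vec1 F) c' = prepend2 F h c'"
        using append1_vec1 [OF F] 1 by (simp add: B_eq prepend2_def p_def)
      then show ?thesis
        using 1 c'(1) by metis
    next
      case (2 k c)
      then have "B h k c = prepend2 F h c'"
        by (simp add: B_def vec1_perp_def complex_vector.scale_zero_left)
      moreover have "c \<in> words_avoiding F I2"
        using 2 c'(1) by (cases c) (auto simp: words_avoiding_def ends_avoiding_def)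
      ultimately show ?thesis
        using 2 by metis
    qed
    then obtain k c where "c \<in> words_avoiding F I2" "c \<in> ends_avoiding F I1" "tensor F w = B h k c"
      using c'(2) by auto
    then show "(lambda2 F a * rho1 F b) (tensor F w) = (rho1 F b * lambda2 F a) (tensor F w)"
      by (simp add: bop_rep left right)
  qed
qed

text \<open>The same two-slot argument, but now both slots belong to the first space. They are
  separated only by a nonempty middle word c, which is why the types \<open>[]\<close> and
  \<open>[I1]\<close> are excluded.\<close>

lemma lambda1_rho1_commute_long:
  assumes F: "is_free_product F" and w: "w \<in> reduced_words F" and long: "map index_of w \<notin> {[], [I1]}"
  shows "lambda1 F a (rho1 F b (tensor F w)) = rho1 F b (lambda1 F a (tensor F w))"
proof -
  define B where "B h k c = cinner k (vec1 F) *\<^sub>C prepend1 F h c + prepend1 F h (c @ [Inl (vec1_perp F k)])" for h k c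
  have B_eq: "B h k c = cinner h (vec1 F) *\<^sub>C append1 F k c + append1 F k (Inl (vec1_perp F h) # c)" for h k c
    by (simp add: B_def prepend1_eq append1_def scaleC_add_right scaleC_scaleC algebra_simps)
  have left: "lambda1 F a (B h k c) = B (a h) k c"
    if "c \<in> words_avoiding F I1" "c \<in> ends_avoiding F I1" "c \<noteq> []" for h k c
  proof -
    have "c @ [Inl (vec1_perp F k)] \<in> words_avoiding F I1"
      using that snoc_Inl_reduced [of c "vec1_perp F k" F] vec1_perp_inner [OF F]
      by (auto simp: words_avoiding_def hd_append)
    then show ?thesis
      by (simp add: B_def bop_linear_simps lambda1_prepend1 [OF F] that)
  qed
  have right: "rho1 F b (B h k c) = B h (b k) c"
    if "c \<in> words_avoiding F I1" "c \<in> ends_avoiding F I1" "c \<noteq> []" for h k c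
  proof -
    have "Inl (vec1_perp F h) # c \<in> ends_avoiding F I1"
      using that Cons_Inl_reduced [of "vec1_perp F h" c F] vec1_perp_inner [OF F]
      by (auto simp: ends_avoiding_def)
    then show ?thesis
      by (simp add: B_eq bop_linear_simps rho1_append1 [OF F] that)
  qed
  have "\<exists>h c'. c' \<in> words_avoiding F I1 \<and> c' \<noteq> [] \<and> tensor F w = prepend1 F h c'"
    using w
  proof (cases rule: reduced_cases1)
    case 1
    then show ?thesis
      using prepend1_vec1 [OF F] long by (metis insertI1 list.map_disc_iff)
  next
    case (2 h v)
    then show ?thesis
      using prepend1_perp long by (metis index_of.simps(1) insertCI list.simps(8,9))
  qed
  then obtain h c' where c': "c' \<in> words_avoiding F I1" "c' \<noteq> []" "tensor F w = prepend1 F h c'"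
    by blast
  have "\<exists>k c. c \<in> words_avoiding F I1 \<and> c \<in> ends_avoiding F I1 \<and> c \<noteq> [] \<and> prepend1 F h c' = B h k c"
    using words_avoiding_reduced [OF c'(1)]
  proof (cases rule: reduced_cases_end)
    case 1
    have "Inl (vec1_perp F h) # c' \<in> ends_avoiding F I1"
      using c' 1 Cons_Inl_reduced [of "vec1_perp F h" c' F] vec1_perp_inner [OF F]
      by (auto simp: ends_avoiding_def)
    then have "B h (vec1 F) c' = prepend1 F h c'"
      using append1_vec1 [OF F] 1 by (simp add: B_eq prepend1_eq)
    then show ?thesis
      using 1 c' by metis
  next
    case (2 k c)
    then have "B h k c = prepend1 F h c'"
      by (simp add: B_def vec1_perp_def complex_vector.scale_zero_left)
    moreover have "c \<noteq> []"
      using 2 c' by (auto simp: words_avoiding_def)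
    moreover have "c \<in> words_avoiding F I1"
      using 2 c' by (cases c) (auto simp: words_avoiding_def ends_avoiding_def)
    ultimately show ?thesis
      using 2 by metis
  qed
  then obtain k c where "c \<in> words_avoiding F I1" "c \<in> ends_avoiding F I1" "c \<noteq> []" "tensor F w = B h k c"
    using c'(3) by auto
  then show ?thesis
    by (simp add: left right)
qed

lemma prepend1_Nil_eq_append1: "prepend1 F h [] = append1 F h []"
  by (simp add: prepend1_eq append1_def)

lemma Nil_ends_avoiding [simp]: "[] \<in> ends_avoiding F i"
  by (simp add: ends_avoiding_def)

lemma tensor_short:
  assumes F: "is_free_product F" and w: "w \<in> reduced_words F" and short: "map index_of w \<in> {[], [I1]}"
  obtains h where "tensor F w = prepend1 F h []"
  using w
proof (cases rule: reduced_cases1)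
  case 1
  then have "w = []"
    using short by (auto simp: words_avoiding_def)
  then show ?thesis
    using that [of "vec1 F"] prepend1_vec1 [OF F, of "[]"] by simp
next
  case (2 h v)
  then show ?thesis
    using that [of h] short by (auto simp: prepend1_perp)
qed

text \<open>On the first level both actions operate on one and the same copy of the first space, so
  there they commute exactly as \<open>a\<close> and \<open>b\<close> do.\<close>

lemma lambda1_rho1_commute:
  assumes F: "is_free_product F" and ab: "a * b = b * a"
  shows "lambda1 F a * rho1 F b = rho1 F b * lambda1 F a"
proof (rule bop_eq_on_tensors [OF F])
  fix w assume w: "w \<in> reduced_words F"
  show "(lambda1 F a * rho1 F b) (tensor F w) = (rho1 F b * lambda1 F a) (tensor F w)"
  proof (cases "map index_of w \<in> {[], [I1]}")
    case True
    obtain h where h: "tensor F w = prepend1 F h []"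
      by (rule tensor_short [OF F w True])
    have rho: "rho1 F b (prepend1 F g []) = prepend1 F (b g) []" for g
      by (simp add: prepend1_Nil_eq_append1 rho1_append1 [OF F])
    have "a (b h) = b (a h)"
      using ab by (metis times_bop.rep_eq)
    then show ?thesis
      by (simp add: h bop_rep rho lambda1_prepend1 [OF F])
  next
    case False
    then show ?thesis
      using lambda1_rho1_commute_long [OF F w] by (simp add: bop_rep)
  qed
qed

subsection \<open>The compression to the first level\<close>

abbreviation first_level :: "index list set"
  where "first_level \<equiv> {[], [I1]}"

lemma first_level_lambda1_commute:
  assumes F: "is_free_product F"
  shows "type_proj F first_level * lambda1 F a = lambda1 F a * type_proj F first_level"
  by (rule type_proj_lambda1_commute [OF F]) auto

lemma first_level_rho1_commute:
  assumes F: "is_free_product F"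
  shows "type_proj F first_level * rho1 F a = rho1 F a * type_proj F first_level"
proof -
  have "type_proj (rev_product F) first_level = type_proj F {t. rev t \<in> first_level}"
    by (rule type_proj_rev [OF F])
  also have "{t. rev t \<in> first_level} = first_level"
    by (auto simp: rev_swap)
  finally show ?thesis
    using first_level_lambda1_commute [OF is_free_product_rev [OF F]] by metis
qed

lemma lambda1_rho1_commute_Compl:
  assumes F: "is_free_product F"
  shows "lambda1 F a * rho1 F b * (1 - type_proj F first_level) =
    rho1 F b * lambda1 F a * (1 - type_proj F first_level)"
proof (rule bop_eq_on_tensors [OF F])
  fix w assume w: "w \<in> reduced_words F"
  show "(lambda1 F a * rho1 F b * (1 - type_proj F first_level)) (tensor F w) =
      (rho1 F b * lambda1 F a * (1 - type_proj F first_level)) (tensor F w)"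
    using lambda1_rho1_commute_long [OF F w] by (simp add: bop_rep type_proj_tensor [OF F w])
qed

text \<open>Right actions of the operators \<open>rank_one h (vec1 F)\<close> carry the vacuum to an
  arbitrary vector of the first level, so what commutes with them is controlled there by its action
  on the vacuum.\<close>

lift_definition rank_one :: "'a::complex_inner \<Rightarrow> 'a \<Rightarrow> 'a bop" is "\<lambda>h k x. cinner x k *\<^sub>C h"
  unfolding bounded_clinear_def
proof (intro conjI allI)
  show "bounded_linear (\<lambda>x. cinner x k *\<^sub>C h)" for h k :: 'a
  proof (rule bounded_linear_intro [of _ "norm k * norm h"])
    show "norm (cinner x k *\<^sub>C h) \<le> norm x * (norm k * norm h)" for x
      using mult_right_mono [OF Cauchy_Schwarz_cinner [of x k], of "norm h"]
      by (simp add: norm_scaleC mult.assoc)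
  qed (simp_all add: cinner_simps scaleR_scaleC scaleC_add_left scaleC_scaleC)
qed (simp add: cinner_simps scaleC_scaleC)

lemma rank_one_adjoint: "cinner (rank_one h k x) y = cinner x (rank_one k h y)"
  by (simp add: rank_one.rep_eq cinner_simps flip: cinner_commute)

text \<open>An operator commuting with the right action looks like \<open>b\<^sub>0 \<otimes> 1\<close>, so its compression to
  the first level is the scalar \<open>\<langle>b \<xi>, \<xi>\<rangle>\<close>.\<close>

lemma first_level_compression:
  assumes F: "is_free_product F" and comm: "\<And>c. b * rho1 F c = rho1 F c * b"
  shows "type_proj F first_level * b * type_proj F first_level =
    vector_state (vacuum F) b *\<^sub>C type_proj F first_level"
proof -
  let ?P = "type_proj F first_level" and ?\<xi> = "tensor F []"
  have R: "is_free_product (rev_product F)"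
    by (rule is_free_product_rev [OF F])
  have vac: "prepend1 F (vec1 F) [] = ?\<xi>"
    using prepend1_vec1 [OF F, of "[]"] by simp
  have rho: "rho1 F c (prepend1 F g []) = prepend1 F (c g) []" for c g
    by (simp add: prepend1_Nil_eq_append1 rho1_append1 [OF F])
  have gen: "rho1 F (rank_one h (vec1 F)) ?\<xi> = prepend1 F h []" for h
    unfolding vac [symmetric] rho by (simp add: rank_one.rep_eq cinner_vec1_vec1 [OF F] scaleC_one)
  have comm': "b (rho1 F c x) = rho1 F c (b x)" for c x
    using comm [of c] by (metis times_bop.rep_eq)
  \<comment> \<open>Both vectors are right translates of the vacuum. Moving the right actions across
    the inner product and past \<open>b\<close> leaves the vacuum multiplied by the inner product of
    h and k.\<close>
  have key: "cinner (b (prepend1 F h [])) (prepend1 F k []) = vector_state (vacuum F) b * cinner h k" for h k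
  proof -
    have "cinner (b (prepend1 F h [])) (prepend1 F k []) =
        cinner (rho1 F (rank_one h (vec1 F)) (b ?\<xi>)) (rho1 F (rank_one k (vec1 F)) ?\<xi>)"
      unfolding gen [symmetric] comm' ..
    also have "\<dots> = cinner (rho1 F (rank_one (vec1 F) k) (rho1 F (rank_one h (vec1 F)) (b ?\<xi>))) ?\<xi>"
      by (rule sym, rule lambda1_adjoint [OF R]) (rule rank_one_adjoint)
    also have "rho1 F (rank_one (vec1 F) k) (rho1 F (rank_one h (vec1 F)) (b ?\<xi>)) =
        b (rho1 F (rank_one (vec1 F) k) (rho1 F (rank_one h (vec1 F)) ?\<xi>))"
      unfolding comm' ..
    also have "rho1 F (rank_one (vec1 F) k) (rho1 F (rank_one h (vec1 F)) ?\<xi>) = cinner h k *\<^sub>C ?\<xi>"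
      unfolding gen rho rank_one.rep_eq by (simp add: prepend1_scaleC [OF F] vac)
    finally show ?thesis
      by (simp add: bop_scaleC cinner_simps vector_state_def vacuum_def mult.commute)
  qed
  have sa: "cinner (?P x) y = cinner x (?P y)" for x y
    using type_proj_selfadjoint [OF F] by (rule selfadjoint_opD)
  show ?thesis
  proof (rule bop_eq_on_tensors [OF F], rule tensor_eqI [OF F])
    fix v w assume v: "v \<in> reduced_words F" and w: "w \<in> reduced_words F"
    show "cinner ((?P * b * ?P) (tensor F v)) (tensor F w) =
        cinner ((vector_state (vacuum F) b *\<^sub>C ?P) (tensor F v)) (tensor F w)"
    proof (cases "map index_of v \<in> first_level \<and> map index_of w \<in> first_level")
      case True
      obtain h where h: "tensor F v = prepend1 F h []"
        by (rule tensor_short [OF F v]) (use True in blast)+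
      obtain k where k: "tensor F w = prepend1 F k []"
        by (rule tensor_short [OF F w]) (use True in blast)+
      note hk = h k
      have P: "?P (tensor F v) = tensor F v" "?P (tensor F w) = tensor F w"
        using type_proj_tensor [OF F] v w True by simp_all
      have "cinner (tensor F v) (tensor F w) = cinner h k"
        unfolding hk by (simp add: prepend1_inner [OF F] vacuum_inner [OF F])
      then show ?thesis
        using key [of h k] by (simp add: bop_rep sa P cinner_simps flip: hk)
    next
      case False
      then consider "?P (tensor F v) = 0" | "?P (tensor F w) = 0"
        using type_proj_tensor [OF F] v w by auto
      then show ?thesis
      proof cases
        case 1
        then show ?thesis
          by (simp add: bop_rep complex_vector.scale_zero_right)
      next
        case 2
        then show ?thesis
          by (simp add: bop_rep sa cinner_simps)
      qed
    qed
  qed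
qed

section \<open>The decomposition\<close>

lemma alg_subset: "csubalgebra A \<Longrightarrow> S \<subseteq> A \<Longrightarrow> alg S \<subseteq> A"
  unfolding alg_def by (rule hull_minimal)

lemma alg_superset: "S \<subseteq> alg S"
  unfolding alg_def by (rule hull_subset)

lemma csubalgebra_alg: "csubalgebra (alg S)"
  unfolding alg_def
proof (rule hull_in)
  fix \<A> :: "'a set set" assume A: "\<forall>A\<in>\<A>. csubalgebra A"
  then have "csubspace (\<Inter> \<A>)"
    by (auto simp: csubalgebra_def complex_vector.subspace_def)
  then show "csubalgebra (\<Inter> \<A>)"
    using A by (auto simp: csubalgebra_def)
qed

lemma csubalgebra_commutant: "csubalgebra {b :: 'a::complex_inner bop. b * c = c * b}"
  unfolding csubalgebra_def complex_vector.subspace_def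
proof (intro conjI ballI allI; clarsimp)
  show "(a + b) * c = c * (a + b)" if "a * c = c * a" "b * c = c * b" for a b
    using that by (simp add: distrib_left distrib_right)
  show "(r *\<^sub>C b) * c = c * (r *\<^sub>C b)" if "b * c = c * b" for r b
    using that by (simp add: scaleC_mult_bop)
  show "a * b * c = c * (a * b)" if "a * c = c * a" "b * c = c * b" for a b
    using that by (metis mult.assoc)
qed

lemma csubalgebra_corner: "csubalgebra {b :: 'a::complex_inner bop. p * b = b \<and> b * p = b}"
  unfolding csubalgebra_def complex_vector.subspace_def
proof (intro conjI ballI allI; clarsimp)
  show "p * (a + b) = a + b \<and> (a + b) * p = a + b" if "p * a = a" "a * p = a" "p * b = b" "b * p = b" for a b
    using that by (simp add: distrib_left distrib_right)
  show "p * (r *\<^sub>C b) = r *\<^sub>C b \<and> (r *\<^sub>C b) * p = r *\<^sub>C b" if "p * b = b" "b * p = b" for r b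
    using that by (simp add: scaleC_mult_bop)
  show "p * (a * b) = a * b \<and> a * b * p = a * b" if "p * a = a" "b * p = b" for a b
    using that by (metis mult.assoc)
qed

text \<open>The difference u of the root at v and v is mapped to -u by the root, and positivity
  forces u = 0.\<close>

lemma sqrt_op_fixed_vector:
  assumes T: "positive_op T" and v: "T v = v"
  shows "sqrt_op T v = v"
proof -
  define u where "u = sqrt_op T v - v"
  have "sqrt_op T u + u = sqrt_op T (sqrt_op T v) - v"
    by (simp add: u_def bop_diff)
  also have "\<dots> = 0"
    using sqrt_op_square [OF T] v by (metis times_bop.rep_eq diff_self)
  finally have "cinner (sqrt_op T u + u) u = 0" by simp
  then have "Re (cinner (sqrt_op T u) u) + (norm u)\<^sup>2 = 0"
    by (metis cinner_add_left cinner_self Re_complex_of_real plus_complex.simps(1) zero_complex.simps(1))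
  moreover have "Re (cinner (sqrt_op T u) u) \<ge> 0"
    using positive_sqrt_op [OF T] by (simp add: positive_op_iff)
  ultimately have "(norm u)\<^sup>2 = 0"
    by (smt (verit) zero_le_power2)
  then show ?thesis
    by (simp add: u_def)
qed

lemma type_proj_positive: "is_free_product F \<Longrightarrow> positive_op (type_proj F D)"
  using positive_op_square [OF type_proj_selfadjoint, of F D] by (simp add: type_proj_mult)

lemma sqrt_type_proj: "is_free_product F \<Longrightarrow> sqrt_op (type_proj F D) = type_proj F D"
  by (rule sqrt_op_eqI) (simp_all add: type_proj_positive type_proj_mult)

section \<open>The factors \<open>y\<close> and \<open>z\<close>, the operator \<open>Y\<close>, and
  monotone independence\<close>

locale free_product_pair =
  fixes F :: "('a::complex_hilbert, 'b::complex_hilbert, 'h::complex_hilbert) free_product"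
    and x :: "'a bop" and y0 :: "'b bop" and X1 X2 :: "'h bop"
  assumes F: "is_free_product F"
    and X1: "X1 = lambda1 F x" and X2: "X2 = lambda2 F y0"
    and X1_pos: "positive_op X1" and X2_pos: "positive_op X2"
begin

definition P :: "'h bop" where "P = type_proj F first_level"

definition y :: "'h bop" where "y = X1 * P + (1 - P)"

definition z :: "'h bop" where "z = P + X1 * (1 - P)"

definition Y :: "'h bop" where "Y = sqrt_op z * X2 * sqrt_op z"

definition vac :: 'h where "vac = vacuum F"

lemma P_idem: "P * P = P"
  by (simp add: P_def type_proj_mult [OF F])

lemma P_X1: "P * X1 = X1 * P"
  by (simp add: P_def X1 first_level_lambda1_commute [OF F])

lemma P_pos: "positive_op P" "positive_op (1 - P)"
  by (simp_all add: P_def type_proj_Compl [OF F] type_proj_positive [OF F])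

lemma P_Compl: "P * (1 - P) = 0" "(1 - P) * P = 0" "(1 - P) * (1 - P) = 1 - P" "(1 - P) * X1 = X1 * (1 - P)"
  by (simp_all add: right_diff_distrib left_diff_distrib P_idem P_X1)

lemma y_pos: "positive_op y"
  unfolding y_def using P_pos X1_pos P_X1 by (intro positive_op_add positive_op_mult_commute) auto

lemma z_pos: "positive_op z"
  unfolding z_def using P_pos X1_pos P_Compl(4) by (intro positive_op_add positive_op_mult_commute) auto

lemma P_y: "P * y = X1 * P" "y * P = X1 * P"
  by (simp_all add: y_def distrib_left distrib_right P_Compl mult.assoc P_idem)
    (metis P_X1 P_idem mult.assoc)

lemma P_z: "P * z = P" "z * P = P"
proof -
  have "P * (X1 * (1 - P)) = X1 * (P * (1 - P))"
    by (metis P_X1 mult.assoc)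
  then show "P * z = P"
    by (simp add: z_def distrib_left P_idem P_Compl)
  show "z * P = P"
    by (simp add: z_def distrib_right P_idem P_Compl mult.assoc)
qed

lemma yz: "y * z = X1" and zy: "z * y = X1"
proof -
  have "y * z = X1 * (P * z) + (1 - P) * z"
    by (simp add: y_def distrib_right mult.assoc)
  also have "(1 - P) * z = (1 - P) * P + (1 - P) * X1 * (1 - P)"
    by (simp add: z_def distrib_left mult.assoc)
  also have "\<dots> = X1 * (1 - P)"
    by (simp add: P_Compl mult.assoc)
  also have "X1 * (P * z) + X1 * (1 - P) = X1"
    by (simp add: P_z right_diff_distrib)
  finally show "y * z = X1" .
  have "z * y = z * P * X1 + z * (1 - P)"
    by (simp add: y_def distrib_left mult.assoc P_X1 [symmetric])
  also have "z * (1 - P) = X1 * (1 - P)"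
    by (simp add: z_def distrib_right P_Compl mult.assoc)
  also have "z * P * X1 + X1 * (1 - P) = X1"
    by (simp add: P_z P_X1 right_diff_distrib)
  finally show "z * y = X1" .
qed

lemma Y_pos: "positive_op Y"
  unfolding Y_def by (intro positive_op_conjugate selfadjoint_sqrt_op z_pos X2_pos)

lemma sqrt_X1: "sqrt_op X1 = sqrt_op y * sqrt_op z"
  using sqrt_op_mult [OF y_pos z_pos] yz zy by simp

lemma sqrt_yz: "sqrt_op y * sqrt_op z = sqrt_op z * sqrt_op y"
proof -
  have "sqrt_op z * y = y * sqrt_op z"
    using sqrt_op_commute [OF z_pos, of y] yz zy by simp
  then show ?thesis
    using sqrt_op_commute [OF y_pos, of "sqrt_op z"] by simp
qed

lemma decomposition: "sqrt_op X1 * X2 * sqrt_op X1 = sqrt_op y * Y * sqrt_op y"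
proof -
  have "sqrt_op X1 * X2 * sqrt_op X1 = sqrt_op y * sqrt_op z * X2 * (sqrt_op z * sqrt_op y)"
    unfolding sqrt_X1 by (subst (2) sqrt_yz) (rule refl)
  then show ?thesis
    by (simp add: Y_def mult.assoc)
qed

lemma norm_vac: "norm vac = 1"
  by (simp add: vac_def norm_vacuum [OF F])

lemma vac_inner: "cinner vac vac = 1"
  by (simp add: cinner_self norm_vac)

lemma P_vac: "P vac = vac"
  using type_proj_tensor [OF F Nil_reduced, of first_level] by (simp add: P_def vac_def vacuum_def)

lemma P_sa: "cinner (P u) v = cinner u (P v)"
  using type_proj_selfadjoint [OF F] by (simp add: P_def selfadjoint_op_def)

lemma z_vac: "z vac = vac"
  using P_z(2) P_vac by (metis times_bop.rep_eq)

lemma sqrt_z_vac: "sqrt_op z vac = vac"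
  by (rule sqrt_op_fixed_vector [OF z_pos z_vac])

text \<open>On the range of \<open>P\<close>, which contains the vacuum and is invariant under
  \<open>X1\<close>, the operators \<open>y\<close> and \<open>X1\<close> coincide.\<close>

lemma distribution_y: "distribution (vector_state vac) y = distribution (vector_state vac) X1"
proof -
  have "(y ^ n) vac = (X1 ^ n) vac" for n
  proof (induction n)
    case (Suc n)
    have "P * X1 ^ n = X1 ^ n * P"
      using P_X1 by (rule bop_power_commute)
    then have "P ((X1 ^ n) vac) = (X1 ^ n) vac"
      using P_vac by (metis times_bop.rep_eq)
    then have "y ((X1 ^ n) vac) = X1 ((X1 ^ n) vac)"
      using P_y(2) by (metis times_bop.rep_eq)
    then show ?case
      using Suc by (simp add: bop_rep)
  qed simp
  then show ?thesis
    by (simp add: distribution_def vector_state_def)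
qed

text \<open>The heart of the factorization: \<open>X1\<close> can fail to commute with a right
  action only on the first level, and there \<open>z\<close> is the identity.\<close>

lemma rho1_z: "rho1 F c * z = z * rho1 F c"
proof -
  have P: "P * rho1 F c = rho1 F c * P"
    by (simp add: P_def first_level_rho1_commute [OF F])
  have "rho1 F c * (X1 * (1 - P)) = X1 * rho1 F c * (1 - P)"
    using lambda1_rho1_commute_Compl [OF F, of x c] by (simp add: X1 P_def mult.assoc)
  also have "\<dots> = X1 * (1 - P) * rho1 F c"
    using P by (simp add: mult.assoc right_diff_distrib left_diff_distrib)
  finally show ?thesis
    using P by (simp add: z_def distrib_left distrib_right)
qed

lemma rho1_Y: "rho1 F c * Y = Y * rho1 F c"
proof -
  have 1: "rho1 F c * sqrt_op z = sqrt_op z * rho1 F c"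
    by (rule sqrt_op_commute [OF z_pos rho1_z])
  have 2: "rho1 F c * X2 = X2 * rho1 F c"
    by (simp add: X2 lambda2_rho1_commute [OF F])
  have mult: "c * (p * q) = (p * q) * c" if "c * p = p * c" "c * q = q * c" for c p q :: "'h bop"
    using that by (metis mult.assoc)
  show ?thesis
    unfolding Y_def by (intro mult 1 2)
qed

lemma compression:
  assumes "\<And>c. b * rho1 F c = rho1 F c * b"
  shows "P * b * P = vector_state vac b *\<^sub>C P"
  using first_level_compression [OF F assms] by (simp add: P_def vac_def)

lemma compression_alg_Y:
  assumes "b \<in> alg {Y - 1}"
  shows "P * b * P = vector_state vac b *\<^sub>C P"
proof (rule compression)
  fix c
  have "alg {Y - 1} \<subseteq> {b. b * rho1 F c = rho1 F c * b}"
    by (rule alg_subset [OF csubalgebra_commutant])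
      (simp add: left_diff_distrib right_diff_distrib rho1_Y)
  then show "b * rho1 F c = rho1 F c * b"
    using assms by blast
qed

text \<open>Since y - 1 = (X1 - 1) P, the non-unital algebra of y - 1 lies in the corner of
  \<open>P\<close>; subtracting the unit is what puts it there.\<close>

lemma alg_y_corner:
  assumes "a \<in> alg {y - 1}"
  shows "P * a = a" "a * P = a"
proof -
  have "P * (y - 1) = y - 1" "(y - 1) * P = y - 1"
    by (simp_all add: right_diff_distrib left_diff_distrib P_y) (simp_all add: y_def)
  then have "alg {y - 1} \<subseteq> {a. P * a = a \<and> a * P = a}"
    by (intro alg_subset csubalgebra_corner) simp
  then show "P * a = a" "a * P = a"
    using assms by blast+
qed

text \<open>An element a of the first algebra absorbs \<open>P\<close> on both sides and the vacuum
  lies in the range of \<open>P\<close>. Thus any b next to an a is sandwiched as P b P, which is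
  the scalar \<phi>(b) times P.\<close>

lemma monotone: "monotone_independent (vector_state vac) (y - 1) (Y - 1)"
  unfolding monotone_independent_def
proof (intro ballI conjI)
  fix w1 w2 a1 a2 b
  assume a: "a1 \<in> alg {y - 1}" "a2 \<in> alg {y - 1}" and b: "b \<in> alg {Y - 1}"
  let ?s = "vector_state vac b"
  note corner = alg_y_corner [OF a(1)] alg_y_corner [OF a(2)]
  have PbP: "P (b (P v)) = ?s *\<^sub>C P v" for v
    using compression_alg_Y [OF b] by (metis times_bop.rep_eq scaleC_bop.rep_eq)
  have a1: "a1 (P v) = a1 v" "P (a1 v) = a1 v" for v
    using corner by (metis times_bop.rep_eq)+
  have a2: "a2 (P v) = a2 v" "P (a2 v) = a2 v" for v
    using corner by (metis times_bop.rep_eq)+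
  have "a1 (b vac) = ?s *\<^sub>C a1 vac"
    using PbP [of vac] by (metis P_vac a1(1) bop_scaleC)
  then show "vector_state vac (w1 * a1 * b) = ?s * vector_state vac (w1 * a1)"
    by (simp add: vector_state_def bop_rep bop_scaleC cinner_simps)
  have "cinner (b (a2 v)) vac = ?s * cinner (a2 v) vac" for v
  proof -
    have "cinner (b (a2 v)) vac = cinner (P (b (P (a2 v)))) vac"
      by (simp add: P_sa P_vac a2)
    also have "\<dots> = ?s * cinner (a2 v) vac"
      unfolding PbP by (simp add: a2 cinner_simps)
    finally show ?thesis .
  qed
  then show "vector_state vac (b * a2 * w2) = ?s * vector_state vac (a2 * w2)"
    by (simp add: vector_state_def bop_rep)
  have "a1 (b (a2 v)) = ?s *\<^sub>C a1 (a2 v)" for v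
    using PbP [of "a2 v"] by (metis a1(1) a2(2) bop_scaleC)
  then show "vector_state vac (w1 * a1 * b * a2 * w2) = ?s * vector_state vac (w1 * a1 * a2 * w2)"
    by (simp add: vector_state_def bop_rep bop_scaleC cinner_simps)
qed

end

subsection \<open>The operators on the s-free Fock space\<close>

definition summand_types :: "index \<Rightarrow> nat \<Rightarrow> index list set"
  where "summand_types i n = {t. (t = [] \<or> hd t \<noteq> i) \<and> length t = n - 1} \<union>
    {t. (t = [] \<or> hd t \<noteq> other i) \<and> length t = n}"

lemma type_space_mono: "D \<subseteq> E \<Longrightarrow> type_space F D \<subseteq> type_space F E"
  unfolding type_space_def type_words_def
  by (intro closure_mono complex_vector.span_mono image_mono) auto

lemma closure_cspan_UN_type_space:
  "closure (cspan (\<Union>n\<in>J. type_space F (D n))) = type_space F (\<Union>n\<in>J. D n)"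
proof (rule equalityI)
  show "closure (cspan (\<Union>n\<in>J. type_space F (D n))) \<subseteq> type_space F (\<Union>n\<in>J. D n)"
    by (intro closure_cspan_subset csubspace_type_space closed_type_space UN_least type_space_mono) auto
  have "tensor F ` type_words F (\<Union>n\<in>J. D n) \<subseteq> (\<Union>n\<in>J. type_space F (D n))"
    by (auto simp: type_words_def intro!: tensor_in_type_space)
  then show "type_space F (\<Union>n\<in>J. D n) \<subseteq> closure (cspan (\<Union>n\<in>J. type_space F (D n)))"
    unfolding type_space_def [of F "\<Union>n\<in>J. D n"]
    by (intro closure_mono complex_vector.span_mono)
qed

lemma level_space_eq: "level_space F i n = type_space F {t. (t = [] \<or> hd t \<noteq> i) \<and> length t = n}"
proof -
  have "{w \<in> words_avoiding F i. length w = n} = type_words F {t. (t = [] \<or> hd t \<noteq> i) \<and> length t = n}"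
    by (auto simp: words_avoiding_def type_words_def hd_map)
  then show ?thesis
    by (simp add: level_space_def type_space_def)
qed

lemma summand_eq: "summand F i n = type_space F (summand_types i n)"
  using closure_cspan_UN_type_space [of F "\<lambda>b. if b
      then {t. (t = [] \<or> hd t \<noteq> i) \<and> length t = n - 1}
      else {t. (t = [] \<or> hd t \<noteq> other i) \<and> length t = n}" UNIV]
  by (simp add: summand_def level_space_eq summand_types_def UNIV_bool Un_commute)

lemma type_proj_norm_le:
  assumes F: "is_free_product F"
  shows "norm (type_proj F D h) \<le> norm h"
proof -
  have "positive_op (1 - type_proj F D)"
    by (simp add: type_proj_Compl [OF F] type_proj_positive [OF F])
  then have "norm (type_proj F D h) \<le> 1 * norm h"
    by (intro positive_op_norm_le type_proj_positive F)
      (auto simp: positive_op_iff bop_rep cinner_simps cinner_self)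
  then show ?thesis by simp
qed

lemma sum_type_proj:
  assumes F: "is_free_product F" and "finite K" "disjoint_family_on D K"
  shows "(\<Sum>j\<in>K. type_proj F (D j) h) = type_proj F (\<Union>j\<in>K. D j) h"
  using assms(2,3)
proof (induction K)
  case empty
  have "type_proj F {} = 0"
    by (rule type_proj_eqI [OF F]) (simp add: bop_rep)
  then show ?case by (simp add: bop_rep)
next
  case (insert a K)
  have "D a \<inter> (\<Union>j\<in>K. D j) = {}"
    using insert.prems insert.hyps by (auto simp: disjoint_family_on_def)
  then have "type_proj F (D a) h + type_proj F (\<Union>j\<in>K. D j) h = type_proj F (\<Union>j\<in>insert a K. D j) h"
    using type_proj_add [OF F, of "D a" "\<Union>j\<in>K. D j"] by (metis UN_insert plus_bop.rep_eq)
  moreover have "disjoint_family_on D K"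
    using insert.prems by (auto simp: disjoint_family_on_def)
  ultimately show ?case
    using insert by simp
qed

text \<open>On the span of the tensors the partial sums are eventually equal to the limit, since
  each word has at most one type index j. Partial sums are themselves projections of norm at most
  one, so density gives convergence everywhere.\<close>

lemma has_sum_type_proj:
  assumes F: "is_free_product F" and disj: "disjoint_family_on D J"
  shows "((\<lambda>j. type_proj F (D j) h) has_sum type_proj F (\<Union>j\<in>J. D j) h) J"
proof -
  let ?U = "\<Union>j\<in>J. D j" and ?A = "finite_subsets_at_top J"
  define E where "E = {g. \<forall>\<^sub>F K in ?A. (\<Sum>j\<in>K. type_proj F (D j) g) = type_proj F ?U g}"
  have "csubspace E"
    unfolding complex_vector.subspace_def
  proof (intro conjI ballI allI)
    show "0 \<in> E" by (simp add: E_def)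
    fix g g' assume "g \<in> E" "g' \<in> E"
    then show "g + g' \<in> E"
      unfolding E_def mem_Collect_eq
      by eventually_elim (simp add: bop_add sum.distrib)
  next
    fix c g assume "g \<in> E"
    then show "c *\<^sub>C g \<in> E"
      unfolding E_def mem_Collect_eq
      by eventually_elim (simp add: bop_scaleC complex_vector.scale_sum_right [symmetric])
  qed
  moreover have "tensor F ` reduced_words F \<subseteq> E"
  proof clarify
    fix w assume w: "w \<in> reduced_words F"
    let ?t = "map index_of w"
    have fin: "\<forall>\<^sub>F K in ?A. finite K \<and> K \<subseteq> J"
      by (rule eventually_finite_subsets_at_top_weakI) simp
    have "\<forall>\<^sub>F K in ?A. {j\<in>J. ?t \<in> D j} \<subseteq> K"
    proof (rule eventually_finite_subsets_at_top [THEN iffD2])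
      have "finite {j\<in>J. ?t \<in> D j}"
      proof (cases "\<exists>a\<in>J. ?t \<in> D a")
        case True
        then obtain a where "a \<in> J" "?t \<in> D a" by blast
        then have "{j\<in>J. ?t \<in> D j} \<subseteq> {a}"
          using disj unfolding disjoint_family_on_def by blast
        then show ?thesis
          by (rule finite_subset) simp
      next
        case False
        then have "{j\<in>J. ?t \<in> D j} = {}" by blast
        then show ?thesis by (simp only: finite.emptyI)
      qed
      then show "\<exists>X. finite X \<and> X \<subseteq> J \<and> (\<forall>Y. finite Y \<and> X \<subseteq> Y \<and> Y \<subseteq> J \<longrightarrow> {j\<in>J. ?t \<in> D j} \<subseteq> Y)"
        by (intro exI [of _ "{j\<in>J. ?t \<in> D j}"]) auto
    qed
    with fin show "tensor F w \<in> E"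
      unfolding E_def mem_Collect_eq
    proof eventually_elim
      case (elim K)
      then have "disjoint_family_on D K"
        using disj disjoint_family_on_mono by blast
      then have "(\<Sum>j\<in>K. type_proj F (D j) (tensor F w)) = type_proj F (\<Union>j\<in>K. D j) (tensor F w)"
        using elim by (intro sum_type_proj [OF F]) auto
      also have "\<dots> = type_proj F ?U (tensor F w)"
        using elim by (auto simp: type_proj_tensor [OF F w])
      finally show ?case .
    qed
  qed
  ultimately have cspan: "cspan (tensor F ` reduced_words F) \<subseteq> E"
    by (intro complex_vector.span_minimal)
  show ?thesis
    unfolding has_sum_def tendsto_iff
  proof (intro allI impI)
    fix e :: real assume "e > 0"
    have "h \<in> closure (cspan (tensor F ` reduced_words F))"
      using free_product_dense [OF F] by blast
    then obtain g where g: "g \<in> cspan (tensor F ` reduced_words F)" "dist g h < e / 2"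
      using \<open>e > 0\<close> by (meson closure_approachable half_gt_zero)
    have "g \<in> E"
      using g(1) cspan by blast
    have fin: "\<forall>\<^sub>F K in ?A. finite K \<and> K \<subseteq> J"
      by (rule eventually_finite_subsets_at_top_weakI) simp
    show "\<forall>\<^sub>F K in ?A. dist (\<Sum>j\<in>K. type_proj F (D j) h) (type_proj F ?U h) < e"
      using \<open>g \<in> E\<close> [unfolded E_def mem_Collect_eq] fin
    proof eventually_elim
      case (elim K)
      then have K: "disjoint_family_on D K"
        using disj disjoint_family_on_mono by blast
      let ?PK = "type_proj F (\<Union>j\<in>K. D j)"
      have "?PK g = type_proj F ?U g"
        using elim K by (simp add: sum_type_proj [OF F])
      then have "?PK h - type_proj F ?U h = ?PK (h - g) - type_proj F ?U (h - g)"
        by (simp add: bop_diff)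
      then have "norm (?PK h - type_proj F ?U h) \<le> norm (?PK (h - g)) + norm (type_proj F ?U (h - g))"
        by (simp only: norm_triangle_ineq4)
      also have "\<dots> \<le> norm (h - g) + norm (h - g)"
        by (intro add_mono type_proj_norm_le F)
      also have "\<dots> < e"
        using g(2) by (simp add: dist_norm norm_minus_commute)
      finally show ?case
        using elim K by (simp add: sum_type_proj [OF F] dist_norm)
    qed
  qed
qed

text \<open>A projection that commutes with X turns each block p X p into X p; only the projections
  remain to be summed.\<close>

lemma strong_sum_blocks:
  assumes F: "is_free_product F" and disj: "disjoint_family_on (summand_types i) J"
    and comm: "\<And>j. j \<in> J \<Longrightarrow> type_proj F (summand_types i j) * X = X * type_proj F (summand_types i j)"
  shows "strong_sum (block F i X) J = X * type_proj F (\<Union>j\<in>J. summand_types i j)"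
proof -
  have block: "block F i X j h = X (type_proj F (summand_types i j) h)" if "j \<in> J" for j h
  proof -
    let ?p = "type_proj F (summand_types i j)"
    have "block F i X j = ?p * X * ?p"
      by (simp add: block_def summand_eq type_proj_def)
    also have "\<dots> = X * ?p"
      using comm [OF that] type_proj_mult [OF F, of "summand_types i j" "summand_types i j"]
      by (metis Int_absorb mult.assoc)
    finally show ?thesis
      by (simp add: bop_rep)
  qed
  have "(\<Sum>\<^sub>\<infinity>j\<in>J. block F i X j h) = X (type_proj F (\<Union>j\<in>J. summand_types i j) h)" for h
  proof -
    have "((\<lambda>j. X (type_proj F (summand_types i j) h)) has_sum
        X (type_proj F (\<Union>j\<in>J. summand_types i j) h)) J"
      using has_sum_bounded_linear [OF bop_bounded_linear [of X] has_sum_type_proj [OF F disj, of h]]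
      by (simp add: comp_def)
    then have "(\<Sum>\<^sub>\<infinity>j\<in>J. X (type_proj F (summand_types i j) h)) = X (type_proj F (\<Union>j\<in>J. summand_types i j) h)"
      by (rule infsumI)
    then show ?thesis
      using infsum_cong [of J "\<lambda>j. block F i X j h" "\<lambda>j. X (type_proj F (summand_types i j) h)"] block
      by simp
  qed
  then show ?thesis
    unfolding strong_sum_def by (simp add: bop_apply_inverse flip: times_bop.rep_eq)
qed

lemma summand_types_lambda1_commute:
  assumes F: "is_free_product F" and "n \<ge> 1"
  shows "type_proj F (summand_types I1 n) * lambda1 F a = lambda1 F a * type_proj F (summand_types I1 n)"
proof (rule type_proj_lambda1_commute [OF F])
  fix t :: "index list" assume t: "t = [] \<or> hd t \<noteq> I1"
  show "t \<in> summand_types I1 n \<longleftrightarrow> I1 # t \<in> summand_types I1 n"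
  proof (cases t)
    case Nil
    then show ?thesis using assms(2) by (auto simp: summand_types_def)
  next
    case (Cons i s)
    then have "i = I2"
      using t by (cases i) auto
    then show ?thesis
      using Cons assms(2) by (auto simp: summand_types_def)
  qed
qed

lemma summand_types_lambda2_commute:
  assumes F: "is_free_product F" and "n \<ge> 1"
  shows "type_proj F (summand_types I2 n) * lambda2 F a = lambda2 F a * type_proj F (summand_types I2 n)"
proof -
  have "map other t \<in> summand_types I1 n \<longleftrightarrow> t \<in> summand_types I2 n" for t
    by (cases t; cases "hd t") (auto simp: summand_types_def)
  then have "{t. map other t \<in> summand_types I1 n} = summand_types I2 n"
    by blast
  then show ?thesis
    using summand_types_lambda1_commute [OF is_free_product_swap [OF F] assms(2), of a]
    by (simp add: type_proj_swap [OF F] lambda2_swap)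
qed

text \<open>Indices alternate, so first index and parity determine the last one. This converts the
  parity of summands into a condition on the last letter.\<close>

lemma last_alternating:
  "distinct_adj t \<Longrightarrow> t \<noteq> [] \<Longrightarrow> last t = (if odd (length t) then hd t else other (hd t))"
proof (induction t)
  case (Cons i t)
  show ?case
  proof (cases "t = []")
    case False
    then have "hd t = other i"
      using Cons.prems by (simp add: distinct_adj_Cons) (metis neq_iff_eq_other other_other)
    then show ?thesis
      using Cons False by (simp add: distinct_adj_Cons)
  qed simp
qed simp

definition ends_in_2 :: "index list set"
  where "ends_in_2 = {t. t \<noteq> [] \<and> last t = I2}"

text \<open>A nonempty type of even length n can only occur in the summand n + 1, and then starts
  with \<open>I1\<close>; one of odd length n only in the summand n, and then starts with
  \<open>I2\<close>. In both cases it ends with \<open>I2\<close>. The empty type occurs in the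
  summand 1.\<close>

lemma s_free_types_odd:
  assumes "distinct_adj t"
  shows "t \<in> (\<Union>j\<in>{j. odd j}. summand_types I2 j) \<longleftrightarrow> t \<in> insert [] ends_in_2"
proof (cases "t = []")
  case True
  then show ?thesis
    by (auto simp: summand_types_def intro!: exI [of _ "1::nat"])
next
  case False
  have "(\<exists>j. odd j \<and> t \<in> summand_types I2 j) \<longleftrightarrow> (if even (length t) then hd t = I1 else hd t = I2)"
  proof (cases "even (length t)")
    case True
    have "\<exists>j. odd j \<and> t \<in> summand_types I2 j" if "hd t = I1"
      using that True by (intro exI [of _ "Suc (length t)"]) (simp add: summand_types_def)
    moreover have "\<not> (\<exists>j. odd j \<and> t \<in> summand_types I2 j)" if "hd t = I2"
      using that True False by (auto simp: summand_types_def)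
    ultimately show ?thesis
      using True by (cases "hd t") auto
  next
    case odd: False
    have "\<exists>j. odd j \<and> t \<in> summand_types I2 j" if "hd t = I2"
      using that odd by (intro exI [of _ "length t"]) (simp add: summand_types_def)
    moreover have "\<not> (\<exists>j. odd j \<and> t \<in> summand_types I2 j)" if "hd t = I1"
      using that odd False by (auto simp: summand_types_def odd_pos)
    ultimately show ?thesis
      using odd by (cases "hd t") auto
  qed
  then show ?thesis
    using last_alternating [OF assms False] False
    by (cases "hd t") (auto simp: ends_in_2_def)
qed

text \<open>The same condition on nonempty types as for the odd summands of index \<open>I2\<close>,
  but the empty type would need the odd index 1. This missing vacuum is what the extra vacuum
  projection in \<open>R1_even\<close> restores.\<close>

lemma s_free_types_even:
  assumes "distinct_adj t"
  shows "t \<in> (\<Union>j\<in>{j. even j \<and> j \<ge> 1}. summand_types I1 j) \<longleftrightarrow> t \<in> ends_in_2"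
proof (cases "t = []")
  case True
  then show ?thesis
    by (auto simp: summand_types_def ends_in_2_def)
next
  case False
  have "(\<exists>j. even j \<and> j \<ge> 1 \<and> t \<in> summand_types I1 j) \<longleftrightarrow> (if even (length t) then hd t = I1 else hd t = I2)"
  proof (cases "even (length t)")
    case True
    have "\<exists>j. even j \<and> j \<ge> 1 \<and> t \<in> summand_types I1 j" if "hd t = I1"
      using that True False by (intro exI [of _ "length t"]) (simp add: summand_types_def Suc_le_eq)
    moreover have "\<not> (\<exists>j. even j \<and> j \<ge> 1 \<and> t \<in> summand_types I1 j)" if "hd t = I2"
      using that True False by (auto simp: summand_types_def)
    ultimately show ?thesis
      using True by (cases "hd t") auto
  next
    case odd: False
    have "\<exists>j. even j \<and> j \<ge> 1 \<and> t \<in> summand_types I1 j" if "hd t = I2"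
      using that odd by (intro exI [of _ "Suc (length t)"]) (simp add: summand_types_def)
    moreover have "\<not> (\<exists>j. even j \<and> j \<ge> 1 \<and> t \<in> summand_types I1 j)" if "hd t = I1"
      using that odd False by (auto simp: summand_types_def)
    ultimately show ?thesis
      using odd by (cases "hd t") auto
  qed
  then show ?thesis
    using last_alternating [OF assms False] False
    by (cases "hd t") (auto simp: ends_in_2_def)
qed

lemma disjoint_summand_types: "disjoint_family_on (summand_types i) {j. odd j}"
  "disjoint_family_on (summand_types i) {j. even j \<and> j \<ge> 1}"
proof -
  have "m = n" if "t \<in> summand_types i m" "t \<in> summand_types i n" "m \<ge> 1" "n \<ge> 1" "even m = even n"
    for t m n
    using that unfolding summand_types_def by (auto; presburger)
  then show "disjoint_family_on (summand_types i) {j. odd j}"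
    "disjoint_family_on (summand_types i) {j. even j \<and> j \<ge> 1}"
    unfolding disjoint_family_on_def by (fastforce simp: odd_pos Suc_le_eq)+
qed

lemma R2_odd_eq:
  assumes F: "is_free_product F"
  shows "R2_odd F (lambda2 F a) = lambda2 F a * type_proj F (insert [] ends_in_2)"
proof -
  have "R2_odd F (lambda2 F a) = lambda2 F a * type_proj F (\<Union>j\<in>{j. odd j}. summand_types I2 j)"
    unfolding R2_odd_def
    by (intro strong_sum_blocks [OF F] disjoint_summand_types summand_types_lambda2_commute [OF F])
      (auto simp: odd_pos Suc_le_eq)
  also have "type_proj F (\<Union>j\<in>{j. odd j}. summand_types I2 j) = type_proj F (insert [] ends_in_2)"
    by (rule type_proj_cong [OF F s_free_types_odd])
  finally show ?thesis .
qed

lemma bounded_linear_scaleC_left: "bounded_linear (\<lambda>c. c *\<^sub>C (v :: 'a::complex_inner))"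
  by (rule bounded_linear_intro [of _ "norm v"])
    (simp_all add: scaleC_add_left scaleR_scaleC scaleC_scaleC norm_scaleC scaleC_complex_def)

lemma type_proj_Nil:
  assumes F: "is_free_product F"
  shows "type_proj F {[]} h = cinner h (vacuum F) *\<^sub>C vacuum F"
proof -
  let ?E = "{h. type_proj F {[]} h = cinner h (vacuum F) *\<^sub>C vacuum F}"
  have "closure (cspan (tensor F ` reduced_words F)) \<subseteq> ?E"
  proof (rule closure_cspan_subset)
    show "tensor F ` reduced_words F \<subseteq> ?E"
    proof clarify
      fix w assume w: "w \<in> reduced_words F"
      show "type_proj F {[]} (tensor F w) = cinner (tensor F w) (vacuum F) *\<^sub>C vacuum F"
        using type_proj_tensor [OF F w, of "{[]}"] tensor_inner [OF F w Nil_reduced]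
        by (auto simp: vacuum_def scaleC_one complex_vector.scale_zero_left)
    qed
    show "csubspace ?E"
      by (auto simp: complex_vector.subspace_def bop_linear_simps cinner_simps scaleC_add_left scaleC_scaleC
          complex_vector.scale_zero_left)
    show "closed ?E"
      by (intro closed_Collect_eq linear_continuous_on bop_bounded_linear
          bounded_linear_compose [OF bounded_linear_scaleC_left bounded_linear_cinner_left])
  qed
  then show ?thesis
    using free_product_dense [OF F] by blast
qed

lemma type_proj_orth:
  assumes F: "is_free_product F" and m: "m \<in> type_space F D"
  shows "cinner (h - type_proj F D h) m = 0"
proof -
  have "cinner (h - type_proj F D h) m = cinner (type_proj F D (h - type_proj F D h)) m"
    using selfadjoint_opD [OF type_proj_selfadjoint [OF F]] type_proj_id [OF F m] by metis
  also have "type_proj F D (h - type_proj F D h) = 0"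
    by (simp add: bop_diff type_proj_id [OF F type_proj_in [OF F]])
  finally show ?thesis by simp
qed

lemma projection_vacuum:
  assumes F: "is_free_product F"
  shows "projection (cspan {vacuum F}) = type_proj F {[]}"
proof (rule projection_eqI)
  show "type_proj F {[]} h \<in> cspan {vacuum F}" for h
    unfolding type_proj_Nil [OF F] by (intro complex_vector.span_scale complex_vector.span_base) simp
  fix h m assume m: "m \<in> cspan {vacuum F}"
  have "vacuum F \<in> type_space F {[]}"
    unfolding vacuum_def by (rule tensor_in_type_space) (simp add: type_words_def)
  then have "cspan {vacuum F} \<subseteq> type_space F {[]}"
    by (intro complex_vector.span_minimal csubspace_type_space) simp
  with m show "cinner (h - type_proj F {[]} h) m = 0"
    by (intro type_proj_orth [OF F]) blast
qed (rule complex_vector.subspace_span)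

lemma R1_even_eq:
  assumes F: "is_free_product F"
  shows "R1_even F (lambda1 F a) = type_proj F {[]} + lambda1 F a * type_proj F ends_in_2"
proof -
  have "strong_sum (block F I1 (lambda1 F a)) {j. even j \<and> j \<ge> 1} =
      lambda1 F a * type_proj F (\<Union>j\<in>{j. even j \<and> j \<ge> 1}. summand_types I1 j)"
    by (intro strong_sum_blocks [OF F] disjoint_summand_types summand_types_lambda1_commute [OF F]) auto
  also have "type_proj F (\<Union>j\<in>{j. even j \<and> j \<ge> 1}. summand_types I1 j) = type_proj F ends_in_2"
    by (rule type_proj_cong [OF F s_free_types_even])
  finally show ?thesis
    by (simp add: R1_even_def projection_vacuum [OF F])
qed

lemma projection_s_free_Fock:
  assumes F: "is_free_product F"
  shows "projection (s_free_Fock F I2) = type_proj F (insert [] ends_in_2)"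
proof -
  have "s_free_Fock F I2 = type_space F (\<Union>j\<in>{j. odd j}. summand_types I2 j)"
    unfolding s_free_Fock_def summand_eq by (rule closure_cspan_UN_type_space)
  then have "projection (s_free_Fock F I2) = type_proj F (\<Union>j\<in>{j. odd j}. summand_types I2 j)"
    by (simp add: type_proj_def)
  also have "\<dots> = type_proj F (insert [] ends_in_2)"
    by (rule type_proj_cong [OF F s_free_types_odd])
  finally show ?thesis .
qed

section \<open>Freeness and s-freeness\<close>

definition starts_in :: "index \<Rightarrow> index list set"
  where "starts_in i = {t. t \<noteq> [] \<and> hd t = i}"

lemma type_space_swap:
  "type_space (swap_product F) D = type_space F {t. map other t \<in> D}"
proof -
  have "tensor (swap_product F) ` type_words (swap_product F) D = tensor F ` type_words F {t. map other t \<in> D}"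
  proof (intro equalityI subsetI)
    fix v assume "v \<in> tensor F ` type_words F {t. map other t \<in> D}"
    then obtain w where w: "w \<in> reduced_words F" "map other (map index_of w) \<in> D" "v = tensor F w"
      by (auto simp: type_words_def)
    then have "map swap_letter w \<in> type_words (swap_product F) D"
      "v = tensor (swap_product F) (map swap_letter w)"
      unfolding type_words_def mem_Collect_eq map_index_of_swap by simp_all
    then show "v \<in> tensor (swap_product F) ` type_words (swap_product F) D" by blast
  next
    fix v assume "v \<in> tensor (swap_product F) ` type_words (swap_product F) D"
    then obtain w where w: "w \<in> reduced_words (swap_product F)" "map index_of w \<in> D"
      "v = tensor F (map swap_letter w)"
      by (auto simp: type_words_def)
    have "map other (map index_of (map swap_letter w)) = map index_of w"
      by (simp add: comp_def)
    with w have "map swap_letter w \<in> type_words F {t. map other t \<in> D}"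
      unfolding type_words_def mem_Collect_eq by (simp del: map_map map_index_of_swap)
    with w(3) show "v \<in> tensor F ` type_words F {t. map other t \<in> D}" by blast
  qed
  then show ?thesis
    by (simp add: type_space_def)
qed

text \<open>A centered \<open>a\<close> moves \<open>vec1 F\<close> into its orthogonal complement,
  so it puts a genuine new letter in front of every word that does not start in the first
  space.\<close>

lemma lambda1_centered:
  assumes F: "is_free_product F" and a: "cinner (bop_apply a (vec1 F)) (vec1 F) = 0"
    and h: "h \<in> type_space F (insert [] (starts_in I2))"
  shows "lambda1 F a h \<in> type_space F (starts_in I1)"
proof (rule bop_closure_cspan_into)
  show "h \<in> closure (cspan (tensor F ` type_words F (insert [] (starts_in I2))))"
    using h by (simp add: type_space_def)
  fix v assume "v \<in> tensor F ` type_words F (insert [] (starts_in I2))"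
  then obtain w where w': "w \<in> type_words F (insert [] (starts_in I2))" "v = tensor F w"
    by blast
  have w: "w \<in> words_avoiding F I1" "v = tensor F w"
    using w' by (auto simp: type_words_def starts_in_def words_avoiding_def hd_map)
  have "lambda1 F a v = prepend1 F (a (vec1 F)) w"
    using lambda1_prepend1 [OF F w(1), of a "vec1 F"] by (simp add: prepend1_vec1 [OF F w(1)] w(2))
  also have "\<dots> = tensor F (Inl (a (vec1 F)) # w)"
    by (rule prepend1_perp [OF a])
  also have "\<dots> \<in> type_space F (starts_in I1)"
    by (rule tensor_in_type_space)
      (simp add: type_words_def starts_in_def Cons_Inl_reduced a w(1))
  finally show "lambda1 F a v \<in> type_space F (starts_in I1)" .
qed (simp_all add: csubspace_type_space closed_type_space)

lemma lambda2_centered: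
  assumes F: "is_free_product F" and a: "cinner (bop_apply a (vec2 F)) (vec2 F) = 0"
    and h: "h \<in> type_space F (insert [] (starts_in I1))"
  shows "lambda2 F a h \<in> type_space F (starts_in I2)"
proof -
  have 1: "map other t \<in> starts_in i \<longleftrightarrow> t \<in> starts_in (other i)" for t i
    by (cases t; cases i; cases "hd t") (auto simp: starts_in_def)
  have "{t. map other t \<in> insert [] (starts_in I2)} = insert [] (starts_in I1)"
    "{t. map other t \<in> starts_in I1} = starts_in I2"
    by (auto simp: 1)
  then show ?thesis
    using lambda1_centered [OF is_free_product_swap [OF F], of a h] a h
    by (simp add: lambda2_swap type_space_swap)
qed

lemma type_space_vacuum_orth:
  assumes F: "is_free_product F" and "h \<in> type_space F D" "[] \<notin> D"
  shows "cinner h (vacuum F) = 0"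
proof -
  have "type_space F D \<subseteq> {h. cinner h (vacuum F) = 0}"
    unfolding type_space_def
  proof (intro closure_cspan_subset csubspace_cinner_eq_zero closed_cinner_eq_zero, clarify)
    fix w assume "w \<in> type_words F D"
    then have "w \<in> reduced_words F" "map index_of w \<noteq> map index_of []"
      using assms(3) by (auto simp: type_words_def)
    then show "cinner (tensor F w) (vacuum F) = 0"
      unfolding vacuum_def by (intro tensor_inner_types [OF F]) simp_all
  qed
  then show ?thesis
    using assms(2) by blast
qed

lemma vacuum_in_type_space: "[] \<in> D \<Longrightarrow> vacuum F \<in> type_space F D"
  unfolding vacuum_def by (rule tensor_in_type_space) (simp add: type_words_def)

text \<open>Common core of freeness and s-freeness: read from the right, each centered factor leads
  from the vacuum or from the words of the other kind to the words of its own kind.\<close>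

lemma alternating_product_in:
  fixes ps :: "(bool \<times> 'a::complex_inner bop) list"
  assumes step: "\<And>i a h. (i, a) \<in> set ps \<Longrightarrow> h = \<xi> \<or> h \<in> N (\<not> i) \<Longrightarrow> bop_apply a h \<in> N i"
    and "ps \<noteq> []" "distinct_adj (map fst ps)"
  shows "bop_apply (prod_list (map snd ps)) \<xi> \<in> N (fst (hd ps))"
  using assms
proof (induction ps)
  case (Cons p ps)
  obtain i a where p: "p = (i, a)" by (cases p)
  have "prod_list (map snd ps) \<xi> = \<xi> \<or> prod_list (map snd ps) \<xi> \<in> N (\<not> i)"
  proof (cases "ps = []")
    case True
    then show ?thesis by (simp add: bop_rep)
  next
    case False
    then have "fst (hd ps) = (\<not> i)" "distinct_adj (map fst ps)"
      using Cons.prems(3) by (auto simp: p distinct_adj_Cons hd_map)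
    moreover have "bop_apply (prod_list (map snd ps)) \<xi> \<in> N (fst (hd ps))"
      using Cons.prems(1) False calculation(2) by (intro Cons.IH) auto
    ultimately show ?thesis by simp
  qed
  then show ?case
    using Cons.prems(1) [of i a "prod_list (map snd ps) \<xi>"] by (simp add: p bop_rep)
qed simp

lemma lambda1_vacuum_state:
  assumes F: "is_free_product F"
  shows "vector_state (vacuum F) (lambda1 F a) = cinner (a (vec1 F)) (vec1 F)"
  using lambda1_prepend1 [OF F Nil_avoiding, of a "vec1 F"]
    prepend1_inner [OF F Nil_avoiding Nil_avoiding, of "a (vec1 F)" "vec1 F"]
    prepend1_vec1 [OF F Nil_avoiding]
  by (simp add: vector_state_def vacuum_def vacuum_inner [OF F])

lemma vacuum_swap [simp]: "vacuum (swap_product F) = vacuum F"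
  by (simp add: vacuum_def)

lemma lambda2_vacuum_state:
  assumes F: "is_free_product F"
  shows "vector_state (vacuum F) (lambda2 F a) = cinner (a (vec2 F)) (vec2 F)"
  using lambda1_vacuum_state [OF is_free_product_swap [OF F], of a] by (simp add: lambda2_swap)

lemma lambda2_hom:
  assumes F: "is_free_product F"
  shows lambda2_mult: "lambda2 F (a * b) = lambda2 F a * lambda2 F b"
    and lambda2_add: "lambda2 F (a + b) = lambda2 F a + lambda2 F b"
    and lambda2_scaleC: "lambda2 F (c *\<^sub>C a) = c *\<^sub>C lambda2 F a"
    and lambda2_one: "lambda2 F 1 = 1"
    and lambda2_diff: "lambda2 F (a - b) = lambda2 F a - lambda2 F b"
  using is_free_product_swap [OF F]
  by (simp_all add: lambda2_swap lambda1_mult lambda1_add lambda1_scaleC lambda1_one lambda1_diff)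

text \<open>The flag \<open>True\<close> stands for the second factor, because the first generator
  of the free algebra will be evaluated at \<open>X2\<close>.\<close>

lemma lambda_alternating_vanish:
  assumes F: "is_free_product F"
    and ps: "ps \<noteq> []" "distinct_adj (map fst ps)"
    and elements: "\<And>i a. (i, a) \<in> set ps \<Longrightarrow>
      a \<in> (if i then range (lambda2 F) else range (lambda1 F)) \<and> vector_state (vacuum F) a = 0"
  shows "vector_state (vacuum F) (prod_list (map snd ps)) = 0"
proof -
  define N where "N i = type_space F (starts_in (if i then I2 else I1))" for i
  have "prod_list (map snd ps) (vacuum F) \<in> N (fst (hd ps))"
  proof (rule alternating_product_in [OF _ ps])
    fix i a h assume ia: "(i, a) \<in> set ps" and h: "h = vacuum F \<or> h \<in> N (\<not> i)"
    show "a h \<in> N i"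
    proof (cases i)
      case True
      then obtain b where b: "a = lambda2 F b"
        using elements [OF ia] by auto
      have "h \<in> type_space F (insert [] (starts_in I1))"
        using h True type_space_mono [of "starts_in I1" "insert [] (starts_in I1)" F]
        by (auto simp: N_def vacuum_in_type_space)
      then show ?thesis
        using lambda2_centered [OF F] elements [OF ia] True
        by (simp add: b N_def lambda2_vacuum_state [OF F])
    next
      case False
      then obtain b where b: "a = lambda1 F b"
        using elements [OF ia] by auto
      have "h \<in> type_space F (insert [] (starts_in I2))"
        using h False type_space_mono [of "starts_in I2" "insert [] (starts_in I2)" F]
        by (auto simp: N_def vacuum_in_type_space)
      then show ?thesis
        using lambda1_centered [OF F] elements [OF ia] False
        by (simp add: b N_def lambda1_vacuum_state [OF F])
    qed
  qed
  then show ?thesis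
    unfolding vector_state_def N_def by (rule type_space_vacuum_orth [OF F]) (simp add: starts_in_def)
qed

subsection \<open>Evaluation of noncommutative polynomials\<close>

definition nc_eval :: "(index \<Rightarrow> 'a::complex_inner bop) \<Rightarrow> ncpoly \<Rightarrow> 'a bop"
  where "nc_eval T p = (\<Sum>m\<in>Poly_Mapping.keys p. Poly_Mapping.lookup p m *\<^sub>C prod_list (map T (letters m)))"

lemma nc_eval_superset:
  assumes "finite S" "Poly_Mapping.keys p \<subseteq> S"
  shows "nc_eval T p = (\<Sum>m\<in>S. Poly_Mapping.lookup p m *\<^sub>C prod_list (map T (letters m)))"
  unfolding nc_eval_def using assms
  by (intro sum.mono_neutral_left) (auto simp: in_keys_iff complex_vector.scale_zero_left)

lemma nc_eval_add: "nc_eval T (p + q) = nc_eval T p + nc_eval T q"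
proof -
  let ?S = "Poly_Mapping.keys p \<union> Poly_Mapping.keys q"
  have "Poly_Mapping.keys (p + q) \<subseteq> ?S"
    by (rule keys_add)
  then show ?thesis
    using nc_eval_superset [of ?S "p + q" T] nc_eval_superset [of ?S p T] nc_eval_superset [of ?S q T]
    by (simp add: lookup_add scaleC_add_left sum.distrib)
qed

lemma nc_eval_scaleC: "nc_eval T (c *\<^sub>C p) = c *\<^sub>C nc_eval T p"
proof -
  have "Poly_Mapping.keys (c *\<^sub>C p) \<subseteq> Poly_Mapping.keys p"
    by (auto simp: in_keys_iff scaleC_poly_mapping.rep_eq complex_vector.scale_zero_right)
  then have "nc_eval T (c *\<^sub>C p) =
      (\<Sum>m\<in>Poly_Mapping.keys p. (c * Poly_Mapping.lookup p m) *\<^sub>C prod_list (map T (letters m)))"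
    by (subst nc_eval_superset [of "Poly_Mapping.keys p"])
      (simp_all add: scaleC_poly_mapping.rep_eq scaleC_complex_def)
  then show ?thesis
    by (simp add: nc_eval_def complex_vector.scale_sum_right scaleC_scaleC)
qed

lemma nc_eval_single: "nc_eval T (Poly_Mapping.single m c) = c *\<^sub>C prod_list (map T (letters m))"
  by (subst nc_eval_superset [of "{m}"]) (auto split: if_splits)

lemma ncpoly_induct [case_names zero single add]:
  fixes p :: ncpoly
  assumes "P 0" "\<And>m c. P (Poly_Mapping.single m c)" "\<And>p q. P p \<Longrightarrow> P q \<Longrightarrow> P (p + q)"
  shows "P p"
proof (induction p rule: update_induct)
  case (update f a b)
  have "Poly_Mapping.update a b f = f + Poly_Mapping.single a b"
    using update(1)
    by (intro poly_mapping_eqI) (auto simp: lookup_update lookup_add lookup_single in_keys_iff when_def)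
  then show ?case
    using assms update by simp
qed (use assms in simp)

lemma nc_eval_zero: "nc_eval T 0 = 0"
  by (simp add: nc_eval_def)

lemma nc_eval_mult: "nc_eval T (p * q) = nc_eval T p * nc_eval T q"
proof (induction p rule: ncpoly_induct)
  case (single m c)
  show ?case
  proof (induction q rule: ncpoly_induct)
    case (single n d)
    show ?case
      by (simp add: mult_single nc_eval_single plus_monomial_def scaleC_mult_bop scaleC_scaleC mult.commute)
  qed (simp_all add: nc_eval_zero nc_eval_add distrib_left)
qed (simp_all add: nc_eval_zero nc_eval_add distrib_right)

lemma nc_eval_one: "nc_eval T 1 = 1"
proof -
  have one: "(1 :: ncpoly) = Poly_Mapping.single (Monomial []) 1"
    by (simp flip: single_one add: zero_monomial_def)
  show ?thesis
    unfolding one nc_eval_single by (simp add: scaleC_one)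
qed

lemma nc_eval_variable: "nc_eval T (variable i) = T i"
  by (simp add: variable_def nc_eval_single scaleC_one)

lemma nc_eval_power: "nc_eval T (p ^ n) = nc_eval T p ^ n"
  by (induction n) (simp_all add: nc_eval_one nc_eval_mult)

lemma nc_eval_prod_list: "nc_eval T (prod_list ps) = prod_list (map (nc_eval T) ps)"
  by (induction ps) (simp_all add: nc_eval_one nc_eval_mult)

lemma scaleC_mult_ncpoly:
  fixes p q :: ncpoly
  shows "(c *\<^sub>C p) * q = c *\<^sub>C (p * q)" and "p * (c *\<^sub>C q) = c *\<^sub>C (p * q)"
proof -
  have const: "c *\<^sub>C p = Poly_Mapping.single 0 c * p" "c *\<^sub>C p = p * Poly_Mapping.single 0 c" for p :: ncpoly
  proof (induction p rule: ncpoly_induct)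
    case (single m d)
    have "c *\<^sub>C Poly_Mapping.single m d = Poly_Mapping.single m (c * d)"
      by (intro poly_mapping_eqI)
        (simp add: scaleC_poly_mapping.rep_eq lookup_single when_def scaleC_complex_def)
    then show "c *\<^sub>C Poly_Mapping.single m d = Poly_Mapping.single 0 c * Poly_Mapping.single m d"
      "c *\<^sub>C Poly_Mapping.single m d = Poly_Mapping.single m d * Poly_Mapping.single 0 c"
      by (simp_all add: mult_single mult.commute)
  qed (simp_all add: complex_vector.scale_zero_right scaleC_add_right distrib_left distrib_right)
  show "(c *\<^sub>C p) * q = c *\<^sub>C (p * q)"
    by (simp add: const(1) mult.assoc)
  show "p * (c *\<^sub>C q) = c *\<^sub>C (p * q)"
    by (simp add: const(2) mult.assoc)
qed

subsection \<open>Free pairs have determined joint moments\<close>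

lemma alg_one_subset_span_powers:
  fixes v :: ncpoly
  shows "alg {1, v} \<subseteq> cspan (range (\<lambda>n. v ^ n))"
proof (rule alg_subset)
  let ?A = "cspan (range (\<lambda>n. v ^ n))"
  have pow: "v ^ k * c \<in> ?A" if "c \<in> ?A" for k c
    using that
  proof (induction rule: complex_vector.span_induct_alt)
    case (step r b c)
    then obtain n where "b = v ^ n" by blast
    then have "v ^ k * (r *\<^sub>C b + c) = r *\<^sub>C v ^ (k + n) + v ^ k * c"
      by (simp add: distrib_left scaleC_mult_ncpoly power_add)
    moreover have "r *\<^sub>C v ^ (k + n) \<in> ?A"
      by (intro complex_vector.span_scale complex_vector.span_base rangeI)
    ultimately show ?case
      using step by (simp add: complex_vector.span_add)
  qed (simp add: complex_vector.span_zero)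
  have "b * c \<in> ?A" if "b \<in> ?A" "c \<in> ?A" for b c
    using that(1)
  proof (induction rule: complex_vector.span_induct_alt)
    case (step r b' b)
    then obtain n where "b' = v ^ n" by blast
    then have "(r *\<^sub>C b' + b) * c = r *\<^sub>C (v ^ n * c) + b * c"
      by (simp add: distrib_right scaleC_mult_ncpoly)
    then show ?case
      using step pow that(2) by (auto intro!: complex_vector.span_add complex_vector.span_scale)
  qed (simp add: complex_vector.span_zero)
  then show "csubalgebra ?A"
    by (simp add: csubalgebra_def)
  have "v ^ 0 \<in> ?A" "v ^ 1 \<in> ?A"
    by (intro complex_vector.span_base rangeI)+
  then show "{1, v} \<subseteq> ?A" by simp
qed

lemma not_distinct_adj_split:
  "\<not> distinct_adj (map fst ps) \<Longrightarrow> \<exists>us i a b vs. ps = us @ (i, a) # (i, b) # vs"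
proof (induction ps)
  case (Cons p ps)
  show ?case
  proof (cases "distinct_adj (map fst ps)")
    case True
    then obtain q qs where q: "ps = q # qs" "fst p = fst q"
      using Cons.prems by (cases ps) (auto simp: distinct_adj_Cons)
    then have "p # ps = [] @ (fst p, snd p) # (fst p, snd q) # qs"
      by (cases p; cases q) simp
    then show ?thesis by blast
  next
    case False
    then obtain us i a b vs where "ps = us @ (i, a) # (i, b) # vs"
      using Cons.IH by blast
    then have "p # ps = (p # us) @ (i, a) # (i, b) # vs"
      by simp
    then show ?thesis by blast
  qed
qed simp

text \<open>Two functionals with the same marginals for which \<open>a\<close> and \<open>b\<close>
  are free. Their agreement on products from the two algebras shows that the description
  \<open>free_mult_conv\<close> has at most one solution.\<close>

locale two_free_functionals =
  fixes \<Phi> \<Phi>' :: "ncpoly \<Rightarrow> complex" and a b :: ncpoly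
  assumes lin: "Vector_Spaces.linear (*\<^sub>C) (*) \<Phi>" and lin': "Vector_Spaces.linear (*\<^sub>C) (*) \<Phi>'"
    and free: "free_pair \<Phi> a b" and free': "free_pair \<Phi>' a b"
    and unit: "\<Phi> 1 = 1"
    and mom_a: "\<And>n. \<Phi> (a ^ n) = \<Phi>' (a ^ n)" and mom_b: "\<And>n. \<Phi> (b ^ n) = \<Phi>' (b ^ n)"
begin

definition B :: "bool \<Rightarrow> ncpoly set" where "B i = alg {1, if i then a else b}"

lemma linear_simps:
  "\<Phi> (p + q) = \<Phi> p + \<Phi> q" "\<Phi> (c *\<^sub>C p) = c * \<Phi> p"
  "\<Phi>' (p + q) = \<Phi>' p + \<Phi>' q" "\<Phi>' (c *\<^sub>C p) = c * \<Phi>' p"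
  using lin lin' unfolding Vector_Spaces.linear_iff by blast+

lemma B_eq: "c \<in> B i \<Longrightarrow> \<Phi> c = \<Phi>' c"
proof -
  assume "c \<in> B i"
  then have "c \<in> cspan (range (\<lambda>n. (if i then a else b) ^ n))"
    unfolding B_def using alg_one_subset_span_powers by blast
  then show ?thesis
  proof (induction rule: complex_vector.span_induct_alt)
    case base
    show ?case using linear_simps(2) [of 0 0] linear_simps(4) [of 0 0] by simp
  next
    case (step r d e)
    then have "\<Phi> d = \<Phi>' d"
      using mom_a mom_b by (auto split: if_splits)
    then show ?case
      using step by (simp add: linear_simps)
  qed
qed

lemma B_algebra: "1 \<in> B i" "c \<in> B i \<Longrightarrow> d \<in> B i \<Longrightarrow> c * d \<in> B i"
  "c \<in> B i \<Longrightarrow> d \<in> B i \<Longrightarrow> c - r *\<^sub>C d \<in> B i"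
proof -
  note alg = csubalgebra_alg [of "{1, if i then a else b}"] alg_superset [of "{1, if i then a else b}"]
  show "1 \<in> B i" "c \<in> B i \<Longrightarrow> d \<in> B i \<Longrightarrow> c * d \<in> B i"
    using alg unfolding B_def csubalgebra_def by blast+
  have "csubspace (B i)"
    using alg unfolding B_def csubalgebra_def by blast
  then show "c \<in> B i \<Longrightarrow> d \<in> B i \<Longrightarrow> c - r *\<^sub>C d \<in> B i"
    by (intro complex_vector.subspace_diff complex_vector.subspace_scale)
qed

lemma vanish:
  assumes "ps \<noteq> []" "distinct_adj (map fst ps)" "\<forall>(i, c)\<in>set ps. c \<in> B i \<and> \<Phi> c = 0"
  shows "\<Phi> (prod_list (map snd ps)) = 0" "\<Phi>' (prod_list (map snd ps)) = 0"
proof -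
  have "\<forall>(i, c)\<in>set ps. c \<in> (if i then {c \<in> alg {1, a}. \<Phi> c = 0} else {c \<in> alg {1, b}. \<Phi> c = 0})"
    using assms(3) by (auto simp: B_def split: if_splits)
  then show "\<Phi> (prod_list (map snd ps)) = 0"
    using free assms(1,2) unfolding free_pair_def alternating_products_vanish_def by blast
  have "\<forall>(i, c)\<in>set ps. c \<in> (if i then {c \<in> alg {1, a}. \<Phi>' c = 0} else {c \<in> alg {1, b}. \<Phi>' c = 0})"
  proof clarify
    fix i c assume "(i, c) \<in> set ps"
    then have "c \<in> B i" "\<Phi>' c = 0"
      using assms(3) B_eq by auto
    then show "c \<in> (if i then {c \<in> alg {1, a}. \<Phi>' c = 0} else {c \<in> alg {1, b}. \<Phi>' c = 0})"
      by (simp add: B_def split: if_splits)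
  qed
  then show "\<Phi>' (prod_list (map snd ps)) = 0"
    using free' assms(1,2) unfolding free_pair_def alternating_products_vanish_def by blast
qed

text \<open>Centering the entries of an alternating product from left to right leaves products with
  fewer factors.\<close>

lemma agree: "\<forall>(i, c)\<in>set ps. c \<in> B i \<Longrightarrow> \<Phi> (prod_list (map snd ps)) = \<Phi>' (prod_list (map snd ps))"
proof (induction "length ps" arbitrary: ps rule: less_induct)
  case less
  show ?case
  proof (cases "distinct_adj (map fst ps)")
    case False
    then obtain us i c d vs where ps: "ps = us @ (i, c) # (i, d) # vs"
      using not_distinct_adj_split by blast
    have "\<Phi> (prod_list (map snd (us @ (i, c * d) # vs))) = \<Phi>' (prod_list (map snd (us @ (i, c * d) # vs)))"
      using less.prems by (intro less.hyps) (auto simp: ps B_algebra)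
    then show ?thesis
      by (simp add: ps mult.assoc)
  next
    case True
    have "\<Phi> (prod_list (map snd (us @ vs))) = \<Phi>' (prod_list (map snd (us @ vs)))"
      if "\<forall>(i, c)\<in>set us. c \<in> B i \<and> \<Phi> c = 0" "\<forall>(i, c)\<in>set vs. c \<in> B i"
        "distinct_adj (map fst (us @ vs))" "length (us @ vs) = length ps" for us vs
      using that
    proof (induction vs arbitrary: us)
      case Nil
      show ?case
      proof (cases "us = []")
        case True
        then show ?thesis
          using mom_a [of 0] by simp
      next
        case False
        then show ?thesis
          using vanish [of us] Nil by simp
      qed
    next
      case (Cons p vs)
      obtain i c where p: "p = (i, c)" by (cases p)
      define c0 where "c0 = c - \<Phi> c *\<^sub>C 1"
      define r where "r = \<Phi> c"
      have c: "c \<in> B i"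
        using Cons.prems(2) by (simp add: p)
      have c0: "c0 \<in> B i" "\<Phi> c0 = 0"
        using c B_algebra(1) linear_simps(1) [of c0 "\<Phi> c *\<^sub>C 1"]
        by (simp_all add: c0_def B_algebra(3) linear_simps(2) unit)
      have split: "prod_list (map snd (us @ p # vs)) =
          prod_list (map snd ((us @ [(i, c0)]) @ vs)) + r *\<^sub>C prod_list (map snd (us @ vs))"
        by (simp add: p c0_def r_def distrib_left distrib_right left_diff_distrib right_diff_distrib
            scaleC_mult_ncpoly mult.assoc)
      have "\<Phi> (prod_list (map snd ((us @ [(i, c0)]) @ vs))) = \<Phi>' (prod_list (map snd ((us @ [(i, c0)]) @ vs)))"
        using Cons.prems c0 by (intro Cons.IH) (auto simp: p)
      moreover have "\<Phi> (prod_list (map snd (us @ vs))) = \<Phi>' (prod_list (map snd (us @ vs)))"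
        using Cons.prems by (intro less.hyps) auto
      ultimately show ?case
        unfolding split linear_simps by simp
    qed
    from this [of "[]" ps] True less.prems show ?thesis
      by simp
  qed
qed

end

section \<open>Free multiplicative convolution and the moments of \<open>W\<close>\<close>

lemma csubalgebraI:
  assumes "0 \<in> A" "\<And>a b. a \<in> A \<Longrightarrow> b \<in> A \<Longrightarrow> a + b \<in> A"
    and "\<And>c a. a \<in> A \<Longrightarrow> c *\<^sub>C a \<in> A" "\<And>a b. a \<in> A \<Longrightarrow> b \<in> A \<Longrightarrow> a * b \<in> A"
  shows "csubalgebra A"
  using assms by (simp add: csubalgebra_def complex_vector.subspace_def)

lemma swap_swap_product [simp]: "swap_product (swap_product F) = F"
  by (simp add: swap_product_def)

lemma has_distribution_unit:
  assumes "has_distribution \<omega> a \<mu>"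
  shows "\<omega> 1 = 1"
proof -
  interpret real_distribution \<mu>
    using assms by (simp add: has_distribution_def prob_real_iff_real_distribution)
  have "\<omega> (a ^ 0) = complex_of_real (\<integral>t. t ^ 0 \<partial>\<mu>)"
    using assms unfolding has_distribution_def distribution_def by metis
  then show ?thesis
    using prob_space by simp
qed

lemma has_distribution_moment: "has_distribution \<omega> a \<mu> \<Longrightarrow> \<omega> (a ^ n) = complex_of_real (\<integral>t. t ^ n \<partial>\<mu>)"
  unfolding has_distribution_def distribution_def by metis

definition models_free_product :: "(ncpoly \<Rightarrow> complex) \<Rightarrow> real measure \<Rightarrow> real measure \<Rightarrow> real measure \<Rightarrow> bool"
  where "models_free_product \<Phi> \<mu> \<nu> \<rho> \<longleftrightarrow> Vector_Spaces.linear (*\<^sub>C) (*) \<Phi> \<and>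
       has_distribution \<Phi> (variable I1) \<mu> \<and> has_distribution \<Phi> (variable I2) \<nu> \<and>
       free_pair \<Phi> (variable I1) (variable I2) \<and>
       has_distribution \<Phi> (variable I1 * variable I2) \<rho>"

lemma models_free_product_unique:
  assumes 1: "models_free_product \<Phi> \<mu> \<nu> \<rho>" and 2: "models_free_product \<Phi>' \<mu> \<nu> \<rho>'"
  shows "\<rho> = \<rho>'"
proof -
  note 1 = 1 [unfolded models_free_product_def] and 2 = 2 [unfolded models_free_product_def]
  let ?a = "variable I1" and ?b = "variable I2"
  interpret two_free_functionals \<Phi> \<Phi>' ?a ?b
  proof (rule two_free_functionals.intro)
    show "\<Phi> (?a ^ n) = \<Phi>' (?a ^ n)" "\<Phi> (?b ^ n) = \<Phi>' (?b ^ n)" for n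
      using 1 2 by (simp_all add: has_distribution_moment [of _ _ \<mu>] has_distribution_moment [of _ _ \<nu>])
    show "\<Phi> 1 = 1"
      using 1 has_distribution_unit by blast
  qed (use 1 2 in blast)+
  have gens: "?a \<in> B True" "?b \<in> B False"
    using alg_superset [of "{1, ?a}"] alg_superset [of "{1, ?b}"] by (auto simp: B_def)
  have "\<Phi> ((?a * ?b) ^ n) = \<Phi>' ((?a * ?b) ^ n)" for n
  proof -
    let ?ps = "concat (replicate n [(True, ?a), (False, ?b)])"
    have "prod_list (map snd ?ps) = (?a * ?b) ^ n"
      by (induction n) (simp_all add: mult.assoc)
    moreover have "\<forall>(i, c)\<in>set ?ps. c \<in> B i"
      using gens by (auto simp: set_concat)
    ultimately show ?thesis
      using agree [of ?ps] by simp
  qed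
  then show ?thesis
    using 1 2 by (intro has_distribution_unique [of \<Phi> "?a * ?b" \<rho> \<Phi>' "?a * ?b" \<rho>'])
      (auto simp: distribution_def)
qed

lemma free_mult_conv_eqI:
  assumes "models_free_product \<Phi> \<mu> \<nu> \<rho>" "nonneg_support \<rho>"
  shows "free_mult_conv \<mu> \<nu> = \<rho>"
  unfolding free_mult_conv_def models_free_product_def [symmetric]
  using assms models_free_product_unique by (intro the_equality) blast+

lemma prod_list_eq_nc_eval: "prod_list (map snd (map (\<lambda>(i, c). (i, nc_eval T c)) ps)) = nc_eval T (prod_list (map snd ps))"
  by (simp add: nc_eval_prod_list comp_def case_prod_beta)

context free_product_pair
begin

definition W :: "'h bop" where "W = sqrt_op X1 * X2 * sqrt_op X1"

lemma W_pos: "positive_op W"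
  unfolding W_def by (intro positive_op_conjugate selfadjoint_sqrt_op X1_pos X2_pos)

text \<open>The first generator becomes \<open>X2\<close>, matching the order of factors in \<mu>2
  \<boxtimes> \<mu>1.\<close>

definition \<Phi> :: "ncpoly \<Rightarrow> complex"
  where "\<Phi> p = vector_state vac (nc_eval (\<lambda>i. case i of I1 \<Rightarrow> X2 | I2 \<Rightarrow> X1) p)"

lemma \<Phi>_linear: "Vector_Spaces.linear (*\<^sub>C) (*) \<Phi>"
  unfolding Vector_Spaces.linear_iff
proof (intro conjI allI)
  show "vector_space ((*\<^sub>C) :: complex \<Rightarrow> ncpoly \<Rightarrow> ncpoly)"
    by (rule complex_vector.vector_space_axioms)
  show "vector_space ((*) :: complex \<Rightarrow> complex \<Rightarrow> complex)"
    by unfold_locales (simp_all add: algebra_simps)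
qed (simp_all add: \<Phi>_def nc_eval_add nc_eval_scaleC vector_state_def bop_rep cinner_simps)

lemma \<Phi>_distribution:
  "distribution \<Phi> p = distribution (vector_state vac) (nc_eval (\<lambda>i. case i of I1 \<Rightarrow> X2 | I2 \<Rightarrow> X1) p)"
  by (simp add: distribution_def \<Phi>_def nc_eval_power)

lemma csubalgebra_vimage_range_lambda1:
  "csubalgebra {c. nc_eval T c \<in> range (lambda1 F)}"
proof (rule csubalgebraI; clarsimp simp: nc_eval_zero nc_eval_add nc_eval_scaleC nc_eval_mult)
  show "0 \<in> range (lambda1 F)"
    using lambda1_diff [OF F, of 0 0] by (metis diff_self rangeI)
qed (metis lambda1_add [OF F] lambda1_scaleC [OF F] lambda1_mult [OF F] rangeI)+

lemma \<Phi>_free: "free_pair \<Phi> (variable I1) (variable I2)"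
proof -
  let ?T = "\<lambda>i. case i of I1 \<Rightarrow> X2 | I2 \<Rightarrow> X1"
  interpret swap: free_product_pair "swap_product F" y0 x X2 X1
    using F X1 X2 X1_pos X2_pos
    by unfold_locales (simp_all add: is_free_product_swap lambda2_swap)
  have "alg {1, variable I1} \<subseteq> {c. nc_eval ?T c \<in> range (lambda1 (swap_product F))}"
    by (rule alg_subset [OF swap.csubalgebra_vimage_range_lambda1])
      (use lambda1_one [OF swap.F, symmetric] swap.X1 in \<open>auto simp: nc_eval_one nc_eval_variable\<close>)
  then have 1: "nc_eval ?T c \<in> range (lambda2 F)" if "c \<in> alg {1, variable I1}" for c
    using that by (auto simp: lambda2_swap [abs_def])
  have "alg {1, variable I2} \<subseteq> {c. nc_eval ?T c \<in> range (lambda1 F)}"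
    by (rule alg_subset [OF csubalgebra_vimage_range_lambda1])
      (use lambda1_one [OF F, symmetric] X1 in \<open>auto simp: nc_eval_one nc_eval_variable\<close>)
  then have 2: "nc_eval ?T c \<in> range (lambda1 F)" if "c \<in> alg {1, variable I2}" for c
    using that by blast
  show ?thesis
    unfolding free_pair_def alternating_products_vanish_def
  proof (intro allI impI, elim conjE)
    fix ps :: "(bool \<times> ncpoly) list"
    assume ps: "ps \<noteq> []" "distinct_adj (map fst ps)"
      "\<forall>(i, a)\<in>set ps. a \<in> (if i then {c \<in> alg {1, variable I1}. \<Phi> c = 0} else {c \<in> alg {1, variable I2}. \<Phi> c = 0})"
    let ?qs = "map (\<lambda>(i, c). (i, nc_eval ?T c)) ps"
    have "vector_state (vacuum F) (prod_list (map snd ?qs)) = 0"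
    proof (rule lambda_alternating_vanish [OF F])
      show "?qs \<noteq> []" "distinct_adj (map fst ?qs)"
        using ps(1,2) by (simp_all add: comp_def case_prod_beta)
      fix i a assume "(i, a) \<in> set ?qs"
      then obtain c where c: "(i, c) \<in> set ps" "a = nc_eval ?T c" by auto
      then have "c \<in> (if i then {c \<in> alg {1, variable I1}. \<Phi> c = 0} else {c \<in> alg {1, variable I2}. \<Phi> c = 0})"
        using ps(3) by blast
      then show "a \<in> (if i then range (lambda2 F) else range (lambda1 F)) \<and> vector_state (vacuum F) a = 0"
        using 1 2 by (auto simp: c(2) \<Phi>_def vac_def split: if_splits)
    qed
    then show "\<Phi> (prod_list (map snd ps)) = 0"
      unfolding prod_list_eq_nc_eval by (simp add: \<Phi>_def vac_def)
  qed
qed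

text \<open>On the vacuum, left multiplication by \<open>\<surd>X\<^sub>1\<close> agrees with right multiplication, and the latter
  commutes with \<open>X\<^sub>1\<close> and \<open>X\<^sub>2\<close>.\<close>

lemma trace_sqrt_X1:
  assumes A: "A \<in> alg {1, X1, X2, sqrt_op X1}"
  shows "vector_state vac (sqrt_op X1 * A) = vector_state vac (A * sqrt_op X1)"
proof -
  define c where "c = sqrt_op x"
  have x: "positive_op x"
    using X1_pos by (simp add: X1 lambda1_positive_iff [OF F])
  have sqrtX1: "sqrt_op X1 = lambda1 F c"
    by (simp add: X1 c_def lambda1_sqrt [OF F x])
  have cx: "x * c = c * x"
    unfolding c_def by (rule sqrt_op_commute [OF x]) simp
  let ?R = "rho1 F c"
  have R_vac: "?R vac = sqrt_op X1 vac"
  proof -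
    have "vac = append1 F (vec1 F) []" "vac = prepend1 F (vec1 F) []"
      by (simp_all add: vac_def vacuum_def append1_vec1 [OF F] prepend1_vec1 [OF F])
    then show ?thesis
      using rho1_append1 [OF F Nil_ends_avoiding, of c "vec1 F"] lambda1_prepend1 [OF F Nil_avoiding, of c "vec1 F"]
      by (simp add: sqrtX1 prepend1_Nil_eq_append1)
  qed
  have R_sa: "cinner (?R u) v = cinner u (?R v)" for u v
    using lambda1_selfadjoint [OF is_free_product_rev [OF F] selfadjoint_sqrt_op [OF x]]
    by (simp add: c_def selfadjoint_op_def)
  have S_sa: "cinner (sqrt_op X1 u) v = cinner u (sqrt_op X1 v)" for u v
    using selfadjoint_sqrt_op [OF X1_pos] by (simp add: selfadjoint_op_def)
  have "X1 * ?R = ?R * X1" "X2 * ?R = ?R * X2" "sqrt_op X1 * ?R = ?R * sqrt_op X1"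
    unfolding sqrtX1 unfolding X1 X2
    by (simp_all add: lambda1_rho1_commute [OF F cx] lambda1_rho1_commute [OF F] lambda2_rho1_commute [OF F])
  then have "alg {1, X1, X2, sqrt_op X1} \<subseteq> {b. b * ?R = ?R * b}"
    by (intro alg_subset csubalgebra_commutant) auto
  then have comm: "A (?R v) = ?R (A v)" for v
    using A by (metis (mono_tags, lifting) mem_Collect_eq subsetD times_bop.rep_eq)
  have "cinner (sqrt_op X1 (A vac)) vac = cinner (A vac) (?R vac)"
    by (simp add: S_sa R_vac)
  also have "\<dots> = cinner (A (?R vac)) vac"
    by (simp add: comm R_sa)
  finally show ?thesis
    by (simp add: vector_state_def bop_rep R_vac)
qed

lemma W_power: "W ^ Suc n = sqrt_op X1 * ((X2 * X1) ^ n * X2 * sqrt_op X1)"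
proof (induction n)
  case (Suc n)
  have "W ^ Suc (Suc n) = (sqrt_op X1 * X2 * sqrt_op X1) * (sqrt_op X1 * ((X2 * X1) ^ n * X2 * sqrt_op X1))"
    using Suc by (simp add: W_def)
  also have "\<dots> = sqrt_op X1 * (X2 * (sqrt_op X1 * sqrt_op X1) * ((X2 * X1) ^ n * X2 * sqrt_op X1))"
    by (simp add: mult.assoc)
  finally show ?case
    by (simp add: sqrt_op_square [OF X1_pos] mult.assoc)
qed (simp add: W_def mult.assoc)

lemma generators_alg: "(X2 * X1) ^ n * X2 \<in> alg {1, X1, X2, sqrt_op X1}"
  "(X2 * X1) ^ n * X2 * sqrt_op X1 \<in> alg {1, X1, X2, sqrt_op X1}"
  "sqrt_op X1 * ((X2 * X1) ^ n * X2) \<in> alg {1, X1, X2, sqrt_op X1}"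
proof -
  let ?A = "alg {1, X1, X2, sqrt_op X1}"
  have gens: "1 \<in> ?A" "X1 \<in> ?A" "X2 \<in> ?A" "sqrt_op X1 \<in> ?A"
    using alg_superset [of "{1, X1, X2, sqrt_op X1}"] by auto
  have mult: "p * q \<in> ?A" if "p \<in> ?A" "q \<in> ?A" for p q
    using that csubalgebra_alg [of "{1, X1, X2, sqrt_op X1}"] by (auto simp: csubalgebra_def)
  have "(X2 * X1) ^ n \<in> ?A"
    by (induction n) (simp_all add: gens mult)
  then show "(X2 * X1) ^ n * X2 \<in> ?A" "(X2 * X1) ^ n * X2 * sqrt_op X1 \<in> ?A"
    "sqrt_op X1 * ((X2 * X1) ^ n * X2) \<in> ?A"
    by (simp_all add: gens mult)
qed

text \<open>The first identity links \<open>W\<close> to the free convolution. The second makes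
  \<open>W\<close> and its counterpart with the factors exchanged equidistributed, so that both
  subordination equations concern one measure.\<close>

lemma distribution_W: "distribution (vector_state vac) W = distribution (vector_state vac) (X2 * X1)"
  and distribution_W': "distribution (vector_state vac) W = distribution (vector_state vac) (X1 * X2)"
proof -
  have "vector_state vac (W ^ n) = vector_state vac ((X2 * X1) ^ n) \<and>
      vector_state vac (W ^ n) = vector_state vac ((X1 * X2) ^ n)" for n
  proof (cases n)
    case (Suc m)
    let ?S = "sqrt_op X1" and ?B = "(X2 * X1) ^ m * X2"
    have "vector_state vac (W ^ n) = vector_state vac (?B * ?S * ?S)"
      unfolding Suc W_power by (rule trace_sqrt_X1) (rule generators_alg)
    also have "?B * ?S * ?S = ?B * (?S * ?S)"
      by (simp only: mult.assoc)
    also have "?B * (?S * ?S) = (X2 * X1) ^ n"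
      unfolding sqrt_op_square [OF X1_pos] Suc by (simp add: power_Suc2 mult.assoc del: power_Suc)
    finally have 1: "vector_state vac (W ^ n) = vector_state vac ((X2 * X1) ^ n)" .
    have "vector_state vac (W ^ n) = vector_state vac ((?S * ?B) * ?S)"
      unfolding Suc W_power by (simp add: mult.assoc)
    also have "\<dots> = vector_state vac (?S * (?S * ?B))"
      by (rule trace_sqrt_X1 [symmetric]) (rule generators_alg)
    also have "?S * (?S * ?B) = X1 * ?B"
      by (simp add: sqrt_op_square [OF X1_pos] flip: mult.assoc)
    also have "X1 * ?B = (X1 * X2) ^ n"
    proof -
      have "X1 * (X2 * X1) ^ m = (X1 * X2) ^ m * X1" for m
        by (induction m) (simp_all add: mult.assoc)
      then show ?thesis
        unfolding Suc power_Suc2 by (simp flip: mult.assoc)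
    qed
    finally show ?thesis
      using 1 by simp
  qed simp
  note * = this
  show "distribution (vector_state vac) W = distribution (vector_state vac) (X2 * X1)"
    "distribution (vector_state vac) W = distribution (vector_state vac) (X1 * X2)"
    unfolding distribution_def by (intro ext, use * in blast)+
qed

lemma free_mult_conv_W:
  assumes "has_distribution (vector_state vac) X1 \<mu>1" "has_distribution (vector_state vac) X2 \<mu>2"
    and "has_distribution (vector_state vac) W \<rho>" "nonneg_support \<rho>"
  shows "free_mult_conv \<mu>2 \<mu>1 = \<rho>"
proof (rule free_mult_conv_eqI)
  show "models_free_product \<Phi> \<mu>2 \<mu>1 \<rho>"
    unfolding models_free_product_def
    using assms \<Phi>_linear \<Phi>_free distribution_W
    by (simp add: has_distribution_def \<Phi>_distribution nc_eval_variable nc_eval_mult)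
qed (rule assms)

subsection \<open>s-freeness\<close>

definition Q :: "'h bop" where "Q = type_proj F (insert [] ends_in_2)"

definition E :: "'h bop" where "E = type_proj F ends_in_2"

lemma Q_eq: "Q = type_proj F {[]} + E"
  using type_proj_add [OF F, of "{[]}" ends_in_2] by (simp add: Q_def E_def ends_in_2_def)

lemma Q_idem: "Q * Q = Q" and E_idem: "E * E = E" and QE: "Q * E = E" "E * Q = E"
proof -
  have "insert [] ends_in_2 \<inter> ends_in_2 = ends_in_2" "ends_in_2 \<inter> insert [] ends_in_2 = ends_in_2"
    by auto
  then show "Q * Q = Q" "E * E = E" "Q * E = E" "E * Q = E"
    by (simp_all add: Q_def E_def type_proj_mult [OF F])
qed

lemma E_lambda1: "E * lambda1 F a = lambda1 F a * E"
  unfolding E_def by (rule type_proj_lambda1_commute [OF F]) (auto simp: ends_in_2_def)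

lemma Q_lambda2: "Q * lambda2 F a = lambda2 F a * Q"
proof -
  let ?D = "{t. map other t \<in> insert [] ends_in_2}"
  have "type_proj (swap_product F) ?D = Q"
  proof -
    have "{t. map other t \<in> ?D} = insert [] ends_in_2"
      by (auto simp: comp_def)
    then show ?thesis
      unfolding Q_def type_proj_swap [OF F] by (simp only:)
  qed
  moreover have "type_proj (swap_product F) ?D * lambda1 (swap_product F) a =
      lambda1 (swap_product F) a * type_proj (swap_product F) ?D"
    by (rule type_proj_lambda1_commute [OF is_free_product_swap [OF F]]) (auto simp: ends_in_2_def last_map)
  ultimately show ?thesis
    by (simp add: lambda2_swap)
qed

lemma Nil_proj_vac: "type_proj F {[]} v = cinner v vac *\<^sub>C vac"
  by (simp add: type_proj_Nil [OF F] vac_def)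

lemma E_vac: "E vac = 0"
  using type_proj_tensor [OF F Nil_reduced, of ends_in_2] by (simp add: E_def vac_def vacuum_def ends_in_2_def)

lemma Q_vac: "Q vac = vac"
  using type_proj_tensor [OF F Nil_reduced, of "insert [] ends_in_2"] by (simp add: Q_def vac_def vacuum_def)

lemma R2_eq: "R2_odd F X2 = X2 * Q"
  by (simp add: X2 R2_odd_eq [OF F] Q_def)

text \<open>Inside the range of \<open>Q\<close> the first level consists of the vacuum alone, since
  \<open>[I1]\<close> does not end in \<open>I2\<close>. Hence \<open>z\<close> is the identity on
  the vacuum and \<open>X1\<close> on the rest, which is \<open>R1\<close>.\<close>

lemma R1_eq: "R1_even F X1 = Q * z"
proof -
  have QP: "Q * P = type_proj F {[]}"
  proof -
    have "insert [] ends_in_2 \<inter> first_level = {[]}"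
      by (auto simp: ends_in_2_def)
    then show ?thesis
      unfolding Q_def P_def type_proj_mult [OF F] by (simp only:)
  qed
  have E: "(1 - P) * Q = E" "Q * (1 - P) = E"
  proof -
    have "- first_level \<inter> insert [] ends_in_2 = ends_in_2" "insert [] ends_in_2 \<inter> - first_level = ends_in_2"
      by (auto simp: ends_in_2_def)
    then show "(1 - P) * Q = E" "Q * (1 - P) = E"
      by (simp_all add: Q_def P_def E_def type_proj_Compl [OF F] type_proj_mult [OF F])
  qed
  have "Q * (X1 * (1 - P)) = Q * (1 - P) * X1"
    by (simp add: P_Compl(4) mult.assoc)
  also have "\<dots> = X1 * E"
    unfolding E(2) by (simp add: X1 E_lambda1)
  finally have "Q * z = type_proj F {[]} + X1 * E"
    by (simp add: z_def distrib_left QP)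
  moreover have "R1_even F X1 = type_proj F {[]} + X1 * E"
    by (simp add: X1 R1_even_eq [OF F] E_def)
  ultimately show ?thesis by simp
qed

text \<open>The product Q z equals the self-adjoint operator \<open>R1\<close>, hence also its own
  adjoint z Q.\<close>

lemma Q_z: "Q * z = z * Q"
proof -
  have sa: "selfadjoint_op (Q * z)"
  proof -
    have "selfadjoint_op (type_proj F {[]} + X1 * E)"
      using type_proj_selfadjoint [OF F] positive_op_selfadjoint [OF X1_pos] E_lambda1 [of x]
      by (intro selfadjoint_op_intros) (simp_all add: E_def X1)
    then show ?thesis
      using R1_eq R1_even_eq [OF F, of x] by (simp add: X1 E_def)
  qed
  have "cinner ((Q * z) u) v = cinner ((z * Q) u) v" for u v
  proof -
    have "cinner ((Q * z) u) v = cinner u (Q (z v))"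
      using selfadjoint_opD [OF sa, of u v] by (simp add: bop_rep)
    also have "\<dots> = cinner (z (Q u)) v"
      using positive_op_selfadjoint [OF z_pos] type_proj_selfadjoint [OF F]
      by (simp add: selfadjoint_op_def Q_def)
    finally show ?thesis
      by (simp add: bop_rep)
  qed
  then show ?thesis
    by (intro bop_eqI tensor_eqI [OF F])
qed

lemma sqrt_R1: "sqrt_op (R1_even F X1) = Q * sqrt_op z"
  using sqrt_op_mult [OF _ z_pos Q_z] type_proj_positive [OF F] sqrt_type_proj [OF F]
  by (simp add: R1_eq Q_def)

text \<open>\<open>Q\<close> fixes the vacuum and commutes with \<surd>z and \<open>X2\<close>, so
  the vacuum never leaves the range of \<open>Q\<close> under powers of \<open>Y\<close>.\<close>

lemma distribution_Y:
  "distribution (vector_state vac) Y =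
    distribution (vector_state vac) (sqrt_op (R1_even F X1) * R2_odd F X2 * sqrt_op (R1_even F X1))"
proof -
  have QS: "Q * sqrt_op z = sqrt_op z * Q"
    by (rule sqrt_op_commute [OF z_pos Q_z])
  have QX2: "Q * X2 = X2 * Q"
    by (simp add: X2 Q_lambda2)
  have Q_S: "Q (sqrt_op z u) = sqrt_op z (Q u)" and Q_X2: "Q (X2 u) = X2 (Q u)" and Q_Q: "Q (Q u) = Q u" for u
    using QS QX2 Q_idem by (metis times_bop.rep_eq)+
  let ?V = "sqrt_op (R1_even F X1) * R2_odd F X2 * sqrt_op (R1_even F X1)"
  have V: "?V u = Y (Q u)" for u
    unfolding sqrt_R1 R2_eq Y_def by (simp add: bop_rep Q_S Q_X2 Q_Q)
  have QY: "Q (Y u) = Y (Q u)" for u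
    unfolding Y_def by (simp add: bop_rep Q_S Q_X2)
  have "(?V ^ n) vac = (Y ^ n) vac \<and> Q ((Y ^ n) vac) = (Y ^ n) vac" for n
    by (induction n) (simp_all add: times_bop.rep_eq [of ?V] times_bop.rep_eq [of Y] V QY one_bop.rep_eq Q_vac)
  then show ?thesis
    by (simp add: distribution_def vector_state_def)
qed

text \<open>The elements of the two algebras are \<open>lambda2 F a * Q\<close> and
  \<open>lambda1 F a * E\<close>. Hence alternating products are handled as for freeness, except
  that a factor of the second kind kills the vacuum.\<close>

lemma s_free_Q:
  assumes k: "cinner k (vec2 F) = 0" "norm k = 1"
  shows "s_free_pair Q (vector_state vac) (vector_state (tensor F [Inr k])) (R2_odd F X2 - Q) (R1_even F X1 - Q)"
proof -
  let ?\<phi> = "vector_state vac" and ?\<psi> = "vector_state (tensor F [Inr k])"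
  let ?A1 = "alg {Q, R2_odd F X2 - Q}" and ?A2 = "alg {E, R1_even F X1 - Q}"
  have A1: "\<exists>a'. a = lambda2 F a' * Q" if "a \<in> ?A1" for a
  proof -
    have "csubalgebra {a. \<exists>a'. a = lambda2 F a' * Q}"
    proof (rule csubalgebraI; unfold mem_Collect_eq)
      show "\<exists>a'. 0 = lambda2 F a' * Q"
        using lambda2_diff [OF F, of 0 0] by (intro exI [of _ 0]) simp
    next
      fix u v assume "\<exists>a'. u = lambda2 F a' * Q" "\<exists>a'. v = lambda2 F a' * Q"
      then obtain a b where ab: "u = lambda2 F a * Q" "v = lambda2 F b * Q" by blast
      then have "u + v = lambda2 F (a + b) * Q"
        by (simp add: lambda2_add [OF F] distrib_right)
      then show "\<exists>a'. u + v = lambda2 F a' * Q" by blast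
      have "u * v = lambda2 F a * (lambda2 F b * Q) * Q"
        unfolding ab by (metis Q_lambda2 mult.assoc)
      then have "u * v = lambda2 F (a * b) * Q"
        by (simp add: lambda2_mult [OF F] mult.assoc Q_idem)
      then show "\<exists>a'. u * v = lambda2 F a' * Q" by blast
    next
      fix r u assume "\<exists>a'. u = lambda2 F a' * Q"
      then obtain a where "u = lambda2 F a * Q" by blast
      then have "r *\<^sub>C u = lambda2 F (r *\<^sub>C a) * Q"
        by (simp add: lambda2_scaleC [OF F] scaleC_mult_bop)
      then show "\<exists>a'. r *\<^sub>C u = lambda2 F a' * Q" by blast
    qed
    moreover have "Q = lambda2 F 1 * Q" "R2_odd F X2 - Q = lambda2 F (y0 - 1) * Q"
      unfolding R2_eq by (simp_all add: lambda2_one [OF F] lambda2_diff [OF F] left_diff_distrib X2)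
    ultimately have "?A1 \<subseteq> {a. \<exists>a'. a = lambda2 F a' * Q}"
      by (intro alg_subset) blast+
    then show ?thesis using that by blast
  qed
  have A2: "\<exists>a'. a = lambda1 F a' * E" if "a \<in> ?A2" for a
  proof -
    have "csubalgebra {a. \<exists>a'. a = lambda1 F a' * E}"
    proof (rule csubalgebraI; unfold mem_Collect_eq)
      show "\<exists>a'. 0 = lambda1 F a' * E"
        using lambda1_diff [OF F, of 0 0] by (intro exI [of _ 0]) simp
    next
      fix u v assume "\<exists>a'. u = lambda1 F a' * E" "\<exists>a'. v = lambda1 F a' * E"
      then obtain a b where ab: "u = lambda1 F a * E" "v = lambda1 F b * E" by blast
      then have "u + v = lambda1 F (a + b) * E"
        by (simp add: lambda1_add [OF F] distrib_right)
      then show "\<exists>a'. u + v = lambda1 F a' * E" by blast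
      have "u * v = lambda1 F a * (lambda1 F b * E) * E"
        unfolding ab by (metis E_lambda1 mult.assoc)
      then have "u * v = lambda1 F (a * b) * E"
        by (simp add: lambda1_mult [OF F] mult.assoc E_idem)
      then show "\<exists>a'. u * v = lambda1 F a' * E" by blast
    next
      fix r u assume "\<exists>a'. u = lambda1 F a' * E"
      then obtain a where "u = lambda1 F a * E" by blast
      then have "r *\<^sub>C u = lambda1 F (r *\<^sub>C a) * E"
        by (simp add: lambda1_scaleC [OF F] scaleC_mult_bop)
      then show "\<exists>a'. r *\<^sub>C u = lambda1 F a' * E" by blast
    qed
    \<comment> \<open>Both \<open>R1\<close> and \<open>Q\<close> contain the vacuum projection;
      subtracting the unit cancels it and puts the second algebra under \<open>E\<close>.\<close>
    moreover have "R1_even F X1 - Q = lambda1 F (x - 1) * E"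
      by (simp add: lambda1_one [OF F] lambda1_diff [OF F] left_diff_distrib Q_eq X1 R1_even_eq [OF F] E_def)
    moreover have "E = lambda1 F 1 * E"
      by (simp add: lambda1_one [OF F])
    ultimately have "?A2 \<subseteq> {a. \<exists>a'. a = lambda1 F a' * E}"
      by (intro alg_subset) blast+
    then show ?thesis using that by blast
  qed
  have cornerQ: "Q * a = a \<and> a * Q = a" if "a \<in> ?A1 \<union> ?A2" for a
    using that
  proof
    assume "a \<in> ?A1"
    then obtain a' where "a = lambda2 F a' * Q" using A1 by blast
    then show ?thesis
      by (metis Q_idem Q_lambda2 mult.assoc)
  next
    assume "a \<in> ?A2"
    then obtain a' where a': "a = lambda1 F a' * E" using A2 by blast
    then have "Q * a = Q * E * lambda1 F a'"
      by (simp add: mult.assoc E_lambda1)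
    then show ?thesis
      using a' by (simp add: QE E_lambda1 mult.assoc)
  qed
  have cornerE: "E * a = a \<and> a * E = a" if a: "a \<in> ?A2" for a
  proof -
    obtain a' where "a = lambda1 F a' * E" using A2 [OF a] by blast
    then show ?thesis
      by (metis E_idem E_lambda1 mult.assoc)
  qed
  have red: "[Inr k] \<in> reduced_words F"
    by (simp add: reduced_words_def k)
  have wa: "[Inr k] \<in> words_avoiding F I1"
    using red by (simp add: words_avoiding_def)
  have zeta: "cinner (tensor F [Inr k]) (tensor F [Inr k]) = 1"
    using tensor_inner [OF F red red] k(2) by (simp add: cinner_self)
  have E_zeta: "E (tensor F [Inr k]) = tensor F [Inr k]"
    using type_proj_tensor [OF F red, of ends_in_2] by (simp add: E_def ends_in_2_def)
  \<comment> \<open>The word \<open>[Inr k]\<close> does not start in the first space, so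
    \<open>lambda1\<close> acts on it as on an invisible \<open>vec1 F\<close>, and \<psi> sees the
    vector state of \<open>vec1 F\<close>.\<close>
  have psi: "?\<psi> (lambda1 F a * E) = cinner (a (vec1 F)) (vec1 F)" for a
    using lambda1_prepend1 [OF F wa, of a "vec1 F"] prepend1_inner [OF F wa wa, of "a (vec1 F)" "vec1 F"]
      prepend1_vec1 [OF F wa]
    by (simp add: vector_state_def bop_rep E_zeta zeta)
  have phi: "?\<phi> (lambda2 F a * Q) = cinner (a (vec2 F)) (vec2 F)" for a
    using lambda2_vacuum_state [OF F, of a] by (simp add: vector_state_def bop_rep Q_vac flip: vac_def)
  \<comment> \<open>A type projection keeps or kills each elementary tensor, so it cannot change the
    first index.\<close>
  have proj_starts: "type_proj F D h \<in> type_space F (starts_in i)" if h: "h \<in> type_space F (starts_in i)" for D i h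
  proof (rule bop_closure_cspan_into)
    show "h \<in> closure (cspan (tensor F ` type_words F (starts_in i)))"
      using h by (simp add: type_space_def)
    fix v assume "v \<in> tensor F ` type_words F (starts_in i)"
    then obtain w where w: "w \<in> type_words F (starts_in i)" "v = tensor F w" by blast
    then show "type_proj F D v \<in> type_space F (starts_in i)"
      using tensor_in_type_space [OF w(1)] complex_vector.subspace_0 [OF csubspace_type_space [of F "starts_in i"]]
      by (simp add: type_proj_tensor [OF F] type_words_def)
  qed (simp_all add: csubspace_type_space closed_type_space)
  have vanish: "alternating_products_vanish ?\<phi> {a \<in> ?A1. ?\<phi> a = 0} {a \<in> ?A2. ?\<psi> a = 0}"
    unfolding alternating_products_vanish_def
  proof (intro allI impI, elim conjE)
    fix ps :: "(bool \<times> 'h bop) list"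
    assume ps: "ps \<noteq> []" "distinct_adj (map fst ps)"
      "\<forall>(i, a)\<in>set ps. a \<in> (if i then {a \<in> ?A1. ?\<phi> a = 0} else {a \<in> ?A2. ?\<psi> a = 0})"
    define N where "N i = type_space F (starts_in (if i then I2 else I1))" for i
    have "prod_list (map snd ps) vac \<in> N (fst (hd ps))"
    proof (rule alternating_product_in [OF _ ps(1,2)])
      fix i a h assume ia: "(i, a) \<in> set ps" and h: "h = vac \<or> h \<in> N (\<not> i)"
      have a: "a \<in> (if i then {a \<in> ?A1. ?\<phi> a = 0} else {a \<in> ?A2. ?\<psi> a = 0})"
        using ps(3) ia by blast
      show "a h \<in> N i"
      proof (cases i)
        case True
        then obtain b where b: "a = lambda2 F b * Q"
          using a A1 by auto
        have "Q h \<in> type_space F (insert [] (starts_in I1))"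
          using h
        proof
          assume "h = vac"
          then show ?thesis
            using vacuum_in_type_space [of "insert [] (starts_in I1)" F] Q_vac by (simp add: vac_def)
        next
          assume "h \<in> N (\<not> i)"
          then have "Q h \<in> type_space F (starts_in I1)"
            using proj_starts True by (simp add: N_def Q_def)
          then show ?thesis
            using type_space_mono by blast
        qed
        then show ?thesis
          using lambda2_centered [OF F] a True phi by (simp add: b N_def bop_rep)
      next
        case False
        then obtain b where b: "a = lambda1 F b * E"
          using a A2 by auto
        have "E h \<in> type_space F (insert [] (starts_in I2))"
          using h
        proof
          assume "h = vac"
          then show ?thesis
            using complex_vector.subspace_0 [OF csubspace_type_space] E_vac by simp
        next
          assume "h \<in> N (\<not> i)"
          then have "E h \<in> type_space F (starts_in I2)"
            using proj_starts False by (simp add: N_def E_def)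
          then show ?thesis
            using type_space_mono by blast
        qed
        then show ?thesis
          using lambda1_centered [OF F] a False psi by (simp add: b N_def bop_rep)
      qed
    qed
    then show "?\<phi> (prod_list (map snd ps)) = 0"
      unfolding vector_state_def N_def vac_def
      by (rule type_space_vacuum_orth [OF F]) (simp add: starts_in_def)
  qed
  \<comment> \<open>In the corner of \<open>Q\<close>, the unit \<open>E\<close> is \<open>Q\<close>
    minus the rank-one vacuum projection, and the latter factorizes the vacuum state.\<close>
  have split: "?\<phi> (w1 * E * w2) = ?\<phi> (w1 * w2) - ?\<phi> w1 * ?\<phi> w2"
    if w: "w1 \<in> alg (?A1 \<union> ?A2)" for w1 w2
  proof -
    have "alg (?A1 \<union> ?A2) \<subseteq> {b. Q * b = b \<and> b * Q = b}"
      using cornerQ by (intro alg_subset csubalgebra_corner) blast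
    then have "w1 * Q = w1"
      using w by blast
    moreover have "E = Q - type_proj F {[]}"
      by (simp add: Q_eq)
    ultimately have "w1 * E * w2 = w1 * w2 - w1 * type_proj F {[]} * w2"
      by (simp add: right_diff_distrib left_diff_distrib)
    moreover have "?\<phi> (w1 * type_proj F {[]} * w2) = ?\<phi> w1 * ?\<phi> w2"
      by (simp add: vector_state_def bop_rep Nil_proj_vac bop_scaleC cinner_simps mult.commute)
    ultimately show ?thesis
      by (simp add: vector_state_def bop_rep cinner_simps)
  qed
  have "Q \<notin> ?A2"
  proof
    assume "Q \<in> ?A2"
    then have "Q * E = Q"
      using cornerE by blast
    then have "vac = 0"
      using Q_vac E_vac by (metis bop_zero times_bop.rep_eq)
    then show False
      using norm_vac by simp
  qed
  moreover have "Q \<in> ?A1" "E \<in> ?A2"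
    by (rule subsetD [OF alg_superset], simp)+
  moreover have "?\<psi> E = 1"
    by (simp add: vector_state_def E_zeta zeta)
  ultimately have "s_free Q ?\<phi> ?\<psi> ?A1 ?A2 E"
    unfolding s_free_def
    by (intro conjI ballI csubalgebra_alg vanish split) (simp_all add: cornerQ cornerE)
  then show ?thesis
    unfolding s_free_pair_def by blast
qed

end

section \<open>Subordination\<close>

definition neumann :: "complex \<Rightarrow> 'a::complex_hilbert bop \<Rightarrow> 'a \<Rightarrow> 'a"
  where "neumann c T u = suminf (\<lambda>n. c ^ n *\<^sub>C bop_apply (T ^ n) u)"

lemma bop_power_norm_le:
  fixes T :: "'a::complex_inner bop"
  assumes T: "\<And>v. norm (T v) \<le> K * norm v" and K: "0 \<le> K"
  shows "norm ((T ^ n) u) \<le> K ^ n * norm u"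
proof (induction n)
  case 0
  show ?case by (simp add: bop_rep)
next
  case (Suc n)
  have "norm (T ((T ^ n) u)) \<le> K * norm ((T ^ n) u)"
    by (rule T)
  also have "\<dots> \<le> K * (K ^ n * norm u)"
    using Suc K by (rule mult_left_mono)
  finally show ?case
    by (simp add: bop_rep)
qed

context
  fixes T :: "'a::complex_hilbert bop" and K :: real and c :: complex
  assumes T: "\<And>v. norm (T v) \<le> K * norm v" and K: "0 \<le> K" and c: "cmod c * K < 1"
begin

lemma neumann_term_le: "norm (c ^ n *\<^sub>C (T ^ n) u) \<le> (cmod c * K) ^ n * norm u"
proof -
  have "cmod c ^ n * norm ((T ^ n) u) \<le> cmod c ^ n * (K ^ n * norm u)"
    using bop_power_norm_le [OF T K] by (intro mult_left_mono) auto
  then show ?thesis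
    by (simp add: norm_scaleC norm_power power_mult_distrib mult.assoc)
qed

lemma neumann_sums: "(\<lambda>n. c ^ n *\<^sub>C (T ^ n) u) sums neumann c T u"
  unfolding neumann_def
proof (rule summable_sums, rule summable_comparison_test')
  show "summable (\<lambda>n. (cmod c * K) ^ n * norm u)"
    using c K by (intro summable_mult2 summable_geometric) simp
  show "norm (c ^ n *\<^sub>C (T ^ n) u) \<le> (cmod c * K) ^ n * norm u" if "n \<ge> 0" for n
    by (rule neumann_term_le)
qed

lemma neumann_fixed_point: "neumann c T u = u + c *\<^sub>C T (neumann c T u)"
proof -
  have "(\<lambda>n. c *\<^sub>C T (c ^ n *\<^sub>C (T ^ n) u)) sums (c *\<^sub>C T (neumann c T u))"
    using bounded_linear.sums [OF bounded_linear_scaleC bounded_linear.sums [OF bop_bounded_linear neumann_sums]] .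
  then have "(\<lambda>n. c ^ Suc n *\<^sub>C (T ^ Suc n) u) sums (c *\<^sub>C T (neumann c T u))"
    by (simp add: bop_scaleC scaleC_scaleC times_bop.rep_eq)
  then have "(\<lambda>n. c ^ n *\<^sub>C (T ^ n) u) sums (c *\<^sub>C T (neumann c T u) + c ^ 0 *\<^sub>C (T ^ 0) u)"
    by (rule sums_Suc)
  then have "neumann c T u = c *\<^sub>C T (neumann c T u) + c ^ 0 *\<^sub>C (T ^ 0) u"
    using neumann_sums sums_unique2 by blast
  then show ?thesis
    by (simp add: one_bop.rep_eq scaleC_one add.commute)
qed

text \<open>Iterating the equation n times leaves the remainder c^n T^n v, which is a term of a
  convergent series and so tends to 0.\<close>

lemma neumann_unique:
  assumes v: "v = u + c *\<^sub>C T v"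
  shows "v = neumann c T u"
proof -
  have partial: "v = (\<Sum>k<n. c ^ k *\<^sub>C (T ^ k) u) + c ^ n *\<^sub>C (T ^ n) v" for n
  proof (induction n)
    case (Suc n)
    have "(T ^ n) v = (T ^ n) u + c *\<^sub>C (T ^ Suc n) v"
    proof -
      have "(T ^ n) v = (T ^ n) (u + c *\<^sub>C T v)"
        using v by simp
      then show ?thesis
        by (simp add: bop_add bop_scaleC power_Suc2 times_bop.rep_eq del: power_Suc)
    qed
    then have "c ^ n *\<^sub>C (T ^ n) v = c ^ n *\<^sub>C (T ^ n) u + c ^ Suc n *\<^sub>C (T ^ Suc n) v"
      by (simp only: scaleC_add_right scaleC_scaleC power_Suc2)
    then show ?case
      using Suc by (simp only: sum.lessThan_Suc) (simp add: add.assoc)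
  qed (simp add: one_bop.rep_eq scaleC_one)
  have "(\<lambda>n. c ^ n *\<^sub>C (T ^ n) v) \<longlonglongrightarrow> 0"
    by (rule summable_LIMSEQ_zero [OF sums_summable [OF neumann_sums]])
  then have "(\<lambda>n. v - c ^ n *\<^sub>C (T ^ n) v) \<longlonglongrightarrow> v - 0"
    by (intro tendsto_diff tendsto_const)
  moreover have "v - c ^ n *\<^sub>C (T ^ n) v = (\<Sum>k<n. c ^ k *\<^sub>C (T ^ k) u)" for n
    using partial [of n] by (simp add: algebra_simps)
  ultimately have "(\<lambda>n. c ^ n *\<^sub>C (T ^ n) u) sums v"
    by (simp add: sums_def)
  then show ?thesis
    using neumann_sums sums_unique2 by blast
qed

lemma neumann_state_sums: "(\<lambda>n. c ^ n * cinner ((T ^ n) u) w) sums cinner (neumann c T u) w"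
  using bounded_linear.sums [OF bounded_linear_cinner_left neumann_sums]
  by (simp add: cinner_scaleC_left)

end

lemma psi_transform_small:
  assumes mu: "prob_real \<mu>" "AE t in \<mu>. \<bar>t\<bar> \<le> r" "0 \<le> r" and z: "r * cmod z \<le> 1 / 2"
  shows "cmod (psi_transform \<mu> z) \<le> 2 * r * cmod z"
proof -
  interpret real_distribution \<mu>
    using mu(1) by (simp add: prob_real_iff_real_distribution)
  have bound: "norm (z * complex_of_real t / (1 - z * complex_of_real t)) \<le> 2 * r * cmod z"
    if "\<bar>t\<bar> \<le> r" for t
  proof -
    have zt: "cmod (z * complex_of_real t) \<le> r * cmod z"
      using mult_right_mono [OF that, of "cmod z"] by (simp add: norm_mult mult.commute)
    \<comment> \<open>The factor 2 in the bound is the reciprocal of this lower bound for the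
      denominator.\<close>
    then have "1 / 2 \<le> cmod (1 - z * complex_of_real t)"
      using z norm_triangle_ineq2 [of 1 "z * complex_of_real t"] by simp
    then have "cmod (z * complex_of_real t) / cmod (1 - z * complex_of_real t) \<le> (r * cmod z) / (1 / 2)"
      using zt mu(3) by (intro frac_le) auto
    then show ?thesis
      by (simp add: norm_divide)
  qed
  have AE: "AE t in \<mu>. norm (z * complex_of_real t / (1 - z * complex_of_real t)) \<le> 2 * r * cmod z"
    using mu(2) by eventually_elim (rule bound)
  have int: "integrable \<mu> (\<lambda>t. z * complex_of_real t / (1 - z * complex_of_real t))"
    by (rule real_distribution_integrable_bounded [OF mu(1) _ AE]) measurable
  have "cmod (psi_transform \<mu> z) \<le> (\<integral>t. norm (z * complex_of_real t / (1 - z * complex_of_real t)) \<partial>\<mu>)"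
    unfolding psi_transform_def by (rule integral_norm_bound)
  also have "\<dots> \<le> (\<integral>t. 2 * r * cmod z \<partial>\<mu>)"
    using int AE by (intro integral_mono_AE) auto
  finally show ?thesis
    by (simp add: prob_space del: space_eq_univ)
qed

lemma compact_support_bound:
  assumes "compact_support \<mu>"
  obtains r where "r > 0" "AE t in \<mu>. \<bar>t\<bar> \<le> r"
proof -
  obtain r where "AE t in \<mu>. \<bar>t\<bar> \<le> r"
    using assms by (auto simp: compact_support_def)
  then have "AE t in \<mu>. \<bar>t\<bar> \<le> \<bar>r\<bar> + 1"
    by eventually_elim simp
  then show thesis
    by (intro that [of "\<bar>r\<bar> + 1"]) auto
qed

text \<open>Expanding one factor T - 1 raises the power of T, so k has to vary in the
  induction.\<close>

lemma has_distribution_shifted_moment: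
  fixes T :: "'a::complex_hilbert bop"
  assumes dist: "has_distribution (vector_state \<xi>) T \<mu>"
  shows "vector_state \<xi> ((T - 1) ^ n * T ^ k) = complex_of_real (\<integral>t. (t - 1) ^ n * t ^ k \<partial>\<mu>)"
proof (induction n arbitrary: k)
  case 0
  then show ?case
    using has_distribution_moment [OF dist] by simp
next
  case (Suc n)
  have mu: "prob_real \<mu>" "compact_support \<mu>"
    using dist by (simp_all add: has_distribution_def)
  have int: "integrable \<mu> (\<lambda>t. (t - 1) ^ n * t ^ k)" for k
    using mu by (rule compact_support_integrable) (intro continuous_intros)
  have "(T - 1) ^ Suc n * T ^ k = (T - 1) ^ n * T ^ Suc k - (T - 1) ^ n * T ^ k"
    by (simp add: power_Suc2 [of "T - 1"] right_diff_distrib left_diff_distrib mult.assoc del: power_Suc)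
      (simp add: power_Suc)
  then have "vector_state \<xi> ((T - 1) ^ Suc n * T ^ k) =
      vector_state \<xi> ((T - 1) ^ n * T ^ Suc k) - vector_state \<xi> ((T - 1) ^ n * T ^ k)"
    by (simp only: vector_state_def minus_bop.rep_eq cinner_diff_left)
  also have "\<dots> = complex_of_real ((\<integral>t. (t - 1) ^ n * t ^ Suc k \<partial>\<mu>) - (\<integral>t. (t - 1) ^ n * t ^ k \<partial>\<mu>))"
    by (simp only: Suc.IH of_real_diff)
  also have "(\<integral>t. (t - 1) ^ n * t ^ Suc k \<partial>\<mu>) - (\<integral>t. (t - 1) ^ n * t ^ k \<partial>\<mu>) =
      (\<integral>t. (t - 1) ^ n * t ^ Suc k - (t - 1) ^ n * t ^ k \<partial>\<mu>)"
    using int [of "Suc k"] int [of k] by (rule Bochner_Integration.integral_diff [symmetric])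
  also have "\<dots> = (\<integral>t. (t - 1) ^ Suc n * t ^ k \<partial>\<mu>)"
    by (intro Bochner_Integration.integral_cong refl) (simp add: algebra_simps)
  finally show ?case .
qed

text \<open>The geometric series for \<open>1 / (1 - p (t - 1))\<close> and
  \<open>(1 + p) / (1 - p (t - 1)) = 1 / (1 - e t)\<close> with \<open>e = p / (1 + p)\<close>.\<close>

lemma cauchy_kernel_transform_shift:
  assumes mu: "prob_real \<mu>" "AE t in \<mu>. \<bar>t\<bar> \<le> r" "0 \<le> r" and p: "(r + 1) * cmod p < 1"
  shows "(\<lambda>n. complex_of_real (\<integral>t. (t - 1) ^ n \<partial>\<mu>) * p ^ n) sums
    (cauchy_kernel_transform \<mu> (p / (1 + p)) / (1 + p))"
proof -
  interpret real_distribution \<mu>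
    using mu(1) by (simp add: prob_real_iff_real_distribution)
  let ?\<nu> = "distr \<mu> borel (\<lambda>t. t - 1)"
  have nu: "prob_real ?\<nu>"
    unfolding prob_real_def by (auto intro!: prob_space_distr)
  have AE: "AE t in ?\<nu>. \<bar>t\<bar> \<le> r + 1"
  proof -
    have "AE t in \<mu>. \<bar>t - 1\<bar> \<le> r + 1"
      using mu(2) by eventually_elim simp
    then show ?thesis
      by (subst AE_distr_iff) simp_all
  qed
  have "0 \<le> r + 1" using mu(3) by simp
  note series = cauchy_kernel_transform_moments [OF nu AE p this]
  have "cmod p < 1"
  proof -
    have "1 * cmod p \<le> (r + 1) * cmod p"
      using mu(3) by (intro mult_right_mono) auto
    then show ?thesis using p by simp
  qed
  then have p1: "1 + p \<noteq> 0"
    by (metis add_eq_0_iff norm_minus_cancel norm_one order_less_irrefl)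
  have "(\<integral>t. t ^ n \<partial>?\<nu>) = (\<integral>t. (t - 1) ^ n \<partial>\<mu>)" for n
    by (rule integral_distr) simp_all
  moreover have "cauchy_kernel_transform ?\<nu> p = cauchy_kernel_transform \<mu> (p / (1 + p)) / (1 + p)"
  proof -
    have "cauchy_kernel_transform ?\<nu> p = (\<integral>t. 1 / (1 - p * complex_of_real (t - 1)) \<partial>\<mu>)"
      unfolding cauchy_kernel_transform_def by (rule integral_distr) simp_all
    also have "\<dots> = (\<integral>t. 1 / (1 - p / (1 + p) * complex_of_real t) / (1 + p) \<partial>\<mu>)"
    proof (intro Bochner_Integration.integral_cong refl)
      fix t
      have "(1 - p / (1 + p) * complex_of_real t) * (1 + p) = 1 - p * complex_of_real (t - 1)"
        using p1 by (simp add: field_simps)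
      then show "1 / (1 - p * complex_of_real (t - 1)) = 1 / (1 - p / (1 + p) * complex_of_real t) / (1 + p)"
        by (simp only: divide_divide_eq_left)
    qed
    also have "\<dots> = (\<integral>t. 1 / (1 - p / (1 + p) * complex_of_real t) \<partial>\<mu>) / (1 + p)"
      by (rule integral_divide_zero)
    finally show ?thesis
      unfolding cauchy_kernel_transform_def .
  qed
  ultimately show ?thesis
    using series(1) by simp
qed

context free_product_pair
begin

text \<open>With s = \<surd>y, d = y - 1 and \<psi> the \<psi>-transform of \<sigma> at \<zeta>, the
  equation (1 - \<zeta> s Y s) v = \<xi> is solved explicitly by v = \<xi> + s t. The compression to
  the first level turns the resolvent of Y into the scalar 1 + \<psi>, so what remains is a
  resolvent of d at \<psi>, an expression in y alone. Its vacuum entry is G of \<mu>1 at \<psi>/(1 +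
  \<psi>), which is \<eta> of \<sigma>.\<close>

lemma cauchy_kernel_transform_W:
  assumes mu1: "has_distribution (vector_state vac) X1 \<mu>1"
    and sigma: "has_distribution (vector_state vac) Y \<sigma>"
    and rho: "has_distribution (vector_state vac) W \<rho>"
  shows "\<exists>\<epsilon>>0. \<forall>z. cmod z < \<epsilon> \<longrightarrow>
    cauchy_kernel_transform \<rho> z = cauchy_kernel_transform \<mu>1 (eta_transform \<sigma> z)"
proof -
  define d where "d = y - 1"
  define s where "s = sqrt_op y"
  have y_dist: "has_distribution (vector_state vac) y \<mu>1"
    using mu1 distribution_y by (simp add: has_distribution_def)
  obtain KY where KY: "KY > 0" "\<And>x. norm (Y x) \<le> KY * norm x"
    by (rule bop_norm_bound [of Y]) blast
  obtain KW where KW: "KW > 0" "\<And>x. norm (W x) \<le> KW * norm x"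
    by (rule bop_norm_bound [of W]) blast
  obtain Kd where Kd: "Kd > 0" "\<And>x. norm (d x) \<le> Kd * norm x"
    by (rule bop_norm_bound [of d]) blast
  have meas: "prob_real \<mu>1" "compact_support \<mu>1" "prob_real \<sigma>" "compact_support \<sigma>"
    "prob_real \<rho>" "compact_support \<rho>"
    using mu1 sigma rho by (simp_all add: has_distribution_def)
  obtain rm where rm: "rm > 0" "AE t in \<mu>1. \<bar>t\<bar> \<le> rm"
    by (rule compact_support_bound [OF meas(2)]) blast
  obtain rs where rs: "rs > 0" "AE t in \<sigma>. \<bar>t\<bar> \<le> rs"
    by (rule compact_support_bound [OF meas(4)]) blast
  obtain rr where rr: "rr > 0" "AE t in \<rho>. \<bar>t\<bar> \<le> rr"
    by (rule compact_support_bound [OF meas(6)]) blast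
  \<comment> \<open>Collects all smallness conditions: the Neumann series of Y and W at \<zeta> and
    of d at \<psi>, the moment series, and the bound 2 \<open>rs\<close> |\<zeta>| for
    |\<psi>|.\<close>
  define C where "C = KY + KW + rr + 2 * rs + 2 * rs * Kd + 2 * rs * (rm + 1)"
  have C: "C > 0"
    unfolding C_def using KY(1) KW(1) rr(1) rs(1) Kd(1) rm(1) by (intro add_pos_pos mult_pos_pos) auto
  have parts: "KY \<le> C" "KW \<le> C" "rr \<le> C" "2 * rs \<le> C" "2 * rs * Kd \<le> C" "2 * rs * (rm + 1) \<le> C"
  proof -
    have "0 < 2 * rs * Kd" "0 < 2 * rs * (rm + 1)"
      using rs(1) Kd(1) rm(1) by (intro mult_pos_pos; simp)+
    then show "KY \<le> C" "KW \<le> C" "rr \<le> C" "2 * rs \<le> C" "2 * rs * Kd \<le> C" "2 * rs * (rm + 1) \<le> C"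
      unfolding C_def using KY(1) KW(1) rr(1) rs(1) by linarith+
  qed
  show ?thesis
  proof (intro exI [of _ "1 / C"] conjI allI impI)
    show "0 < 1 / C" using C by simp
    fix \<zeta> :: complex assume "cmod \<zeta> < 1 / C"
    then have small: "C * cmod \<zeta> < 1"
      using C by (simp add: field_simps)
    have le: "a * cmod \<zeta> < 1" if "a \<le> C" for a
      using mult_right_mono [OF that, of "cmod \<zeta>"] small by simp
    define \<psi> where "\<psi> = psi_transform \<sigma> \<zeta>"
    have psi_bound: "cmod \<psi> \<le> 2 * rs * cmod \<zeta>"
      unfolding \<psi>_def using le [OF parts(4)] rs by (intro psi_transform_small meas) auto
    have psi_Kd: "cmod \<psi> * Kd < 1"
    proof -
      have "cmod \<psi> * Kd \<le> 2 * rs * cmod \<zeta> * Kd"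
        using psi_bound Kd(1) by (intro mult_right_mono) auto
      also have "\<dots> < 1"
        using le [OF parts(5)] by (simp add: mult_ac)
      finally show ?thesis .
    qed
    have psi_rm: "(rm + 1) * cmod \<psi> < 1"
    proof -
      have "(rm + 1) * cmod \<psi> \<le> (rm + 1) * (2 * rs * cmod \<zeta>)"
        using psi_bound rm(1) by (intro mult_left_mono) auto
      also have "\<dots> < 1"
        using le [OF parts(6)] by (simp add: mult_ac)
      finally show ?thesis .
    qed
    have rs_small: "rs * cmod \<zeta> < 1" "rr * cmod \<zeta> < 1"
      using le [of rs] le [OF parts(3)] parts(4) rs(1) by auto
    note sigma_series = cauchy_kernel_transform_moments [OF meas(3) rs(2) rs_small(1) less_imp_le [OF rs(1)]]
    note rho_series = cauchy_kernel_transform_moments(1) [OF meas(5) rr(2) rs_small(2) less_imp_le [OF rr(1)]]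
    have G_sigma: "cauchy_kernel_transform \<sigma> \<zeta> = 1 + \<psi>"
      unfolding \<psi>_def using psi_transform_eq [OF meas(3) sigma_series(2,3)] by simp
    have N: "cmod \<zeta> * KY < 1" "cmod \<zeta> * KW < 1"
      using le [OF parts(1)] le [OF parts(2)] by (simp_all add: mult.commute)
    note nY = neumann_fixed_point [OF KY(2) less_imp_le [OF KY(1)] N(1)]
      and nYs = neumann_sums [OF KY(2) less_imp_le [OF KY(1)] N(1)]
      and nd = neumann_fixed_point [OF Kd(2) less_imp_le [OF Kd(1)] psi_Kd]
      and nds = neumann_sums [OF Kd(2) less_imp_le [OF Kd(1)] psi_Kd]
      and nd_state = neumann_state_sums [OF Kd(2) less_imp_le [OF Kd(1)] psi_Kd]
      and nW = neumann_unique [OF KW(2) less_imp_le [OF KW(1)] N(2)]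
      and nW_state = neumann_state_sums [OF KW(2) less_imp_le [OF KW(1)] N(2)]
    \<comment> \<open>The vector t is sought as \<zeta> Y q with q = (1 - \<zeta> Y)^{-1} g, that
      is, t = q - g. The condition (1 - \<psi> d) g = s \<xi> is what will make s v = q; it also
      puts g into the range of \<open>P\<close>.\<close>
    define g where "g = neumann \<psi> d (s vac)"
    define q where "q = neumann \<zeta> Y g"
    define t where "t = q - g"
    define v where "v = vac + s t"
    have sy: "s * y = y * s"
      unfolding s_def by (rule sqrt_op_commute [OF y_pos, symmetric]) simp
    have ss: "s * s = y"
      unfolding s_def by (rule sqrt_op_square [OF y_pos])
    have s_sa: "cinner (s u) w = cinner u (s w)" for u w
      unfolding s_def using selfadjoint_sqrt_op [OF y_pos] by (simp add: selfadjoint_op_def)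
    have Py: "P * y = y * P"
      using P_y by simp
    then have Ps: "P * s = s * P"
      unfolding s_def by (rule sqrt_op_commute [OF y_pos])
    have dP: "d * P = d" "P * d = d"
      using alg_y_corner [of d] alg_superset [of "{y - 1}"] by (auto simp: d_def)
    have sd: "s * d = d * s"
      using sy by (simp add: d_def right_diff_distrib left_diff_distrib)
    have P_s_vac: "P (s vac) = s vac"
      using Ps P_vac by (metis times_bop.rep_eq)
    have g_eq: "g = s vac + \<psi> *\<^sub>C d g"
      unfolding g_def by (rule nd)
    have Pg: "P g = g"
    proof -
      have "P (\<psi> *\<^sub>C d g) = \<psi> *\<^sub>C d g"
        using dP by (metis bop_scaleC times_bop.rep_eq)
      then show ?thesis
        using g_eq P_s_vac by (metis bop_add)
    qed
    have q_eq: "q = g + \<zeta> *\<^sub>C Y q"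
      unfolding q_def by (rule nY)
    \<comment> \<open>As P g = g, compression replaces each Y^n by its vacuum moment, and the
      moments sum to 1 + \<psi>.\<close>
    have Pq: "P q = (1 + \<psi>) *\<^sub>C g"
    proof -
      have PYP: "P ((Y ^ n) g) = vector_state vac (Y ^ n) *\<^sub>C g" for n
      proof -
        have "Y ^ n * rho1 F c = rho1 F c * Y ^ n" for c
          using rho1_Y by (rule bop_power_commute [symmetric])
        then have "P * Y ^ n * P = vector_state vac (Y ^ n) *\<^sub>C P"
          by (rule compression)
        then show ?thesis
          using Pg by (metis scaleC_bop.rep_eq times_bop.rep_eq)
      qed
      have "(\<lambda>n. P (\<zeta> ^ n *\<^sub>C (Y ^ n) g)) sums P q"
        unfolding q_def by (rule bounded_linear.sums [OF bop_bounded_linear nYs])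
      then have 1: "(\<lambda>n. (vector_state vac (Y ^ n) * \<zeta> ^ n) *\<^sub>C g) sums P q"
        by (simp add: bop_scaleC PYP scaleC_scaleC mult.commute)
      have "(\<lambda>n. vector_state vac (Y ^ n) * \<zeta> ^ n) sums (1 + \<psi>)"
        using sigma_series(1) G_sigma has_distribution_moment [OF sigma] by simp
      then have "(\<lambda>n. (vector_state vac (Y ^ n) * \<zeta> ^ n) *\<^sub>C g) sums ((1 + \<psi>) *\<^sub>C g)"
        by (rule bounded_linear.sums [OF bounded_linear_scaleC_left])
      then show ?thesis
        using 1 sums_unique2 by blast
    qed
    have Pt: "P t = \<psi> *\<^sub>C g"
      by (simp add: t_def bop_diff Pq Pg scaleC_add_left scaleC_one)
    have dt: "d t = \<psi> *\<^sub>C d g"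
      using dP(1) Pt by (metis bop_scaleC times_bop.rep_eq)
    \<comment> \<open>Because d = d P, only the part P t = \<psi> g of t is seen by d; the equation
      for g then closes the system.\<close>
    have "s vac + y t = q"
    proof -
      have "y t = t + d t"
        by (simp add: d_def bop_rep)
      then have "s vac + y t = t + (s vac + \<psi> *\<^sub>C d g)"
        by (simp add: dt)
      also have "\<dots> = q"
        unfolding g_eq [symmetric] by (simp add: t_def)
      finally show ?thesis .
    qed
    then have "s v = q"
      using ss by (metis v_def bop_add times_bop.rep_eq)
    then have "W v = s (Y q)"
      by (simp add: W_def decomposition s_def [symmetric] bop_rep)
    then have "\<zeta> *\<^sub>C W v = s t"
      using q_eq by (metis add_diff_cancel_left' bop_scaleC t_def)
    then have "v = vac + \<zeta> *\<^sub>C W v"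
      by (simp add: v_def)
    then have v: "v = neumann \<zeta> W vac"
      by (rule nW)
    have "cauchy_kernel_transform \<rho> \<zeta> = cinner v vac"
    proof (rule sums_unique2)
      show "(\<lambda>n. \<zeta> ^ n * cinner ((W ^ n) vac) vac) sums cinner v vac"
        unfolding v by (rule nW_state)
      show "(\<lambda>n. \<zeta> ^ n * cinner ((W ^ n) vac) vac) sums cauchy_kernel_transform \<rho> \<zeta>"
        using rho_series has_distribution_moment [OF rho]
        by (simp add: vector_state_def mult.commute)
    qed
    also have "cinner v vac = 1 + \<psi> * cinner g (s vac)"
    proof -
      have "cinner (s t) vac = cinner t (P (s vac))"
        by (simp add: s_sa P_s_vac)
      also have "\<dots> = \<psi> * cinner g (s vac)"
        unfolding P_sa [symmetric] Pt by (simp add: cinner_simps)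
      finally show ?thesis
        by (simp add: v_def cinner_simps vac_inner)
    qed
    also have "1 + \<psi> * cinner g (s vac) = cauchy_kernel_transform \<mu>1 (eta_transform \<sigma> \<zeta>)"
    proof -
      define m where "m n = vector_state vac (d ^ n)" for n
      have m: "m n = complex_of_real (\<integral>t. (t - 1) ^ n \<partial>\<mu>1)" for n
        using has_distribution_shifted_moment [OF y_dist, of n 0] by (simp add: m_def d_def)
      define S where "S = cauchy_kernel_transform \<mu>1 (\<psi> / (1 + \<psi>)) / (1 + \<psi>)"
      have S: "(\<lambda>n. m n * \<psi> ^ n) sums S"
        unfolding m S_def by (rule cauchy_kernel_transform_shift [OF meas(1) rm(2) less_imp_le [OF rm(1)] psi_rm])
      \<comment> \<open>The root s commutes with d, and s^2 = y = 1 + d.\<close>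
      have summand: "cinner ((d ^ n) (s vac)) (s vac) = m (Suc n) + m n" for n
      proof -
        have "s * d ^ n = d ^ n * s"
          using sd by (rule bop_power_commute)
        then have "s * d ^ n * s = d ^ n * y"
          by (simp add: mult.assoc ss)
        also have "\<dots> = d ^ Suc n + d ^ n"
          unfolding power_Suc2 by (simp add: d_def right_diff_distrib)
        finally have "s ((d ^ n) (s vac)) = (d ^ Suc n) vac + (d ^ n) vac"
          by (metis plus_bop.rep_eq times_bop.rep_eq)
        then show ?thesis
          by (simp add: s_sa [symmetric] m_def vector_state_def cinner_simps del: power_Suc)
      qed
      have "(\<lambda>n. \<psi> ^ n * (m (Suc n) + m n)) sums cinner g (s vac)"
        using nd_state [of "s vac" "s vac"] unfolding summand g_def .
      then have "(\<lambda>n. \<psi> * (\<psi> ^ n * (m (Suc n) + m n))) sums (\<psi> * cinner g (s vac))"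
        by (rule sums_mult)
      \<comment> \<open>The shifted series begins at index 1 and so lacks the term m 0 = 1; adding
        it back gives (1 + \<psi>) S.\<close>
      moreover have "(\<lambda>n. \<psi> * (\<psi> ^ n * (m (Suc n) + m n))) sums ((S - 1) + \<psi> * S)"
      proof -
        have "m 0 = 1"
          using vac_inner by (simp add: m_def vector_state_def one_bop.rep_eq)
        then have "(\<lambda>n. m (Suc n) * \<psi> ^ Suc n) sums (S - 1)"
          using S sums_Suc_iff [of "\<lambda>n. m n * \<psi> ^ n" "S - 1"] by simp
        from sums_add [OF this sums_mult [OF S, of \<psi>]] show ?thesis
          by (simp add: algebra_simps)
      qed
      ultimately have "\<psi> * cinner g (s vac) = (S - 1) + \<psi> * S"
        by (rule sums_unique2)
      then have "1 + \<psi> * cinner g (s vac) = (1 + \<psi>) * S"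
        by (simp add: algebra_simps)
      moreover have "1 + \<psi> \<noteq> 0"
      proof
        assume "1 + \<psi> = 0"
        then have "cmod \<psi> = 1"
          by (metis add_eq_0_iff norm_minus_cancel norm_one)
        then show False
          using psi_rm rm(1) by simp
      qed
      ultimately show ?thesis
        by (simp add: S_def eta_transform_def \<psi>_def)
    qed
    finally show "cauchy_kernel_transform \<rho> \<zeta> = cauchy_kernel_transform \<mu>1 (eta_transform \<sigma> \<zeta>)" .
  qed
qed

lemma eta_transform_W:
  assumes mu1: "has_distribution (vector_state vac) X1 \<mu>1" "nonneg_support \<mu>1"
    and sigma: "has_distribution (vector_state vac) Y \<sigma>" "nonneg_support \<sigma>" "\<sigma> \<noteq> delta 0"
    and rho: "has_distribution (vector_state vac) W \<rho>" "nonneg_support \<rho>"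
    and z: "\<zeta> \<notin> \<real>\<^sub>\<ge>\<^sub>0"
  shows "eta_transform \<rho> \<zeta> = eta_transform \<mu>1 (eta_transform \<sigma> \<zeta>)"
proof -
  have meas: "prob_real \<mu>1" "prob_real \<sigma>" "prob_real \<rho>"
    using mu1 sigma rho by (simp_all add: has_distribution_def)
  obtain \<epsilon> where e: "\<epsilon> > 0" "\<And>z. cmod z < \<epsilon> \<Longrightarrow>
      cauchy_kernel_transform \<rho> z = cauchy_kernel_transform \<mu>1 (eta_transform \<sigma> z)"
    using cauchy_kernel_transform_W [OF mu1(1) sigma(1) rho(1)] by blast
  show ?thesis
  proof (rule eta_transform_subordination_extend [OF meas(3) rho(2) meas(1) mu1(2) meas(2) sigma(2,3) e(1) _ z])
    fix z assume z: "z \<notin> \<real>\<^sub>\<ge>\<^sub>0" "cmod z < \<epsilon>"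
    show "eta_transform \<rho> z = eta_transform \<mu>1 (eta_transform \<sigma> z)"
      unfolding eta_transform_eq [OF meas(3) rho(2) z(1)] e(2) [OF z(2)]
        eta_transform_eq [OF meas(1) mu1(2) eta_transform_notin_nonneg_Reals [OF meas(2) sigma(2,3) z(1)]] ..
  qed
qed

section \<open>Degenerate distributions and the law of \<open>Y\<close>\<close>

text \<open>The root of \<open>z\<close> fixes the vacuum. Equality of means will show that the law
  of \<open>Y\<close> is not the point mass at 0.\<close>

lemma state_Y: "vector_state vac Y = vector_state vac X2"
  using selfadjoint_sqrt_op [OF z_pos] sqrt_z_vac
  by (simp add: vector_state_def Y_def bop_rep selfadjoint_op_def)

lemma nonneg_distribution:
  fixes T :: "'h bop"
  assumes "positive_op T" "has_distribution (vector_state vac) T \<mu>"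
  shows "nonneg_support \<mu>"
proof -
  obtain \<nu> where "has_distribution (vector_state vac) T \<nu>" "nonneg_support \<nu>"
    using positive_op_has_distribution [OF assms(1) norm_vac] by blast
  then show ?thesis
    using has_distribution_unique [OF assms(2)] by metis
qed

lemma state_nonzero:
  fixes T :: "'h bop"
  assumes dist: "has_distribution (vector_state vac) T \<mu>" "nonneg_support \<mu>" "\<mu> \<noteq> delta 0"
  shows "vector_state vac T \<noteq> 0"
proof -
  have mu: "prob_real \<mu>" "compact_support \<mu>"
    using dist(1) by (simp_all add: has_distribution_def)
  have "integrable \<mu> (\<lambda>t. t)"
    using mu by (rule compact_support_integrable) (intro continuous_intros)
  then have "0 < (\<integral>t. t \<partial>\<mu>)"
    by (rule not_delta_0_integral_pos [OF mu(1) dist(2,3)]) auto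
  then show ?thesis
    using has_distribution_moment [OF dist(1), of 1] by simp
qed

lemma delta_0_state:
  fixes T :: "'h bop"
  assumes "has_distribution (vector_state vac) T (delta c)"
  shows "vector_state vac T = of_real c"
  using has_distribution_moment [OF assms, of 1] by (simp add: integral_return)

lemma positive_state_zero:
  fixes T :: "'h bop"
  assumes "positive_op T" "vector_state vac T = 0"
  shows "T vac = 0"
  using assms by (intro positive_op_kernel) (simp_all add: vector_state_def)

lemma has_distribution_delta:
  fixes T :: "'h bop"
  assumes "T vac = of_real c *\<^sub>C vac"
  shows "has_distribution (vector_state vac) T (delta c)"
proof -
  have "(T ^ n) vac = of_real (c ^ n) *\<^sub>C vac" for n
    by (induction n) (simp_all add: one_bop.rep_eq times_bop.rep_eq scaleC_one bop_scaleC assms scaleC_scaleC mult.commute)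
  then have "vector_state vac (T ^ n) = complex_of_real (\<integral>t. t ^ n \<partial>delta c)" for n
    by (simp add: vector_state_def cinner_simps vac_inner integral_return)
  moreover have "prob_real (delta c)"
    by (simp add: prob_real_def prob_space_return)
  moreover have "compact_support (delta c)"
    unfolding compact_support_def by (intro exI [of _ "\<bar>c\<bar>"]) (simp add: AE_return)
  ultimately show ?thesis
    by (simp add: has_distribution_def distribution_def)
qed

text \<open>If \<open>X\<^sub>1 \<xi> = 0\<close> then \<open>z\<close> kills the part of \<open>X\<^sub>2 \<xi>\<close> orthogonal to \<open>\<xi>\<close>.\<close>

lemma Y_vac_degenerate:
  assumes X1: "X1 vac = 0"
  shows "Y vac = vector_state vac X2 *\<^sub>C vac"
proof -
  define h where "h = y0 (vec2 F)"
  define r :: "'a + 'b" where "r = Inr (h - cinner h (vec2 F) *\<^sub>C vec2 F)"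
  have S: "is_free_product (swap_product F)"
    by (rule is_free_product_swap [OF F])
  have X2_vac: "X2 vac = vector_state vac X2 *\<^sub>C vac + tensor F [r]"
  proof -
    have "X2 vac = prepend2 F h []"
      using lambda2_prepend2 [OF F Nil_avoiding, of y0 "vec2 F"]
      by (simp add: X2 prepend2_vec2 [OF F] vac_def vacuum_def h_def)
    moreover have "vector_state vac X2 = cinner h (vec2 F)"
      using lambda2_vacuum_state [OF F, of y0] by (simp add: X2 h_def vac_def)
    ultimately show ?thesis
      by (simp add: prepend2_def vac_def vacuum_def r_def)
  qed
  have x: "positive_op x"
    using X1_pos by (simp add: X1 lambda1_positive_iff [OF F] free_product_pair.X1 [OF free_product_pair_axioms])
  have "cinner (x (vec1 F)) (vec1 F) = 0"
    using lambda1_vacuum_state [OF F, of x] X1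
    by (simp add: vector_state_def vac_def free_product_pair.X1 [OF free_product_pair_axioms])
  then have x_vec: "x (vec1 F) = 0"
    using positive_op_kernel [OF x, of "vec1 F"] by simp
  have red: "[r] \<in> reduced_words F"
    using vec1_perp_inner [OF S, of h] by (simp add: reduced_words_def r_def vec1_perp_def)
  have wa: "[r] \<in> words_avoiding F I1"
    using red by (simp add: words_avoiding_def r_def)
  have "X1 (tensor F [r]) = 0"
    using lambda1_prepend1 [OF F wa, of x "vec1 F"] prepend1_vec1 [OF F wa] x_vec prepend1_zero [OF F wa]
    by (simp add: free_product_pair.X1 [OF free_product_pair_axioms])
  moreover have "P (tensor F [r]) = 0"
    using type_proj_tensor [OF F red, of first_level] by (simp add: P_def r_def)
  ultimately have "z (tensor F [r]) = 0"
    by (simp add: z_def bop_rep)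
  then have "sqrt_op z (sqrt_op z (tensor F [r])) = 0"
    using sqrt_op_square [OF z_pos] by (metis times_bop.rep_eq)
  then have "cinner (sqrt_op z (tensor F [r])) (sqrt_op z (tensor F [r])) = 0"
    using selfadjoint_sqrt_op [OF z_pos] by (simp add: selfadjoint_op_def)
  then have "sqrt_op z (tensor F [r]) = 0"
    by simp
  then show ?thesis
    by (simp add: Y_def bop_rep sqrt_z_vac X2_vac bop_add bop_scaleC)
qed

text \<open>If a marginal is the point mass at 0, the vacuum is an eigenvector of \<open>Y\<close>:
  with eigenvalue the mean of \<open>X2\<close> if X1 \<xi> = 0, and 0 if X2 \<xi> = 0. Otherwise
  the laws of \<open>Y\<close> and of its counterpart for the exchanged factors form the s-free
  pair.\<close>

lemma distribution_Y_s_free: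
  assumes mu1: "has_distribution (vector_state vac) X1 \<mu>1" and mu2: "has_distribution (vector_state vac) X2 \<mu>2"
  shows "has_distribution (vector_state vac) Y (s_free_mult_conv \<mu>2 \<mu>1)"
proof -
  have pos: "nonneg_support \<mu>1" "nonneg_support \<mu>2"
    using nonneg_distribution X1_pos X2_pos mu1 mu2 by blast+
  have meas: "prob_real \<mu>1" "prob_real \<mu>2"
    using mu1 mu2 by (simp_all add: has_distribution_def)
  have mean: "vector_state vac X2 = of_real (\<integral>t. t \<partial>\<mu>2)"
    using has_distribution_moment [OF mu2, of 1] by simp
  consider "\<mu>1 = delta 0" | "\<mu>1 \<noteq> delta 0" "\<mu>2 = delta 0" | "\<mu>1 \<noteq> delta 0" "\<mu>2 \<noteq> delta 0"
    by blast
  then show ?thesis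
  proof cases
    case 1
    then have "X1 vac = 0"
      using delta_0_state [of X1 0] mu1 X1_pos by (intro positive_state_zero) auto
    then have "Y vac = of_real (\<integral>t. t \<partial>\<mu>2) *\<^sub>C vac"
      using Y_vac_degenerate mean by simp
    then show ?thesis
      using 1 has_distribution_delta by (simp add: s_free_mult_conv_def)
  next
    case 2
    then have "X2 vac = 0"
      using delta_0_state [of X2 0] mu2 X2_pos by (intro positive_state_zero) auto
    then have "Y vac = of_real 0 *\<^sub>C vac"
      by (simp add: Y_def bop_rep sqrt_z_vac complex_vector.scale_zero_left)
    then show ?thesis
      using 2 has_distribution_delta [of Y 0] by (simp add: s_free_mult_conv_def)
  next
    case 3
    interpret swap: free_product_pair "swap_product F" y0 x X2 X1
      using F X1 X2 X1_pos X2_pos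
      by unfold_locales (simp_all add: is_free_product_swap lambda2_swap)
    have vac_swap [simp]: "swap.vac = vac"
      by (simp add: swap.vac_def vac_def)
    obtain \<sigma> where \<sigma>: "has_distribution (vector_state vac) Y \<sigma>" "nonneg_support \<sigma>"
      using positive_op_has_distribution [OF Y_pos norm_vac] by blast
    obtain \<tau> where \<tau>: "has_distribution (vector_state vac) swap.Y \<tau>" "nonneg_support \<tau>"
      using positive_op_has_distribution [OF swap.Y_pos norm_vac] by blast
    obtain \<rho> where \<rho>: "has_distribution (vector_state vac) W \<rho>" "nonneg_support \<rho>"
      using positive_op_has_distribution [OF W_pos norm_vac] by blast
    \<comment> \<open>Both \<open>W\<close> and its exchanged counterpart have the moments of X1
      X2.\<close>
    have \<rho>': "has_distribution (vector_state vac) swap.W \<rho>"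
      using \<rho>(1) distribution_W' swap.distribution_W by (simp add: has_distribution_def)
    \<comment> \<open>The mean of \<open>Y\<close> is that of \<open>X2\<close>, which is nonzero
      since \<mu>2 lives on the half-line and is not the point mass at 0.\<close>
    have \<sigma>0: "\<sigma> \<noteq> delta 0"
      using delta_0_state [of Y 0] \<sigma>(1) state_Y state_nonzero [OF mu2 pos(2) 3(2)] by auto
    have \<tau>0: "\<tau> \<noteq> delta 0"
      using delta_0_state [of swap.Y 0] \<tau>(1) swap.state_Y state_nonzero [OF mu1 pos(1) 3(1)] by auto
    have conv: "free_mult_conv \<mu>2 \<mu>1 = \<rho>"
      by (rule free_mult_conv_W [OF mu1 mu2 \<rho>])
    have "s_free_mult_conv_pair \<mu>2 \<mu>1 \<sigma> \<tau>"
      unfolding s_free_mult_conv_pair_def conv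
      using \<sigma> \<sigma>0 \<tau> \<tau>0 eta_transform_W [OF mu1 pos(1) \<sigma> \<sigma>0 \<rho>]
        swap.eta_transform_W [of \<mu>2 \<tau> \<rho>] mu2 pos(2) \<rho>' \<rho>(2)
      by (auto simp: has_distribution_def [of _ _ \<sigma>] has_distribution_def [of _ _ \<tau>])
    then have "s_free_mult_conv \<mu>2 \<mu>1 = \<sigma>"
      by (rule s_free_mult_conv_eqI [OF meas(2) pos(2) 3(2) meas(1) pos(1) 3(1)])
    then show ?thesis
      using \<sigma>(1) by simp
  qed
qed

end

theorem mainTheorem1:
  fixes F :: "('a::complex_hilbert, 'b::complex_hilbert, 'h::complex_hilbert) free_product"
    and x :: "'a bop" and y0 :: "'b bop" and X1 X2 R1 R2 :: "'h bop"
    and \<phi> :: "'h bop \<Rightarrow> complex" and \<mu>1 \<mu>2 :: "real measure"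
  assumes "is_free_product F"
    and \<phi>: "\<phi> = vector_state (vacuum F)"
    and X1: "X1 = lambda1 F x" and X2: "X2 = lambda2 F y0"
    and "has_distribution \<phi> X1 \<mu>1" and "has_distribution \<phi> X2 \<mu>2"
    and "positive_op X1" and "positive_op X2"
    and R1: "R1 = R1_even F X1" and R2: "R2 = R2_odd F X2"
  shows "(\<exists>y Y :: 'h bop. positive_op y \<and> positive_op Y \<and>
        sqrt_op X1 * X2 * sqrt_op X1 = sqrt_op y * Y * sqrt_op y \<and>
        has_distribution \<phi> y \<mu>1 \<and>
        has_distribution \<phi> Y (s_free_mult_conv \<mu>2 \<mu>1) \<and>
        monotone_independent \<phi> (y - 1) (Y - 1) \<and>
        distribution \<phi> Y = distribution \<phi> (sqrt_op R1 * R2 * sqrt_op R1))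
    \<and> (\<forall>k :: 'b. cinner k (vec2 F) = 0 \<and> norm k = 1 \<longrightarrow>
        s_free_pair (projection (s_free_Fock F I2)) \<phi> (vector_state (tensor F [Inr k]))
          (R2 - projection (s_free_Fock F I2)) (R1 - projection (s_free_Fock F I2)))"
proof -
  interpret pair: free_product_pair F x y0 X1 X2
    using assms by unfold_locales
  have \<phi>_vac: "\<phi> = vector_state pair.vac"
    by (simp add: \<phi> pair.vac_def)
  have "has_distribution \<phi> pair.y \<mu>1"
    using assms(5) pair.distribution_y by (simp add: has_distribution_def \<phi>_vac)
  moreover have "has_distribution \<phi> pair.Y (s_free_mult_conv \<mu>2 \<mu>1)"
    using assms(5,6) pair.distribution_Y_s_free by (simp add: \<phi>_vac)
  moreover have "distribution \<phi> pair.Y = distribution \<phi> (sqrt_op R1 * R2 * sqrt_op R1)"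
    using pair.distribution_Y by (simp add: \<phi>_vac R1 R2)
  moreover have "s_free_pair (projection (s_free_Fock F I2)) \<phi> (vector_state (tensor F [Inr k]))
      (R2 - projection (s_free_Fock F I2)) (R1 - projection (s_free_Fock F I2))"
    if "cinner k (vec2 F) = 0 \<and> norm k = 1" for k
    using pair.s_free_Q that
    by (simp add: \<phi>_vac R1 R2 projection_s_free_Fock [OF assms(1)] pair.Q_def)
  ultimately show ?thesis
    using pair.y_pos pair.Y_pos pair.decomposition pair.monotone
    unfolding \<phi>_vac by blast
qed

end
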